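(* Let $n\ge 2$, let $(M^n,g)$ be an $n$-dimensional oriented conformally flat Riemannian manifold and let $\boldsymbol{p}:M^n\to\Lambda^{n+1}$ be an isometric immersion into the light-cone $\Lambda^{n+1}\subset\mathbb{R}^{n+2}_1$. Let $N^{n+1}=\mathbb{R}\times M^n$ be the null-space with respect to $\boldsymbol{p}$, with its degenerate metric $g_N$, and regard $\boldsymbol{p}$ as the isometric embedding $\iota:M^n\to N^{n+1}$, $\iota(x)=(0,x)$. Then the following statements are equivalent: (a) The scalar curvature $S$ of $(M^n,g)$ is identically zero. (b) For any compactly supported variation of $\boldsymbol{p}$ in $N^{n+1}$, the first variation of the volume is zero. Moreover, if one of these two conditions holds, then the second variation of the volume is nonpositive for any compactly supported variation of $\boldsymbol{p}$ in $N^{n+1}$.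
   Context: $\mathbb{R}^{n+2}_1$ is the Minkowski spacetime of signature $(-,+,\dots,+)$ with Lorentzian inner product $\langle\cdot,\cdot\rangle$, and $\Lambda^{n+1}=\{\boldsymbol{x}\in\mathbb{R}^{n+2}_1 : \langle \boldsymbol{x},\boldsymbol{x}\rangle=0\}$ is the light-cone. An isometric immersion $\boldsymbol{p}:M^n\to\Lambda^{n+1}$ is a smooth immersion $\boldsymbol{p}:M^n\to\mathbb{R}^{n+2}_1$ with image in $\Lambda^{n+1}$ such that $\boldsymbol{p}^*\langle\cdot,\cdot\rangle=g$. Tangent vectors of $M^n$ are identified with vectors of $\mathbb{R}^{n+2}_1$ via $d\boldsymbol{p}$. Dual map: there is a unique smooth map $\boldsymbol{q}:M^n\to\Lambda^{n+1}$ with $\langle\boldsymbol{p},\boldsymbol{q}\rangle=1$ and $\langle d\boldsymbol{p}(X),\boldsymbol{q}\rangle=0$ for all tangent vector fields $X$ on $M^n$; it is called the dual map of $\boldsymbol{p}$. Null-space: the extended ruled map is $\Phi_{\boldsymbol{p}}:\mathbb{R}\times M^n\to\mathbb{R}^{n+2}_1$, $\Phi_{\boldsymbol{p}}(t,x)=\boldsymbol{p}(x)+t\,\boldsymbol{q}(x)$. The null-space with respect to $\boldsymbol{p}$ is $N^{n+1}:=\mathbb{R}\times M^n$ equipped with the (degenerate) symmetric tensor $g_N:=\Phi_{\boldsymbol{p}}^*\langle\cdot,\cdot\rangle$. The map $\iota(x)=(0,x)$ satisfies $\Phi_{\boldsymbol{p}}\circ\iota=\boldsymbol{p}$ and $\iota^*g_N=g$.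 Variations: a variation of $\boldsymbol{p}$ in $N^{n+1}$ is a smooth map $G:(-\varepsilon,\varepsilon)\times M^n\to N^{n+1}$ (for some $\varepsilon>0$) with $G(0,x)=(0,x)$ for all $x\in M^n$, such that for each $t$ the map $G(t,\cdot)$ is a spacelike immersion, i.e. $g_t:=G(t,\cdot)^*g_N$ is a Riemannian metric on $M^n$. It is compactly supported if there is a compact set $K\subset M^n$ with $G(t,x)=(0,x)$ for all $t$ and all $x\in M^n\setminus K$. With $dV_t$ the volume form of $(M^n,g_t)$, put $\mathrm{Vol}(t)=\int_{K}dV_t$. The first and second variations of the volume are $\frac{d}{dt}\big|_{t=0}\mathrm{Vol}(t)$ and $\frac{d^2}{dt^2}\big|_{t=0}\mathrm{Vol}(t)$. *)

theory Defs
  imports "HOL-Analysis.Analysis"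
begin

section \<open>Smooth functions on open subsets of Euclidean spaces\<close>

primrec Ck_on :: "nat \<Rightarrow> 'a::euclidean_space set \<Rightarrow> ('a \<Rightarrow> 'b::euclidean_space) \<Rightarrow> bool" where
  "Ck_on 0 S f \<longleftrightarrow> continuous_on S f"
| "Ck_on (Suc k) S f \<longleftrightarrow>
     (\<forall>y\<in>S. f differentiable (at y)) \<and> (\<forall>v. Ck_on k S (\<lambda>y. frechet_derivative f (at y) v))"

text \<open>Only used for open \<open>S\<close>.\<close>

definition smooth_on :: "'a::euclidean_space set \<Rightarrow> ('a \<Rightarrow> 'b::euclidean_space) \<Rightarrow> bool" where
  "smooth_on S f \<longleftrightarrow> (\<forall>k. Ck_on k S f)"


section \<open>Smooth manifolds\<close>

text \<open>
  A manifold is a Hausdorff, second countable type together with a smooth atlas modelled on a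
  Euclidean space. The values of the coordinate map of a chart outside its domain are irrelevant.
\<close>

type_synonym ('m, 'e) chart = "'m set \<times> ('m \<Rightarrow> 'e)"

definition cdom :: "('m, 'e) chart \<Rightarrow> 'm set" where
  "cdom c = fst c"

definition cmap :: "('m, 'e) chart \<Rightarrow> 'm \<Rightarrow> 'e" where
  "cmap c = snd c"

definition cran :: "('m, 'e) chart \<Rightarrow> 'e set" where
  "cran c = cmap c ` cdom c"

definition cinv :: "('m, 'e) chart \<Rightarrow> 'e \<Rightarrow> 'm" where
  "cinv c = inv_into (cdom c) (cmap c)"

definition is_chart :: "('m::topological_space, 'e::euclidean_space) chart \<Rightarrow> bool" where
  "is_chart c \<longleftrightarrow> open (cdom c) \<and> open (cran c) \<and>
     homeomorphism (cdom c) (cran c) (cmap c) (cinv c)"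

definition transition :: "('m, 'e) chart \<Rightarrow> ('m, 'e) chart \<Rightarrow> 'e \<Rightarrow> 'e" where
  "transition c d = cmap d \<circ> cinv c"

definition smooth_atlas :: "('m::topological_space, 'e::euclidean_space) chart set \<Rightarrow> bool" where
  "smooth_atlas A \<longleftrightarrow>
     (\<forall>c\<in>A. is_chart c) \<and> (\<Union>c\<in>A. cdom c) = UNIV \<and>
     (\<forall>c\<in>A. \<forall>d\<in>A. smooth_on (cmap c ` (cdom c \<inter> cdom d)) (transition c d))"

definition oriented_atlas ::
    "('m::topological_space, real ^ 'n::finite) chart set \<Rightarrow> bool" where
  "oriented_atlas A \<longleftrightarrow> smooth_atlas A \<and>
     (\<forall>c\<in>A. \<forall>d\<in>A. \<forall>y\<in>cmap c ` (cdom c \<inter> cdom d).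
        det (matrix (frechet_derivative (transition c d) (at y))) > 0)"

definition chart_at :: "('m, 'e) chart set \<Rightarrow> 'm \<Rightarrow> ('m, 'e) chart" where
  "chart_at A x = (SOME c. c \<in> A \<and> x \<in> cdom c)"

definition euclidean_atlas :: "('e::euclidean_space, 'e) chart set" where
  "euclidean_atlas = {(UNIV, id)}"

text \<open>The product manifold \<open>\<real> \<times> M\<close>.\<close>

definition line_times_atlas :: "('m, 'e) chart set \<Rightarrow> (real \<times> 'm, real \<times> 'e) chart set" where
  "line_times_atlas A = (\<lambda>c. (UNIV \<times> cdom c, \<lambda>(s, x). (s, cmap c x))) ` A"

text \<open>Smoothness of a map between manifolds on an open set \<open>W\<close>.\<close>

definition smooth_map_on ::
    "('m::topological_space, 'e::euclidean_space) chart set \<Rightarrow>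
     ('k::topological_space, 'f::euclidean_space) chart set \<Rightarrow> 'm set \<Rightarrow> ('m \<Rightarrow> 'k) \<Rightarrow> bool" where
  "smooth_map_on A B W F \<longleftrightarrow>
     (\<forall>x\<in>W. \<exists>c\<in>A. \<exists>d\<in>B. \<exists>V. open V \<and> x \<in> V \<and> V \<subseteq> W \<inter> cdom c \<and> F ` V \<subseteq> cdom d \<and>
        smooth_on (cmap c ` V) (cmap d \<circ> F \<circ> cinv c))"

definition smooth_near ::
    "('m::topological_space, 'e::euclidean_space) chart set \<Rightarrow> 'm \<Rightarrow>
     ('m \<Rightarrow> 'b::euclidean_space) \<Rightarrow> bool" where
  "smooth_near A x f \<longleftrightarrow> (\<exists>V. open V \<and> x \<in> V \<and> smooth_map_on A euclidean_atlas V f)"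


section \<open>Tangent vectors and differentials\<close>

text \<open>
  A tangent vector at \<open>x\<close> is a directional derivative, acting on the real functions that are
  smooth near \<open>x\<close>. By convention it maps all other functions to \<open>0\<close>, so that equality of
  tangent vectors at \<open>x\<close> is equality of HOL functions.
\<close>

type_synonym 'm tangent = "('m \<Rightarrow> real) \<Rightarrow> real"

definition coord_vector ::
    "('m::topological_space, 'e::euclidean_space) chart set \<Rightarrow> ('m, 'e) chart \<Rightarrow> 'm \<Rightarrow> 'e \<Rightarrow>
     'm tangent" where
  "coord_vector A c x u =
     (\<lambda>f. if smooth_near A x f then frechet_derivative (f \<circ> cinv c) (at (cmap c x)) u else 0)"

definition tangent_space ::
    "('m::topological_space, 'e::euclidean_space) chart set \<Rightarrow> 'm \<Rightarrow> 'm tangent set" where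
  "tangent_space A x = {coord_vector A c x u |c u. c \<in> A \<and> x \<in> cdom c}"

definition coord_frame ::
    "('m::topological_space, real ^ 'n::finite) chart set \<Rightarrow> ('m, real ^ 'n) chart \<Rightarrow> 'm \<Rightarrow> 'n \<Rightarrow>
     'm tangent" where
  "coord_frame A c x i = coord_vector A c x (axis i 1)"

text \<open>The differential at \<open>x\<close> of a map \<open>F\<close> into the manifold with atlas \<open>B\<close>.\<close>

definition pushforward ::
    "('k::topological_space, 'f::euclidean_space) chart set \<Rightarrow> ('m \<Rightarrow> 'k) \<Rightarrow> 'm \<Rightarrow> 'm tangent \<Rightarrow>
     'k tangent" where
  "pushforward B F x X = (\<lambda>f. if smooth_near B (F x) f then X (f \<circ> F) else 0)"

text \<open>
  The differential of a vector-valued map, the tangent spaces of the target being identified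
  with the vector space itself.
\<close>

definition vdiff :: "('m \<Rightarrow> 'b::euclidean_space) \<Rightarrow> 'm tangent \<Rightarrow> 'b" where
  "vdiff F X = (\<Sum>b\<in>Basis. X (\<lambda>y. F y \<bullet> b) *\<^sub>R b)"


section \<open>Riemannian metrics and curvature\<close>

type_synonym 'm tensor2 = "'m \<Rightarrow> 'm tangent \<Rightarrow> 'm tangent \<Rightarrow> real"

definition riemannian_metric ::
    "('m::topological_space, 'e::euclidean_space) chart set \<Rightarrow> 'm tensor2 \<Rightarrow> bool" where
  "riemannian_metric A g \<longleftrightarrow>
     (\<forall>x. \<forall>X\<in>tangent_space A x. \<forall>Y\<in>tangent_space A x. g x X Y = g x Y X) \<and>
     (\<forall>x. \<forall>X\<in>tangent_space A x. \<forall>Y\<in>tangent_space A x. \<forall>Z\<in>tangent_space A x. \<forall>a b.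
        g x (\<lambda>f. a * X f + b * Y f) Z = a * g x X Z + b * g x Y Z) \<and>
     (\<forall>x. \<forall>X\<in>tangent_space A x. X \<noteq> (\<lambda>_. 0) \<longrightarrow> g x X X > 0) \<and>
     (\<forall>c\<in>A. \<forall>u v. smooth_on (cran c)
        (\<lambda>y. g (cinv c y) (coord_vector A c (cinv c y) u) (coord_vector A c (cinv c y) v)))"

definition pullback ::
    "('k::topological_space, 'f::euclidean_space) chart set \<Rightarrow> ('m \<Rightarrow> 'k) \<Rightarrow> 'k tensor2 \<Rightarrow>
     'm tensor2" where
  "pullback B F h = (\<lambda>x X Y. h (F x) (pushforward B F x X) (pushforward B F x Y))"

text \<open>The matrix of components of \<open>g\<close> in the chart \<open>c\<close>, as a function of the coordinates.\<close>

definition local_metric ::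
    "('m::topological_space, real ^ 'n::finite) chart set \<Rightarrow> 'm tensor2 \<Rightarrow> ('m, real ^ 'n) chart \<Rightarrow>
     real ^ 'n \<Rightarrow> real ^ 'n ^ 'n" where
  "local_metric A g c y =
     (\<chi> i j. g (cinv c y) (coord_frame A c (cinv c y) i) (coord_frame A c (cinv c y) j))"

text \<open>
  Local conformal flatness. The isothermal charts need only be compatible with the smooth
  structure, not members of the given atlas (nor positively oriented).
\<close>

definition conformally_flat ::
    "('m::topological_space, real ^ 'n::finite) chart set \<Rightarrow> 'm tensor2 \<Rightarrow> bool" where
  "conformally_flat A g \<longleftrightarrow>
     (\<forall>x. \<exists>c \<rho>. smooth_atlas (insert c A) \<and> x \<in> cdom c \<and> smooth_on (cran c) \<rho> \<and>
        (\<forall>y\<in>cran c. \<rho> y > 0 \<and> local_metric A g c y = \<rho> y *\<^sub>R mat 1))"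

definition partial :: "'n::finite \<Rightarrow> (real ^ 'n \<Rightarrow> real) \<Rightarrow> real ^ 'n \<Rightarrow> real" where
  "partial i f y = frechet_derivative f (at y) (axis i 1)"

text \<open>
  \<open>christoffel h k i j\<close> is $\Gamma^k_{ij}$ and \<open>riemann h l k i j\<close> is the component
  $R^l{}_{kij}$ of $R(\partial_i, \partial_j)\partial_k$, for a metric with component matrix \<open>h\<close>.
\<close>

definition christoffel ::
    "(real ^ 'n::finite \<Rightarrow> real ^ 'n ^ 'n) \<Rightarrow> 'n \<Rightarrow> 'n \<Rightarrow> 'n \<Rightarrow> real ^ 'n \<Rightarrow> real" where
  "christoffel h k i j y =
     (\<Sum>l\<in>UNIV. matrix_inv (h y) $ k $ l *
        (partial i (\<lambda>z. h z $ j $ l) y + partial j (\<lambda>z. h z $ i $ l) y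
          - partial l (\<lambda>z. h z $ i $ j) y)) / 2"

definition riemann ::
    "(real ^ 'n::finite \<Rightarrow> real ^ 'n ^ 'n) \<Rightarrow> 'n \<Rightarrow> 'n \<Rightarrow> 'n \<Rightarrow> 'n \<Rightarrow> real ^ 'n \<Rightarrow> real" where
  "riemann h l k i j y =
     partial i (christoffel h l j k) y - partial j (christoffel h l i k) y +
     (\<Sum>m\<in>UNIV. christoffel h l i m y * christoffel h m j k y
               - christoffel h l j m y * christoffel h m i k y)"

definition ricci ::
    "(real ^ 'n::finite \<Rightarrow> real ^ 'n ^ 'n) \<Rightarrow> 'n \<Rightarrow> 'n \<Rightarrow> real ^ 'n \<Rightarrow> real" where
  "ricci h j k y = (\<Sum>i\<in>UNIV. riemann h i k i j y)"

text \<open>The value does not depend on the chart in which it is computed.\<close>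

definition scalar_curvature ::
    "('m::topological_space, real ^ 'n::finite) chart set \<Rightarrow> 'm tensor2 \<Rightarrow> 'm \<Rightarrow> real" where
  "scalar_curvature A g x =
     (let c = chart_at A x; h = local_metric A g c; y = cmap c x
      in \<Sum>j\<in>UNIV. \<Sum>k\<in>UNIV. matrix_inv (h y) $ j $ k * ricci h j k y)"


section \<open>Integration of top-degree forms and Riemannian volume\<close>

text \<open>
  The value of the volume form on a frame \<open>E\<close> is the square root of its Gram determinant, with
  the sign given by the orientation. Note that \<open>E i (\<lambda>z. cmap c z $ j)\<close> is the \<open>j\<close>-th component
  of \<open>E i\<close> in the chart \<open>c\<close>.
\<close>

definition volume_form ::
    "('m::topological_space, real ^ 'n::finite) chart set \<Rightarrow> 'm tensor2 \<Rightarrow> 'm \<Rightarrow> ('n \<Rightarrow> 'm tangent) \<Rightarrow>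
     real" where
  "volume_form A h x E =
     sgn (det (\<chi> i j. E i (\<lambda>z. cmap (chart_at A x) z $ j))) *
     sqrt (det (\<chi> i j. h x (E i) (E j)))"

text \<open>
  Integral of an $n$-form over a compact set: cut the set into finitely many Borel pieces, each
  lying in a chart of the oriented atlas, and integrate there the coefficient of the form with
  respect to the coordinate frame. The result does not depend on the decomposition.
\<close>

definition has_form_integral ::
    "('m::topological_space, real ^ 'n::finite) chart set \<Rightarrow> ('m \<Rightarrow> ('n \<Rightarrow> 'm tangent) \<Rightarrow> real) \<Rightarrow>
     'm set \<Rightarrow> real \<Rightarrow> bool" where
  "has_form_integral A \<omega> K I \<longleftrightarrow>
     (\<exists>(N::nat) c B.
        (\<forall>i<N. c i \<in> A \<and> B i \<in> sets borel \<and> B i \<subseteq> cdom (c i) \<and>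
           set_integrable lborel (cmap (c i) ` B i)
             (\<lambda>y. \<omega> (cinv (c i) y) (coord_frame A (c i) (cinv (c i) y)))) \<and>
        disjoint_family_on B {..<N} \<and> (\<Union>i<N. B i) = K \<and>
        I = (\<Sum>i<N. set_lebesgue_integral lborel (cmap (c i) ` B i)
             (\<lambda>y. \<omega> (cinv (c i) y) (coord_frame A (c i) (cinv (c i) y)))))"

definition form_integral ::
    "('m::topological_space, real ^ 'n::finite) chart set \<Rightarrow> ('m \<Rightarrow> ('n \<Rightarrow> 'm tangent) \<Rightarrow> real) \<Rightarrow>
     'm set \<Rightarrow> real" where
  "form_integral A \<omega> K = (THE I. has_form_integral A \<omega> K I)"

definition volume ::
    "('m::topological_space, real ^ 'n::finite) chart set \<Rightarrow> 'm tensor2 \<Rightarrow> 'm set \<Rightarrow> real" where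
  "volume A h K = form_integral A (volume_form A h) K"


section \<open>The light-cone, the dual map and the null-space\<close>

text \<open>Minkowski spacetime of dimension $n + 2$; the first component is the time coordinate.\<close>

type_synonym 'n minkowski = "real \<times> real \<times> (real ^ 'n)"

definition lorentz :: "'n::finite minkowski \<Rightarrow> 'n minkowski \<Rightarrow> real" where
  "lorentz v w = - (fst v * fst w) + snd v \<bullet> snd w"

definition light_cone :: "'n::finite minkowski set" where
  "light_cone = {v. lorentz v v = 0}"

definition lorentz_pullback :: "('k \<Rightarrow> 'n::finite minkowski) \<Rightarrow> 'k tensor2" where
  "lorentz_pullback F = (\<lambda>x X Y. lorentz (vdiff F X) (vdiff F Y))"

definition isometric_immersion_in_light_cone ::
    "('m::topological_space, real ^ 'n::finite) chart set \<Rightarrow> 'm tensor2 \<Rightarrow> ('m \<Rightarrow> 'n minkowski) \<Rightarrow>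
     bool" where
  "isometric_immersion_in_light_cone A g p \<longleftrightarrow>
     smooth_map_on A euclidean_atlas UNIV p \<and>
     (\<forall>x. inj_on (vdiff p) (tangent_space A x)) \<and>
     range p \<subseteq> light_cone \<and>
     (\<forall>x. \<forall>X\<in>tangent_space A x. \<forall>Y\<in>tangent_space A x. lorentz_pullback p x X Y = g x X Y)"

definition is_dual_map ::
    "('m::topological_space, real ^ 'n::finite) chart set \<Rightarrow> ('m \<Rightarrow> 'n minkowski) \<Rightarrow>
     ('m \<Rightarrow> 'n minkowski) \<Rightarrow> bool" where
  "is_dual_map A p q \<longleftrightarrow>
     smooth_map_on A euclidean_atlas UNIV q \<and> range q \<subseteq> light_cone \<and>
     (\<forall>x. lorentz (p x) (q x) = 1) \<and>
     (\<forall>x. \<forall>X\<in>tangent_space A x. lorentz (vdiff p X) (q x) = 0)"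

definition dual_map ::
    "('m::topological_space, real ^ 'n::finite) chart set \<Rightarrow> ('m \<Rightarrow> 'n minkowski) \<Rightarrow>
     'm \<Rightarrow> 'n minkowski" where
  "dual_map A p = (THE q. is_dual_map A p q)"

definition extended_ruled_map ::
    "('m::topological_space, real ^ 'n::finite) chart set \<Rightarrow> ('m \<Rightarrow> 'n minkowski) \<Rightarrow>
     real \<times> 'm \<Rightarrow> 'n minkowski" where
  "extended_ruled_map A p = (\<lambda>(s, x). p x + s *\<^sub>R dual_map A p x)"

text \<open>
  The null-space is the manifold \<open>\<real> \<times> M\<close>, with atlas \<open>line_times_atlas A\<close>, and the following
  degenerate metric.
\<close>

definition null_metric ::
    "('m::topological_space, real ^ 'n::finite) chart set \<Rightarrow> ('m \<Rightarrow> 'n minkowski) \<Rightarrow>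
     (real \<times> 'm) tensor2" where
  "null_metric A p = lorentz_pullback (extended_ruled_map A p)"


section \<open>Variations\<close>

definition variation_metric ::
    "('m::topological_space, real ^ 'n::finite) chart set \<Rightarrow> ('m \<Rightarrow> 'n minkowski) \<Rightarrow>
     (real \<Rightarrow> 'm \<Rightarrow> real \<times> 'm) \<Rightarrow> real \<Rightarrow> 'm tensor2" where
  "variation_metric A p G t = pullback (line_times_atlas A) (G t) (null_metric A p)"

definition variation ::
    "('m::topological_space, real ^ 'n::finite) chart set \<Rightarrow> ('m \<Rightarrow> 'n minkowski) \<Rightarrow> real \<Rightarrow>
     (real \<Rightarrow> 'm \<Rightarrow> real \<times> 'm) \<Rightarrow> bool" where
  "variation A p \<epsilon> G \<longleftrightarrow> \<epsilon> > 0 \<and>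
     smooth_map_on (line_times_atlas A) (line_times_atlas A) ({-\<epsilon><..<\<epsilon>} \<times> UNIV) (\<lambda>(t, x). G t x) \<and>
     (\<forall>x. G 0 x = (0, x)) \<and>
     (\<forall>t\<in>{-\<epsilon><..<\<epsilon>}. riemannian_metric A (variation_metric A p G t))"

definition variation_supported_in ::
    "real \<Rightarrow> (real \<Rightarrow> 'm::topological_space \<Rightarrow> real \<times> 'm) \<Rightarrow> 'm set \<Rightarrow> bool" where
  "variation_supported_in \<epsilon> G K \<longleftrightarrow>
     compact K \<and> (\<forall>t\<in>{-\<epsilon><..<\<epsilon>}. \<forall>x. x \<notin> K \<longrightarrow> G t x = (0, x))"

definition variation_volume ::
    "('m::topological_space, real ^ 'n::finite) chart set \<Rightarrow> ('m \<Rightarrow> 'n minkowski) \<Rightarrow>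
     (real \<Rightarrow> 'm \<Rightarrow> real \<times> 'm) \<Rightarrow> 'm set \<Rightarrow> real \<Rightarrow> real" where
  "variation_volume A p G K t = volume A (variation_metric A p G t) K"

definition volume_stationary ::
    "('m::topological_space, real ^ 'n::finite) chart set \<Rightarrow> ('m \<Rightarrow> 'n minkowski) \<Rightarrow> bool" where
  "volume_stationary A p \<longleftrightarrow>
     (\<forall>\<epsilon> G K. variation A p \<epsilon> G \<and> variation_supported_in \<epsilon> G K \<longrightarrow>
        (variation_volume A p G K has_real_derivative 0) (at 0))"

definition has_second_real_derivative :: "(real \<Rightarrow> real) \<Rightarrow> real \<Rightarrow> real \<Rightarrow> bool" where
  "has_second_real_derivative f D t0 \<longleftrightarrow>
     (\<exists>f'. (\<forall>\<^sub>F t in nhds t0. (f has_real_derivative f' t) (at t)) \<and>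
           (f' has_real_derivative D) (at t0))"

end

theory Submission
  imports Defs
begin

text \<open>
  Let \<open>q\<close> be the dual map, so that \<open>q\<close> is orthogonal to \<open>dp\<close>, \<open>dq\<close> and itself, and \<open>dq = W dp\<close> with a
  self-adjoint \<open>W\<close>. The Gauss equation for the null normal frame \<open>p, q\<close> gives \<open>S = 2 (n - 1) tr W\<close>.
  For a variation \<open>G t = (\<phi> t, \<psi> t)\<close> the volume form of the induced metric is
  \<open>det (1 + \<phi> t W) \<psi> t\<^sup>* dV\<close>, where \<open>W\<close> is taken at \<open>\<psi> t\<close>. If \<open>tr W = 0\<close> then
  \<open>det (1 + s W) \<le> 1\<close> for small \<open>s\<close>, and for small \<open>t\<close> the map \<open>\<psi> t\<close> permutes \<open>K\<close>. Hence
  the volume, which is twice differentiable near \<open>0\<close>, has a local maximum there: its first derivative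
  vanishes and its second derivative is nonpositive, with no need to compute either. Conversely, the
  first variation of \<open>G t x = (t \<eta> x, x)\<close> is \<open>\<integral> \<eta> tr W dV\<close>, which for a bump function \<open>\<eta>\<close> is
  nonzero near a point with \<open>tr W \<noteq> 0\<close>.
\<close>

section \<open>Calculus of smooth functions\<close>

text \<open>The comparison behind the local maximum moves points by \<psi> t, while the volume is a
  definite description over finite Borel decompositions. Its independence of the decomposition,
  which is change of variables along transition maps, has to come before any value is known. It then
  serves twice: with pieces that do not depend on t, which turns the volume into a sum of integrals
  over fixed sets, and with their images under \<psi> t, which decompose the same K. The direction q
  is degenerate for the induced metric, so only the height of G t enters the density and not the
  derivative of the height. The heights must be small uniformly over K; this is expressed as s^2
  tr(W^2) < 1, a bound that survives conjugation. Conformal flatness supplies at each point an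
  isothermal chart, which writes the Gram matrix as R R^T and thereby conjugates W to a symmetric
  matrix. The factor 2 (n - 1) results from contracting Ric = (n - 2) b + (tr W) g with b = <dq,
  dp>; it is nonzero since n \<ge> 2.\<close>

abbreviation dir_deriv ::
    "'a::real_normed_vector \<Rightarrow> ('a \<Rightarrow> 'b::real_normed_vector) \<Rightarrow> 'a \<Rightarrow> 'b" where
  "dir_deriv v f \<equiv> (\<lambda>y. frechet_derivative f (at y) v)"

lemma dir_deriv_eqI: "(f has_derivative f') (at y) \<Longrightarrow> dir_deriv v f y = f' v"
  using frechet_derivative_at by metis

lemma has_derivative_frechet:
  "f differentiable (at y) \<Longrightarrow> (f has_derivative (\<lambda>v. dir_deriv v f y)) (at y)"
  using frechet_derivative_works by fastforce

lemma linear_dir_deriv: "f differentiable (at y) \<Longrightarrow> linear (\<lambda>v. dir_deriv v f y)"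
  by (simp add: linear_frechet_derivative)

lemma differentiable_cong_open:
  assumes "open S" "\<And>y. y \<in> S \<Longrightarrow> f y = g y" "y \<in> S" "f differentiable (at y)"
  shows "g differentiable (at y)"
  using assms has_derivative_transform_within_open unfolding differentiable_def by metis

text \<open>\<open>frechet_derivative\<close> is a choice, so its value depends only on the set of
  derivatives at the point; that set is local, also where it is empty.\<close>

lemma dir_deriv_cong_open:
  assumes "open S" "\<And>y. y \<in> S \<Longrightarrow> f y = g y" "y \<in> S"
  shows "dir_deriv v f y = dir_deriv v g y"
proof -
  have "(f has_derivative D) (at y) \<longleftrightarrow> (g has_derivative D) (at y)" for D
    using assms has_derivative_transform_within_open[OF _ assms(1,3)] by metis
  then show ?thesis by (simp add: frechet_derivative_def)
qed

lemma Ck_on_cong: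
  assumes "open S" "\<And>y. y \<in> S \<Longrightarrow> f y = g y" "Ck_on k S f"
  shows "Ck_on k S g"
  using assms(2,3)
proof (induction k arbitrary: f g)
  case 0
  then show ?case using continuous_on_cong by force
next
  case (Suc k)
  have "g differentiable (at y)" if "y \<in> S" for y
    using differentiable_cong_open[OF assms(1) Suc.prems(1)] that Suc.prems(2) by auto
  moreover have "Ck_on k S (dir_deriv v g)" for v
    using Suc.IH[of "dir_deriv v f" "dir_deriv v g"] dir_deriv_cong_open[OF assms(1) Suc.prems(1)]
      Suc.prems(2) by auto
  ultimately show ?case by auto
qed

lemma Ck_on_subset: "Ck_on k S f \<Longrightarrow> T \<subseteq> S \<Longrightarrow> Ck_on k T f"
  by (induction k arbitrary: f) (auto intro: continuous_on_subset)

lemma Ck_on_imp_continuous_on: "Ck_on k S f \<Longrightarrow> continuous_on S f"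
proof (cases k)
  case (Suc m)
  assume "Ck_on k S f"
  then show ?thesis
    unfolding Suc by (auto intro!: continuous_at_imp_continuous_on differentiable_imp_continuous_within)
qed auto

lemma Ck_on_Suc_imp: "Ck_on (Suc k) S f \<Longrightarrow> Ck_on k S f"
proof (induction k arbitrary: f)
  case 0
  then show ?case using Ck_on_imp_continuous_on Ck_on.simps(1) by blast
next
  case (Suc k)
  then show ?case by (metis Ck_on.simps(2))
qed

lemma Ck_on_locally:
  assumes "\<And>x. x \<in> S \<Longrightarrow> \<exists>T. open T \<and> x \<in> T \<and> Ck_on k T f"
  shows "Ck_on k S f"
  using assms
proof (induction k arbitrary: f)
  case 0
  then show ?case
    by (metis Ck_on.simps(1) continuous_at_imp_continuous_on continuous_on_eq_continuous_at)
next
  case (Suc k)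
  then show ?case by (metis Ck_on.simps(2))
qed

lemma Ck_on_const: "Ck_on k S (\<lambda>x. c)"
proof (induction k arbitrary: c)
  case (Suc k)
  have "dir_deriv v (\<lambda>x. c) = (\<lambda>x. 0)" for v :: 'a by auto
  then show ?case using Suc by simp
qed auto

lemma Ck_on_bounded_linear:
  assumes "bounded_linear h"
  shows "Ck_on k S h"
proof (cases k)
  case 0
  then show ?thesis using assms by (simp add: linear_continuous_on)
next
  case (Suc m)
  have "(h has_derivative h) (at y)" for y
    by (simp add: assms bounded_linear_imp_has_derivative)
  then have "h differentiable (at y)" "dir_deriv v h = (\<lambda>y. h v)" for v y
    by (auto simp: differentiable_def intro!: dir_deriv_eqI ext)
  then show ?thesis using Suc by (simp add: Ck_on_const)
qed

lemma Ck_on_add: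
  assumes "open S" "Ck_on k S f" "Ck_on k S g"
  shows "Ck_on k S (\<lambda>x. f x + g x)"
  using assms(2,3)
proof (induction k arbitrary: f g)
  case 0
  then show ?case by (auto intro: continuous_on_add)
next
  case (Suc k)
  have e: "dir_deriv v f y + dir_deriv v g y = dir_deriv v (\<lambda>x. f x + g x) y" if "y \<in> S" for y v
    using Suc.prems that by (intro dir_deriv_eqI[symmetric] has_derivative_add has_derivative_frechet) auto
  have "Ck_on k S (\<lambda>y. dir_deriv v f y + dir_deriv v g y)" for v
    using Suc.IH Suc.prems by auto
  then have "Ck_on k S (dir_deriv v (\<lambda>x. f x + g x))" for v
    by (rule Ck_on_cong[OF assms(1), rotated]) (simp add: e)
  then show ?case using Suc.prems by simp
qed

lemma Ck_on_sum:
  assumes "open S" "\<And>i. i \<in> I \<Longrightarrow> Ck_on k S (f i)"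
  shows "Ck_on k S (\<lambda>x. \<Sum>i\<in>I. f i x)"
  using assms(2)
proof (induction I rule: infinite_finite_induct)
  case (insert i I)
  then show ?case using Ck_on_add[OF assms(1), of k "f i" "\<lambda>x. \<Sum>i\<in>I. f i x"] by simp
qed (auto simp: Ck_on_const)

lemma Ck_on_bilinear:
  assumes "open S" "bounded_bilinear B" "Ck_on k S f" "Ck_on k S g"
  shows "Ck_on k S (\<lambda>x. B (f x) (g x))"
  using assms(3,4)
proof (induction k arbitrary: f g)
  case 0
  then show ?case using bounded_bilinear.continuous_on[OF assms(2)] by auto
next
  case (Suc k)
  have d: "((\<lambda>x. B (f x) (g x)) has_derivative
      (\<lambda>v. B (f y) (dir_deriv v g y) + B (dir_deriv v f y) (g y))) (at y)" if "y \<in> S" for y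
    using Suc.prems that by (intro bounded_bilinear.FDERIV[OF assms(2)] has_derivative_frechet) auto
  have "Ck_on k S (\<lambda>y. B (f y) (dir_deriv v g y) + B (dir_deriv v f y) (g y))" for v
    using Suc.prems Ck_on_Suc_imp[OF Suc.prems(1)] Ck_on_Suc_imp[OF Suc.prems(2)]
    by (intro Ck_on_add[OF assms(1)] Suc.IH) auto
  then have "Ck_on k S (dir_deriv v (\<lambda>x. B (f x) (g x)))" for v
    by (rule Ck_on_cong[OF assms(1), rotated]) (simp add: dir_deriv_eqI[OF d])
  then show ?case using d by (auto simp: differentiable_def)
qed

lemma Ck_on_compose:
  fixes g :: "'a::euclidean_space \<Rightarrow> 'b::euclidean_space" and f :: "'b \<Rightarrow> 'c::euclidean_space"
  assumes "open S" "open T" "g ` S \<subseteq> T" "Ck_on k T f" "Ck_on k S g"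
  shows "Ck_on k S (\<lambda>x. f (g x))"
  using assms(4,5)
proof (induction k arbitrary: f)
  case 0
  then show ?case using assms(3) continuous_on_compose2 by auto
next
  case (Suc k)
  have d: "((\<lambda>x. f (g x)) has_derivative (\<lambda>v. dir_deriv (dir_deriv v g y) f (g y))) (at y)"
    if "y \<in> S" for y
  proof -
    have "(g has_derivative (\<lambda>v. dir_deriv v g y)) (at y)"
      using Suc.prems(2) that by (simp add: has_derivative_frechet)
    moreover have "(f has_derivative (\<lambda>v. dir_deriv v f (g y))) (at (g y))"
      using Suc.prems(1) that assms(3) by (intro has_derivative_frechet) auto
    ultimately show ?thesis
      using diff_chain_at unfolding o_def by metis
  qed
  \<comment> \<open>The direction \<open>dir_deriv v g y\<close> in which f is differentiated varies
    with y. Its basis expansion leaves only derivatives of f in fixed directions, to which the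
    induction hypothesis applies.\<close>
  have e: "dir_deriv v (\<lambda>x. f (g x)) y = (\<Sum>b\<in>Basis. (dir_deriv v g y \<bullet> b) *\<^sub>R dir_deriv b f (g y))"
    if "y \<in> S" for v y
  proof -
    have "linear (\<lambda>v. dir_deriv v f (g y))"
      using Suc.prems(1) that assms(3) by (intro linear_dir_deriv) auto
    then have "dir_deriv (\<Sum>b\<in>Basis. (dir_deriv v g y \<bullet> b) *\<^sub>R b) f (g y)
        = (\<Sum>b\<in>Basis. (dir_deriv v g y \<bullet> b) *\<^sub>R dir_deriv b f (g y))"
      by (simp add: linear_sum linear_cmul)
    then show ?thesis using dir_deriv_eqI[OF d[OF that]] by (simp add: euclidean_representation)
  qed
  have "Ck_on k S (\<lambda>y. \<Sum>b\<in>Basis. (dir_deriv v g y \<bullet> b) *\<^sub>R dir_deriv b f (g y))" for v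
    using Suc.prems Suc.IH Ck_on_Suc_imp[OF Suc.prems(2)]
    by (intro Ck_on_sum Ck_on_bilinear[OF _ bounded_bilinear_scaleR] assms(1)
        Ck_on_bilinear[OF _ bounded_bilinear_inner] Ck_on_const) auto
  then have "Ck_on k S (dir_deriv v (\<lambda>x. f (g x)))" for v
    by (rule Ck_on_cong[OF assms(1), rotated]) (simp add: e)
  then show ?case using d by (auto simp: differentiable_def)
qed

lemma smooth_on_imp_continuous_on: "smooth_on S f \<Longrightarrow> continuous_on S f"
  unfolding smooth_on_def using Ck_on_imp_continuous_on by blast

lemma smooth_on_differentiable: "smooth_on S f \<Longrightarrow> y \<in> S \<Longrightarrow> f differentiable (at y)"
  unfolding smooth_on_def by (metis Ck_on.simps(2))

lemma smooth_on_has_derivative: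
  "smooth_on S f \<Longrightarrow> y \<in> S \<Longrightarrow> (f has_derivative (\<lambda>v. dir_deriv v f y)) (at y)"
  by (simp add: smooth_on_differentiable has_derivative_frechet)

lemma smooth_on_dir_deriv: "smooth_on S f \<Longrightarrow> smooth_on S (dir_deriv v f)"
  unfolding smooth_on_def by (metis Ck_on.simps(2))

lemma smooth_on_cong:
  "open S \<Longrightarrow> smooth_on S f \<Longrightarrow> (\<And>y. y \<in> S \<Longrightarrow> g y = f y) \<Longrightarrow> smooth_on S g"
  unfolding smooth_on_def by (metis Ck_on_cong)

lemma smooth_on_subset: "smooth_on S f \<Longrightarrow> T \<subseteq> S \<Longrightarrow> smooth_on T f"
  unfolding smooth_on_def using Ck_on_subset by blast

lemma smooth_on_locally:
  assumes "\<And>x. x \<in> S \<Longrightarrow> \<exists>T. open T \<and> x \<in> T \<and> smooth_on T f"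
  shows "smooth_on S f"
  using assms unfolding smooth_on_def by (intro allI Ck_on_locally) metis

lemma smooth_on_const: "smooth_on S (\<lambda>x. c)"
  by (simp add: smooth_on_def Ck_on_const)

lemma smooth_on_bounded_linear: "bounded_linear h \<Longrightarrow> smooth_on S h"
  by (simp add: smooth_on_def Ck_on_bounded_linear)

lemma smooth_on_id: "smooth_on S (\<lambda>x. x)"
  by (simp add: smooth_on_bounded_linear bounded_linear_ident)

lemma smooth_on_add:
  "open S \<Longrightarrow> smooth_on S f \<Longrightarrow> smooth_on S g \<Longrightarrow> smooth_on S (\<lambda>x. f x + g x)"
  by (simp add: smooth_on_def Ck_on_add)

lemma smooth_on_sum:
  "open S \<Longrightarrow> (\<And>i. i \<in> I \<Longrightarrow> smooth_on S (f i)) \<Longrightarrow> smooth_on S (\<lambda>x. \<Sum>i\<in>I. f i x)"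
  by (simp add: smooth_on_def Ck_on_sum)

lemma smooth_on_bilinear:
  "open S \<Longrightarrow> bounded_bilinear B \<Longrightarrow> smooth_on S f \<Longrightarrow> smooth_on S g \<Longrightarrow>
    smooth_on S (\<lambda>x. B (f x) (g x))"
  by (simp add: smooth_on_def Ck_on_bilinear)

lemmas smooth_on_scaleR = smooth_on_bilinear[OF _ bounded_bilinear_scaleR]

lemma smooth_on_mult:
  fixes f g :: "_ \<Rightarrow> real"
  shows "open S \<Longrightarrow> smooth_on S f \<Longrightarrow> smooth_on S g \<Longrightarrow> smooth_on S (\<lambda>x. f x * g x)"
  using smooth_on_scaleR[of S f g] by simp

lemma smooth_on_compose:
  assumes "open S" "open T" "g ` S \<subseteq> T" "smooth_on T f" "smooth_on S g"
  shows "smooth_on S (\<lambda>x. f (g x))"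
  unfolding smooth_on_def
proof
  fix k
  show "Ck_on k S (\<lambda>x. f (g x))"
    by (rule Ck_on_compose[OF assms(1-3)]) (use assms(4,5) in \<open>simp_all add: smooth_on_def\<close>)
qed

lemma smooth_on_linear_compose:
  assumes "bounded_linear h" "open S" "smooth_on S f"
  shows "smooth_on S (\<lambda>x. h (f x))"
  by (rule smooth_on_compose[OF assms(2) open_UNIV _ smooth_on_bounded_linear[OF assms(1)] assms(3)]) simp

lemma smooth_on_uminus:
  assumes "open S" "smooth_on S f"
  shows "smooth_on S (\<lambda>x. - f x)"
  by (rule smooth_on_linear_compose[OF bounded_linear_minus[OF bounded_linear_ident] assms])

lemma smooth_on_diff:
  assumes "open S" "smooth_on S f" "smooth_on S g"
  shows "smooth_on S (\<lambda>x. f x - g x)"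
  using smooth_on_add[OF assms(1,2) smooth_on_uminus[OF assms(1,3)]] by simp

lemma smooth_on_Pair:
  fixes f :: "'a::euclidean_space \<Rightarrow> 'b::euclidean_space" and g :: "'a \<Rightarrow> 'c::euclidean_space"
  assumes "open S" "smooth_on S f" "smooth_on S g"
  shows "smooth_on S (\<lambda>x. (f x, g x))"
proof -
  have l: "bounded_linear (\<lambda>a::'b. (a, 0::'c))" "bounded_linear (\<lambda>b::'c. (0::'b, b))"
    by (intro bounded_linear_intros)+
  have "smooth_on S (\<lambda>x. (f x, 0::'c) + (0::'b, g x))"
    by (intro smooth_on_add assms(1) smooth_on_linear_compose[OF l(1) assms(1,2)]
        smooth_on_linear_compose[OF l(2) assms(1,3)])
  then show ?thesis by simp
qed

lemma smooth_on_prod: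
  fixes f :: "'i \<Rightarrow> 'a::euclidean_space \<Rightarrow> real"
  assumes "open S" "\<And>i. i \<in> I \<Longrightarrow> smooth_on S (f i)"
  shows "smooth_on S (\<lambda>x. \<Prod>i\<in>I. f i x)"
  using assms(2)
proof (induction I rule: infinite_finite_induct)
  case (insert i I)
  then show ?case using smooth_on_mult[OF assms(1), of "f i" "\<lambda>x. \<Prod>i\<in>I. f i x"] by simp
qed (auto simp: smooth_on_const)

lemma Ck_on_inverse_nonzero: "Ck_on k (- {0::real}) inverse"
proof (induction k)
  case 0
  then show ?case by (auto intro!: continuous_intros)
next
  case (Suc k)
  have d: "(inverse has_derivative (\<lambda>v. - (inverse y * v * inverse y))) (at y)"
    if "y \<in> - {0}" for y :: real
    using has_derivative_inverse'[of y UNIV] that by simp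
  have "Ck_on k (- {0}) (\<lambda>y::real. - v *\<^sub>R (inverse y * inverse y))" for v
    by (intro Ck_on_bilinear[OF _ bounded_bilinear_scaleR] Ck_on_bilinear[OF _ bounded_bilinear_mult]
        Ck_on_const Suc) auto
  then have "Ck_on k (- {0}) (dir_deriv v (inverse :: real \<Rightarrow> real))" for v
    by (rule Ck_on_cong[rotated 2]) (auto simp: dir_deriv_eqI[OF d])
  then show ?case using d by (auto simp: differentiable_def)
qed

lemma smooth_on_inverse:
  fixes f :: "'a::euclidean_space \<Rightarrow> real"
  assumes "open S" "smooth_on S f" "\<And>y. y \<in> S \<Longrightarrow> f y \<noteq> 0"
  shows "smooth_on S (\<lambda>y. inverse (f y))"
  by (rule smooth_on_compose[OF assms(1) _ _ _ assms(2), of "- {0}"])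
     (use assms(3) in \<open>auto simp: smooth_on_def Ck_on_inverse_nonzero\<close>)

lemma smooth_on_divide:
  fixes f :: "'a::euclidean_space \<Rightarrow> real"
  assumes "open S" "smooth_on S f" "smooth_on S g" "\<And>y. y \<in> S \<Longrightarrow> g y \<noteq> 0"
  shows "smooth_on S (\<lambda>y. f y / g y)"
  using smooth_on_mult[OF assms(1,2) smooth_on_inverse[OF assms(1,3,4)]] by (simp add: divide_inverse)

lemma Ck_on_sqrt_pos: "Ck_on k {0<..} sqrt"
proof (induction k)
  case 0
  then show ?case by (auto intro!: continuous_intros)
next
  case (Suc k)
  have d: "(sqrt has_derivative (*) (inverse (sqrt y) / 2)) (at y)" if "y \<in> {0<..}" for y
    using DERIV_real_sqrt[of y] that by (simp add: has_field_derivative_def)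
  have "Ck_on k {0<..} (\<lambda>y. inverse (sqrt y))"
    by (rule Ck_on_compose[OF _ _ _ Ck_on_inverse_nonzero Suc]) auto
  then have "Ck_on k {0<..} (\<lambda>y. (v / 2) *\<^sub>R inverse (sqrt y))" for v
    by (intro Ck_on_bilinear[OF _ bounded_bilinear_scaleR] Ck_on_const) auto
  then have "Ck_on k {0<..} (dir_deriv v sqrt)" for v
    by (rule Ck_on_cong[rotated 2]) (auto simp: dir_deriv_eqI[OF d])
  then show ?case using d by (auto simp: differentiable_def)
qed

lemma smooth_on_sqrt:
  assumes "open S" "smooth_on S f" "\<And>y. y \<in> S \<Longrightarrow> f y > 0"
  shows "smooth_on S (\<lambda>y. sqrt (f y))"
  by (rule smooth_on_compose[OF assms(1) _ _ _ assms(2), of "{0<..}"])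
     (use assms(3) in \<open>auto simp: smooth_on_def Ck_on_sqrt_pos\<close>)

section \<open>Smooth dependence of determinants and inverse matrices\<close>

lemma smooth_on_det:
  fixes M :: "'a::euclidean_space \<Rightarrow> real ^ 'n ^ 'n"
  assumes "open S" "\<And>i j. smooth_on S (\<lambda>y. M y $ i $ j)"
  shows "smooth_on S (\<lambda>y. det (M y))"
  unfolding det_def
  by (intro smooth_on_sum smooth_on_mult smooth_on_prod smooth_on_const assms)

lemma matrix_inv_inverse:
  fixes M :: "real ^ 'n ^ 'n"
  assumes "det M \<noteq> 0"
  shows "M ** matrix_inv M = mat 1" "matrix_inv M ** M = mat 1"
proof -
  have "\<exists>M'. M ** M' = mat 1 \<and> M' ** M = mat 1"
    using assms invertible_det_nz invertible_def by blast
  then have "M ** matrix_inv M = mat 1 \<and> matrix_inv M ** M = mat 1"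
    unfolding matrix_inv_def by (rule someI_ex)
  then show "M ** matrix_inv M = mat 1" "matrix_inv M ** M = mat 1" by auto
qed

text \<open>Cramer's rule for a unit vector. It exhibits the entries of the inverse as quotients of
  polynomials in the entries, hence as smooth functions of them.\<close>

lemma matrix_inv_eq_cofactor:
  fixes M :: "real ^ 'n ^ 'n"
  assumes "det M \<noteq> 0"
  shows "matrix_inv M $ k $ l =
    det (\<chi> i j. if j = k then axis l 1 $ i else M $ i $ j) / det M"
proof -
  have "M *v (matrix_inv M *v axis l 1) = axis l 1"
    using assms by (simp add: matrix_vector_mul_assoc matrix_inv_inverse)
  then have "matrix_inv M *v axis l 1
      = (\<chi> k. det (\<chi> i j. if j = k then axis l 1 $ i else M $ i $ j) / det M)"
    using cramer[OF assms] by blast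
  then show ?thesis
    by (metis (no_types, lifting) column_def matrix_vector_mul_component matrix_vector_mult_basis vec_lambda_beta)
qed

lemma smooth_on_matrix_inv:
  fixes M :: "'a::euclidean_space \<Rightarrow> real ^ 'n ^ 'n"
  assumes "open S" "\<And>i j. smooth_on S (\<lambda>y. M y $ i $ j)" "\<And>y. y \<in> S \<Longrightarrow> det (M y) \<noteq> 0"
  shows "smooth_on S (\<lambda>y. matrix_inv (M y) $ k $ l)"
proof -
  have "smooth_on S (\<lambda>y. (\<chi> i j. if j = k then axis l 1 $ i else M y $ i $ j) $ i $ j)" for i j
    using assms(2) by (cases "j = k") (auto simp: smooth_on_const)
  then have "smooth_on S (\<lambda>y. det (\<chi> i j. if j = k then axis l 1 $ i else M y $ i $ j) / det (M y))"
    by (intro smooth_on_divide smooth_on_det assms)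
  then show ?thesis
    by (rule smooth_on_cong[OF assms(1)]) (rule matrix_inv_eq_cofactor[OF assms(3)])
qed

lemma dir_deriv_bilinear:
  assumes "bounded_bilinear B" "f differentiable (at y)" "g differentiable (at y)"
  shows "dir_deriv v (\<lambda>x. B (f x) (g x)) y = B (f y) (dir_deriv v g y) + B (dir_deriv v f y) (g y)"
  by (rule dir_deriv_eqI[OF bounded_bilinear.FDERIV[OF assms(1)]])
     (use assms has_derivative_frechet in auto)

lemma dir_deriv_linear_compose:
  assumes "bounded_linear h" "f differentiable (at y)"
  shows "dir_deriv v (\<lambda>x. h (f x)) y = h (dir_deriv v f y)"
  by (rule dir_deriv_eqI[OF bounded_linear.has_derivative[OF assms(1)]])
     (use assms has_derivative_frechet in auto)

lemma dir_deriv_compose: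
  assumes "g differentiable (at y)" "f differentiable (at (g y))"
  shows "dir_deriv v (\<lambda>x. f (g x)) y = dir_deriv (dir_deriv v g y) f (g y)"
  by (rule dir_deriv_eqI)
     (use diff_chain_at[OF has_derivative_frechet[OF assms(1)] has_derivative_frechet[OF assms(2)]]
       in \<open>simp add: o_def\<close>)


section \<open>Symmetry of second derivatives\<close>

lemma DERIV_along_line:
  fixes f :: "'a::real_normed_vector \<Rightarrow> real"
  assumes "f differentiable (at (a + s *\<^sub>R v))"
  shows "((\<lambda>s. f (a + s *\<^sub>R v)) has_real_derivative dir_deriv v f (a + s *\<^sub>R v)) (at s)"
proof -
  have "((\<lambda>s. a + s *\<^sub>R v) has_derivative (\<lambda>h. h *\<^sub>R v)) (at s)"
    by (auto intro!: derivative_eq_intros)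
  then have "((\<lambda>s. f (a + s *\<^sub>R v)) has_derivative (\<lambda>h. dir_deriv (h *\<^sub>R v) f (a + s *\<^sub>R v))) (at s)"
    using diff_chain_at[of "\<lambda>s. a + s *\<^sub>R v" _ s f, OF _ has_derivative_frechet[OF assms]]
    by (simp add: o_def)
  moreover have "dir_deriv (h *\<^sub>R v) f (a + s *\<^sub>R v) = dir_deriv v f (a + s *\<^sub>R v) * h" for h
    using linear_cmul[OF linear_dir_deriv[OF assms], of h v] by (simp add: mult.commute)
  ultimately show ?thesis by (simp add: has_field_derivative_def)
qed

text \<open>Two applications of the mean value theorem, first along v and then along w. Exchanging v
  and w leaves the second difference unchanged, which forces the mixed derivatives to agree in the
  limit.\<close>

lemma second_difference_mvt:
  fixes f :: "'a::euclidean_space \<Rightarrow> real"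
  assumes "smooth_on S f" "h > 0"
    and S: "\<And>s t. 0 \<le> s \<Longrightarrow> s \<le> h \<Longrightarrow> 0 \<le> t \<Longrightarrow> t \<le> h \<Longrightarrow> y + s *\<^sub>R v + t *\<^sub>R w \<in> S"
  shows "\<exists>s t. 0 \<le> s \<and> s \<le> h \<and> 0 \<le> t \<and> t \<le> h \<and>
    f (y + h *\<^sub>R v + h *\<^sub>R w) - f (y + h *\<^sub>R v) - f (y + h *\<^sub>R w) + f y
      = h * (h * dir_deriv w (dir_deriv v f) (y + s *\<^sub>R v + t *\<^sub>R w))"
proof -
  have d1: "((\<lambda>s. f ((y + t *\<^sub>R w) + s *\<^sub>R v)) has_real_derivative
      dir_deriv v f ((y + t *\<^sub>R w) + s *\<^sub>R v)) (at s)" if "0 \<le> s" "s \<le> h" "0 \<le> t" "t \<le> h" for s t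
    using S[OF that] assms(1) by (intro DERIV_along_line smooth_on_differentiable) (auto simp: add_ac)
  have "((\<lambda>s. f ((y + h *\<^sub>R w) + s *\<^sub>R v) - f (y + s *\<^sub>R v)) has_real_derivative
      dir_deriv v f ((y + h *\<^sub>R w) + s *\<^sub>R v) - dir_deriv v f (y + s *\<^sub>R v)) (at s)"
    if "0 \<le> s" "s \<le> h" for s
    using d1[OF that, of h] d1[OF that, of 0] assms(2) by (intro DERIV_diff) auto
  from MVT2[OF assms(2) this] obtain s where s: "0 < s" "s < h"
    and e1: "f ((y + h *\<^sub>R w) + h *\<^sub>R v) - f (y + h *\<^sub>R v) - (f (y + h *\<^sub>R w) - f y)
      = h * (dir_deriv v f ((y + h *\<^sub>R w) + s *\<^sub>R v) - dir_deriv v f (y + s *\<^sub>R v))"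
    by auto
  have "((\<lambda>t. dir_deriv v f ((y + s *\<^sub>R v) + t *\<^sub>R w)) has_real_derivative
      dir_deriv w (dir_deriv v f) ((y + s *\<^sub>R v) + t *\<^sub>R w)) (at t)" if "0 \<le> t" "t \<le> h" for t
    using S[of s t] s that assms(1)
    by (intro DERIV_along_line smooth_on_differentiable[OF smooth_on_dir_deriv]) auto
  from MVT2[OF assms(2) this] obtain t where t: "0 < t" "t < h"
    and e2: "dir_deriv v f ((y + s *\<^sub>R v) + h *\<^sub>R w) - dir_deriv v f (y + s *\<^sub>R v)
      = h * dir_deriv w (dir_deriv v f) (y + s *\<^sub>R v + t *\<^sub>R w)"
    by auto
  have "f (y + h *\<^sub>R v + h *\<^sub>R w) - f (y + h *\<^sub>R v) - f (y + h *\<^sub>R w) + f y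
      = h * (h * dir_deriv w (dir_deriv v f) (y + s *\<^sub>R v + t *\<^sub>R w))"
    using e1 e2 by (simp add: algebra_simps)
  then show ?thesis using s t by (meson less_imp_le)
qed

lemma dir_deriv_commute_real:
  fixes f :: "'a::euclidean_space \<Rightarrow> real"
  assumes "open S" "smooth_on S f" "y \<in> S"
  shows "dir_deriv v (dir_deriv w f) y = dir_deriv w (dir_deriv v f) y"
proof (rule ccontr)
  let ?A = "dir_deriv v (dir_deriv w f)" and ?B = "dir_deriv w (dir_deriv v f)"
  assume "?A y \<noteq> ?B y"
  \<comment> \<open>Half the supposed gap: one number cannot lie within e of both
    \<open>?A y\<close> and \<open>?B y\<close>.\<close>
  define e where "e = \<bar>?A y - ?B y\<bar> / 2"
  have e: "e > 0" using \<open>?A y \<noteq> ?B y\<close> by (simp add: e_def)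
  have "continuous_on S ?A" "continuous_on S ?B"
    by (intro smooth_on_imp_continuous_on smooth_on_dir_deriv assms)+
  then have "isCont ?A y" "isCont ?B y"
    using assms by (simp_all add: continuous_on_eq_continuous_at)
  then obtain d1 d2 where d1: "d1 > 0" "\<And>z. dist z y < d1 \<Longrightarrow> \<bar>?A z - ?A y\<bar> < e"
    and d2: "d2 > 0" "\<And>z. dist z y < d2 \<Longrightarrow> \<bar>?B z - ?B y\<bar> < e"
    using e unfolding continuous_at_eps_delta dist_real_def by metis
  obtain d3 where d3: "d3 > 0" "ball y d3 \<subseteq> S" using assms openE by blast
  define d where "d = min d1 (min d2 d3)"
  \<comment> \<open>Keeps the parallelogram spanned by h v and h w within d / 2 of y; the summand 1
    excludes a zero denominator.\<close>
  define h where "h = d / (2 * (norm v + norm w + 1))"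
  have "d > 0" by (simp add: d_def d1 d2 d3)
  have n: "norm v + norm w + 1 > 0" by (smt (verit) norm_ge_zero)
  then have "h > 0" using \<open>d > 0\<close> by (simp add: h_def)
  have near: "dist (y + s *\<^sub>R v + t *\<^sub>R w) y < d" if "0 \<le> s" "s \<le> h" "0 \<le> t" "t \<le> h" for s t
  proof -
    have "norm (s *\<^sub>R v + t *\<^sub>R w) \<le> s * norm v + t * norm w"
      using norm_triangle_ineq[of "s *\<^sub>R v" "t *\<^sub>R w"] that by simp
    also have "\<dots> \<le> h * norm v + h * norm w"
      using that by (intro add_mono mult_right_mono) auto
    also have "\<dots> \<le> h * (norm v + norm w + 1)" using \<open>h > 0\<close> by (simp add: algebra_simps)
    also have "\<dots> = d / 2" using n by (simp add: h_def field_simps)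
    finally show ?thesis using \<open>d > 0\<close> by (simp add: dist_norm add.assoc)
  qed
  have inS: "y + s *\<^sub>R v + t *\<^sub>R w \<in> S" if "0 \<le> s" "s \<le> h" "0 \<le> t" "t \<le> h" for s t
    using near[OF that] d3 by (auto simp: d_def dist_commute)
  have inS': "y + s *\<^sub>R w + t *\<^sub>R v \<in> S" if "0 \<le> s" "s \<le> h" "0 \<le> t" "t \<le> h" for s t
    using inS[of t s] that by (simp add: add_ac)
  obtain s t where st: "0 \<le> s" "s \<le> h" "0 \<le> t" "t \<le> h"
    "f (y + h *\<^sub>R v + h *\<^sub>R w) - f (y + h *\<^sub>R v) - f (y + h *\<^sub>R w) + f y
      = h * (h * ?B (y + s *\<^sub>R v + t *\<^sub>R w))"
    using second_difference_mvt[OF assms(2) \<open>h > 0\<close> inS] by blast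
  obtain s' t' where st': "0 \<le> s'" "s' \<le> h" "0 \<le> t'" "t' \<le> h"
    "f (y + h *\<^sub>R w + h *\<^sub>R v) - f (y + h *\<^sub>R w) - f (y + h *\<^sub>R v) + f y
      = h * (h * ?A (y + s' *\<^sub>R w + t' *\<^sub>R v))"
    using second_difference_mvt[OF assms(2) \<open>h > 0\<close> inS'] by blast
  have "h * (h * ?A (y + s' *\<^sub>R w + t' *\<^sub>R v)) = h * (h * ?B (y + s *\<^sub>R v + t *\<^sub>R w))"
    unfolding st(5)[symmetric] st'(5)[symmetric] by (simp add: algebra_simps)
  then have "?A (y + s' *\<^sub>R w + t' *\<^sub>R v) = ?B (y + s *\<^sub>R v + t *\<^sub>R w)" using \<open>h > 0\<close> by simp
  moreover have "\<bar>?A (y + s' *\<^sub>R w + t' *\<^sub>R v) - ?A y\<bar> < e"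
    using near[of t' s'] st' d1(2) by (simp add: d_def add_ac)
  moreover have "\<bar>?B (y + s *\<^sub>R v + t *\<^sub>R w) - ?B y\<bar> < e"
    using near[of s t] st d2(2) by (simp add: d_def)
  ultimately show False unfolding e_def by argo
qed

lemma dir_deriv_commute:
  fixes f :: "'a::euclidean_space \<Rightarrow> 'b::euclidean_space"
  assumes "open S" "smooth_on S f" "y \<in> S"
  shows "dir_deriv v (dir_deriv w f) y = dir_deriv w (dir_deriv v f) y"
proof (rule euclidean_eqI)
  fix b :: 'b
  have i: "dir_deriv v (dir_deriv w f) y \<bullet> b = dir_deriv v (dir_deriv w (\<lambda>x. f x \<bullet> b)) y" for v w
  proof -
    have "dir_deriv v (dir_deriv w (\<lambda>x. f x \<bullet> b)) y = dir_deriv v (\<lambda>x. dir_deriv w f x \<bullet> b) y"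
      by (rule dir_deriv_cong_open[OF assms(1) _ assms(3)], rule dir_deriv_linear_compose)
         (use bounded_linear_inner_left smooth_on_differentiable[OF assms(2)] in auto)
    also have "\<dots> = dir_deriv v (dir_deriv w f) y \<bullet> b"
      by (rule dir_deriv_linear_compose[OF bounded_linear_inner_left])
         (rule smooth_on_differentiable[OF smooth_on_dir_deriv[OF assms(2)] assms(3)])
    finally show ?thesis by simp
  qed
  have "smooth_on S (\<lambda>x. f x \<bullet> b)"
    by (rule smooth_on_linear_compose[OF bounded_linear_inner_left assms(1,2)])
  then show "dir_deriv v (dir_deriv w f) y \<bullet> b = dir_deriv w (dir_deriv v f) y \<bullet> b"
    unfolding i by (rule dir_deriv_commute_real[OF assms(1) _ assms(3)])
qed

section \<open>Smooth bump functions\<close>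

definition flat_exp :: "nat \<Rightarrow> real \<Rightarrow> real" where
  "flat_exp m x = (if x > 0 then inverse x ^ m * exp (- inverse x) else 0)"

lemma flat_exp_tendsto_0: "(flat_exp m \<longlongrightarrow> 0) (at 0)"
proof -
  have "((\<lambda>x::real. inverse x ^ m / exp (inverse x)) \<longlongrightarrow> 0) (at_right 0)"
    using filterlim_compose[OF tendsto_power_div_exp_0 filterlim_inverse_at_top_right] .
  then have "(flat_exp m \<longlongrightarrow> 0) (at_right 0)"
    by (rule Lim_transform_eventually)
       (auto simp: eventually_at_filter flat_exp_def exp_minus divide_inverse)
  moreover have "(flat_exp m \<longlongrightarrow> 0) (at_left 0)"
    by (rule tendsto_eventually) (auto simp: eventually_at_filter flat_exp_def)
  ultimately show ?thesis by (simp add: filterlim_split_at)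
qed

text \<open>The family is closed under differentiation up to linear combinations, which is why the
  power m is carried along: smoothness then follows by one induction for all m. At 0 the difference
  quotient is \<open>flat_exp (m + 1)\<close>, which tends to 0.\<close>

lemma DERIV_flat_exp:
  "(flat_exp m has_real_derivative flat_exp (m + 2) x - real m * flat_exp (m + 1) x) (at x)"
proof -
  consider "x > 0" | "x < 0" | "x = 0" by linarith
  then show ?thesis
  proof cases
    case 1
    have "((\<lambda>x. inverse x ^ m * exp (- inverse x)) has_real_derivative
        flat_exp (m + 2) x - real m * flat_exp (m + 1) x) (at x)"
      using DERIV_mult[OF DERIV_power[OF DERIV_inverse[of x], where n = m]
          DERIV_chain2[OF DERIV_exp DERIV_minus[OF DERIV_inverse[of x]]]] 1
      by (cases m) (simp_all add: flat_exp_def algebra_simps)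
    then show ?thesis
      by (rule has_field_derivative_transform_within_open[where S = "{0<..}"])
         (use 1 in \<open>auto simp: flat_exp_def\<close>)
  next
    case 2
    have "((\<lambda>x. 0) has_real_derivative 0) (at x)" by simp
    then have "(flat_exp m has_real_derivative 0) (at x)"
      by (rule has_field_derivative_transform_within_open[where S = "{..<0}"])
         (use 2 in \<open>auto simp: flat_exp_def\<close>)
    then show ?thesis using 2 by (simp add: flat_exp_def)
  next
    case 3
    have "(\<lambda>h. (flat_exp m (0 + h) - flat_exp m 0) / h) = flat_exp (m + 1)"
      by (auto simp: flat_exp_def fun_eq_iff divide_inverse)
    then have "(flat_exp m has_real_derivative 0) (at 0)"
      unfolding DERIV_def using flat_exp_tendsto_0[of "m + 1"] by simp
    then show ?thesis using 3 by (simp add: flat_exp_def)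
  qed
qed

lemma smooth_on_flat_exp: "smooth_on UNIV (flat_exp m)"
proof -
  have "Ck_on k UNIV (flat_exp m)" for k
  proof (induction k arbitrary: m)
    case 0
    show ?case
      using DERIV_flat_exp by (auto intro!: continuous_at_imp_continuous_on DERIV_isCont)
  next
    case (Suc k)
    have d: "(flat_exp m has_derivative (*) (flat_exp (m + 2) x - real m * flat_exp (m + 1) x)) (at x)"
      for x
      using DERIV_flat_exp[of m x] by (simp add: has_field_derivative_def)
    have e: "dir_deriv v (flat_exp m) = (\<lambda>x. v *\<^sub>R (flat_exp (m + 2) x + (- real m) *\<^sub>R flat_exp (m + 1) x))" for v
      using dir_deriv_eqI[OF d] by (auto simp: fun_eq_iff)
    have "Ck_on k UNIV (\<lambda>x. v *\<^sub>R (flat_exp (m + 2) x + (- real m) *\<^sub>R flat_exp (m + 1) x))" for v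
      by (intro Ck_on_bilinear[OF _ bounded_bilinear_scaleR] Ck_on_add Ck_on_const Suc) auto
    then show ?case unfolding Ck_on.simps e using d by (auto simp: differentiable_def)
  qed
  then show ?thesis by (simp add: smooth_on_def)
qed

text \<open>The function is exp (-1 / (r^2 - |y - a|^2)) inside the ball. That it is at most 1 later
  keeps the height t \<eta> in the range of t.\<close>

lemma bump_function_exists:
  fixes a :: "'a::euclidean_space"
  assumes "r > 0"
  obtains \<eta> :: "'a \<Rightarrow> real" where "smooth_on UNIV \<eta>" "\<And>y. 0 \<le> \<eta> y" "\<And>y. \<eta> y \<le> 1"
    "\<And>y. \<eta> y > 0 \<longleftrightarrow> y \<in> ball a r"
proof -
  define \<eta> where "\<eta> y = flat_exp 0 (r\<^sup>2 - (y - a) \<bullet> (y - a))" for y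
  have "smooth_on UNIV (\<lambda>y. y - a)"
    by (intro smooth_on_diff smooth_on_const) (auto simp: smooth_on_id)
  then have "smooth_on UNIV (\<lambda>y. r\<^sup>2 - (y - a) \<bullet> (y - a))"
    by (intro smooth_on_diff[OF _ smooth_on_const] smooth_on_bilinear[OF _ bounded_bilinear_inner]) auto
  then have "smooth_on UNIV \<eta>"
    unfolding \<eta>_def by (intro smooth_on_compose[OF _ _ _ smooth_on_flat_exp]) auto
  moreover have "\<eta> y > 0 \<longleftrightarrow> y \<in> ball a r" for y
  proof -
    have "(y - a) \<bullet> (y - a) < r\<^sup>2 \<longleftrightarrow> norm (y - a) < r"
      using assms norm_lt_square[of "y - a" r] by simp
    then show ?thesis by (auto simp: \<eta>_def flat_exp_def dist_norm norm_minus_commute)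
  qed
  moreover have "0 \<le> \<eta> y" "\<eta> y \<le> 1" for y by (auto simp: \<eta>_def flat_exp_def)
  ultimately show ?thesis using that by blast
qed

section \<open>Charts, tangent vectors and differentials\<close>

text \<open>A germ version of \<open>smooth_on\<close>: composing chart expressions then needs no
  bookkeeping of shrinking domains.\<close>

definition smooth_at :: "('a::euclidean_space \<Rightarrow> 'b::euclidean_space) \<Rightarrow> 'a \<Rightarrow> bool" where
  "smooth_at f y \<longleftrightarrow> (\<exists>T. open T \<and> y \<in> T \<and> smooth_on T f)"

lemma smooth_atI: "open T \<Longrightarrow> y \<in> T \<Longrightarrow> smooth_on T f \<Longrightarrow> smooth_at f y"
  by (auto simp: smooth_at_def)

lemma smooth_at_differentiable: "smooth_at f y \<Longrightarrow> f differentiable (at y)"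
  by (auto simp: smooth_at_def smooth_on_differentiable)

lemma smooth_on_if_smooth_at: "(\<And>y. y \<in> S \<Longrightarrow> smooth_at f y) \<Longrightarrow> smooth_on S f"
  by (rule smooth_on_locally) (simp add: smooth_at_def)

lemma smooth_at_cong:
  assumes "smooth_at f y" "open T" "y \<in> T" "\<And>z. z \<in> T \<Longrightarrow> g z = f z"
  shows "smooth_at g y"
proof -
  obtain U where U: "open U" "y \<in> U" "smooth_on U f" using assms(1) by (auto simp: smooth_at_def)
  have "smooth_on (U \<inter> T) g"
    by (rule smooth_on_cong[of _ f]) (use U assms in \<open>auto intro: smooth_on_subset\<close>)
  then show ?thesis using U assms by (intro smooth_atI[of "U \<inter> T"]) auto
qed

lemma smooth_at_compose:
  assumes "smooth_at g y" "smooth_at f (g y)"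
  shows "smooth_at (\<lambda>x. f (g x)) y"
proof -
  obtain U where U: "open U" "y \<in> U" "smooth_on U g" using assms(1) by (auto simp: smooth_at_def)
  obtain T where T: "open T" "g y \<in> T" "smooth_on T f" using assms(2) by (auto simp: smooth_at_def)
  have o: "open (U \<inter> g -` T)"
    using U T smooth_on_imp_continuous_on continuous_on_open_vimage by (metis Int_commute)
  have "smooth_on (U \<inter> g -` T) (\<lambda>x. f (g x))"
    by (rule smooth_on_compose[OF o T(1) _ T(3)]) (use U in \<open>auto intro: smooth_on_subset\<close>)
  then show ?thesis using o U T by (intro smooth_atI[of "U \<inter> g -` T"]) auto
qed

lemma smooth_at_linear_compose: "bounded_linear h \<Longrightarrow> smooth_at f y \<Longrightarrow> smooth_at (\<lambda>x. h (f x)) y"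
  by (rule smooth_at_compose) (auto intro: smooth_atI[of UNIV] smooth_on_bounded_linear)

lemma smooth_at_Pair:
  assumes "smooth_at f y" "smooth_at g y"
  shows "smooth_at (\<lambda>x. (f x, g x)) y"
proof -
  obtain U where U: "open U" "y \<in> U" "smooth_on U f" using assms(1) by (auto simp: smooth_at_def)
  obtain T where T: "open T" "y \<in> T" "smooth_on T g" using assms(2) by (auto simp: smooth_at_def)
  have "smooth_on (U \<inter> T) (\<lambda>x. (f x, g x))"
    by (rule smooth_on_Pair) (use U T in \<open>auto intro: smooth_on_subset\<close>)
  then show ?thesis using U T by (intro smooth_atI[of "U \<inter> T"]) auto
qed

section \<open>Charts and smooth maps between manifolds\<close>

lemma cinv_cmap: "is_chart c \<Longrightarrow> x \<in> cdom c \<Longrightarrow> cinv c (cmap c x) = x"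
  by (auto simp: is_chart_def homeomorphism_def)

lemma cmap_cinv: "is_chart c \<Longrightarrow> y \<in> cran c \<Longrightarrow> cmap c (cinv c y) = y"
  by (auto simp: is_chart_def homeomorphism_def)

lemma cmap_in_cran: "x \<in> cdom c \<Longrightarrow> cmap c x \<in> cran c"
  by (simp add: cran_def)

lemma cinv_in_cdom: "is_chart c \<Longrightarrow> y \<in> cran c \<Longrightarrow> cinv c y \<in> cdom c"
  by (auto simp: is_chart_def homeomorphism_def)

lemma open_cdom: "is_chart c \<Longrightarrow> open (cdom c)"
  by (simp add: is_chart_def)

lemma open_cran: "is_chart c \<Longrightarrow> open (cran c)"
  by (simp add: is_chart_def)

lemma continuous_on_cmap: "is_chart c \<Longrightarrow> continuous_on (cdom c) (cmap c)"
  by (auto simp: is_chart_def homeomorphism_def)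

lemma continuous_on_cinv: "is_chart c \<Longrightarrow> continuous_on (cran c) (cinv c)"
  by (auto simp: is_chart_def homeomorphism_def)

lemma inj_on_cmap: "is_chart c \<Longrightarrow> inj_on (cmap c) (cdom c)"
  by (rule inj_on_inverseI[of _ "cinv c"]) (rule cinv_cmap)

text \<open>Seen as a preimage under the continuous inverse chart, the image of an open set is open
  and that of a Borel set is Borel.\<close>

lemma cmap_image_eq_vimage:
  assumes "is_chart c" "V \<subseteq> cdom c"
  shows "cmap c ` V = cran c \<inter> cinv c -` V"
  using assms by (auto simp: cinv_cmap cmap_in_cran subset_iff) (metis cmap_cinv image_eqI)

lemma open_cmap_image:
  assumes "is_chart c" "open V" "V \<subseteq> cdom c"
  shows "open (cmap c ` V)"
  unfolding cmap_image_eq_vimage[OF assms(1,3)]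
  using continuous_on_open_vimage[OF open_cran] continuous_on_cinv assms(1,2) by (metis Int_commute)

lemma open_cmap_vimage:
  assumes "is_chart c" "open U"
  shows "open (cdom c \<inter> cmap c -` U)"
  using continuous_on_open_vimage[OF open_cdom] continuous_on_cmap assms by (metis Int_commute)

lemma smooth_atlas_is_chart: "smooth_atlas A \<Longrightarrow> c \<in> A \<Longrightarrow> is_chart c"
  by (simp add: smooth_atlas_def)

lemma chart_at_props:
  assumes "smooth_atlas A"
  shows "chart_at A x \<in> A" "x \<in> cdom (chart_at A x)"
proof -
  have "\<exists>c. c \<in> A \<and> x \<in> cdom c" using assms unfolding smooth_atlas_def by blast
  from someI_ex[OF this] show "chart_at A x \<in> A" "x \<in> cdom (chart_at A x)"
    by (simp_all add: chart_at_def)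
qed

lemma smooth_at_transition:
  assumes "smooth_atlas A" "c \<in> A" "d \<in> A" "x \<in> cdom c" "x \<in> cdom d"
  shows "smooth_at (\<lambda>y. cmap d (cinv c y)) (cmap c x)"
proof (rule smooth_atI)
  show "open (cmap c ` (cdom c \<inter> cdom d))"
    using assms(1-3) by (intro open_cmap_image open_Int open_cdom smooth_atlas_is_chart) auto
  show "cmap c x \<in> cmap c ` (cdom c \<inter> cdom d)" using assms by auto
  show "smooth_on (cmap c ` (cdom c \<inter> cdom d)) (\<lambda>y. cmap d (cinv c y))"
    using assms(1-3) by (auto simp: smooth_atlas_def transition_def o_def)
qed

text \<open>\<open>smooth_map_on\<close> provides smoothness in some pair of charts; transition maps
  on both sides transfer it to the prescribed pair. Continuity comes along, since F is locally a
  smooth map between charts and their inverses.\<close>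

lemma smooth_map_onD:
  assumes "smooth_atlas A" "smooth_atlas B" "smooth_map_on A B W F" "c \<in> A" "d \<in> B"
    "x \<in> W" "x \<in> cdom c" "F x \<in> cdom d"
  obtains V where "open V" "x \<in> V" "V \<subseteq> W" "V \<subseteq> cdom c" "F ` V \<subseteq> cdom d"
    "smooth_at (\<lambda>y. cmap d (F (cinv c y))) (cmap c x)" "continuous_on V F"
proof -
  obtain c' d' V' where 1: "c' \<in> A" "d' \<in> B" "open V'" "x \<in> V'" "V' \<subseteq> W \<inter> cdom c'"
    "F ` V' \<subseteq> cdom d'" "smooth_on (cmap c' ` V') (cmap d' \<circ> F \<circ> cinv c')"
    using assms(3,6) unfolding smooth_map_on_def by metis
  note ch = smooth_atlas_is_chart[OF assms(1,4)] smooth_atlas_is_chart[OF assms(1) 1(1)]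
  note dh = smooth_atlas_is_chart[OF assms(2,5)] smooth_atlas_is_chart[OF assms(2) 1(2)]
  have op: "open (cmap c' ` V')" using open_cmap_image[OF ch(2) 1(3)] 1(5) by auto
  have "continuous_on (cmap c' ` V') (\<lambda>y. cmap d' (F (cinv c' y)))"
    using smooth_on_imp_continuous_on[OF 1(7)] by (simp add: o_def)
  then have "continuous_on V' (\<lambda>z. cmap d' (F (cinv c' (cmap c' z))))"
    using continuous_on_compose2[OF _ continuous_on_subset[OF continuous_on_cmap[OF ch(2)]]] 1(5) by blast
  then have "continuous_on V' (\<lambda>z. cmap d' (F z))"
    by (rule continuous_on_eq) (use 1(5) cinv_cmap[OF ch(2)] in auto)
  then have "continuous_on V' (\<lambda>z. cinv d' (cmap d' (F z)))"
    using 1(6) by (intro continuous_on_compose2[OF continuous_on_cinv[OF dh(2)]]) (auto simp: cran_def)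
  then have cF: "continuous_on V' F"
    by (rule continuous_on_eq) (use 1(6) cinv_cmap[OF dh(2)] in auto)
  \<comment> \<open>Shrunk so that the source chart c and, by continuity of F, the target chart d
    are both usable.\<close>
  define V where "V = V' \<inter> cdom c \<inter> F -` cdom d"
  have "open (V' \<inter> F -` cdom d)"
    using continuous_on_open_vimage[OF 1(3)] cF open_cdom[OF dh(1)] by (metis Int_commute)
  then have V: "open V" "x \<in> V" "V \<subseteq> W" "V \<subseteq> cdom c" "F ` V \<subseteq> cdom d"
    using 1 assms open_cdom[OF ch(1)] open_Int[of "V' \<inter> F -` cdom d" "cdom c"]
    by (auto simp: V_def Int_ac)
  have "smooth_at (\<lambda>y. cmap d' (F (cinv c' y))) (cmap c' x)"
    using 1 op by (intro smooth_atI[of "cmap c' ` V'"]) (auto simp: o_def)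
  moreover have "smooth_at (\<lambda>y. cmap c' (cinv c y)) (cmap c x)"
    by (rule smooth_at_transition[OF assms(1)]) (use 1 assms in auto)
  ultimately have "smooth_at (\<lambda>y. cmap d' (F (cinv c' (cmap c' (cinv c y))))) (cmap c x)"
    using smooth_at_compose[of "\<lambda>y. cmap c' (cinv c y)" "cmap c x" "\<lambda>y. cmap d' (F (cinv c' y))"]
      cinv_cmap[OF ch(1)] assms by simp
  moreover have "smooth_at (\<lambda>y. cmap d (cinv d' y)) (cmap d' (F x))"
    by (rule smooth_at_transition[OF assms(2)]) (use 1 assms in auto)
  moreover have "cmap d' (F (cinv c' (cmap c' (cinv c (cmap c x))))) = cmap d' (F x)"
    using 1 assms cinv_cmap[OF ch(1)] cinv_cmap[OF ch(2)] by auto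
  ultimately have "smooth_at (\<lambda>y. cmap d (cinv d' (cmap d' (F (cinv c' (cmap c' (cinv c y))))))) (cmap c x)"
    using smooth_at_compose[of "\<lambda>y. cmap d' (F (cinv c' (cmap c' (cinv c y))))" "cmap c x"
        "\<lambda>y. cmap d (cinv d' y)"] by simp
  then have "smooth_at (\<lambda>y. cmap d (F (cinv c y))) (cmap c x)"
  proof (rule smooth_at_cong)
    show "open (cmap c ` V)" "cmap c x \<in> cmap c ` V" using open_cmap_image[OF ch(1) V(1,4)] V by auto
    fix z assume "z \<in> cmap c ` V"
    then obtain v where v: "v \<in> V" "z = cmap c v" by auto
    then have "cinv c z = v" using V cinv_cmap[OF ch(1)] by auto
    moreover have "v \<in> cdom c'" "F v \<in> cdom d'" using v 1 by (auto simp: V_def)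
    ultimately show "cmap d (F (cinv c z)) = cmap d (cinv d' (cmap d' (F (cinv c' (cmap c' (cinv c z))))))"
      using cinv_cmap[OF ch(2)] cinv_cmap[OF dh(2)] by simp
  qed
  then show ?thesis using that[OF V] cF continuous_on_subset[OF cF, of V] by (auto simp: V_def)
qed

lemma euclidean_atlas_mem: "(UNIV, id) \<in> euclidean_atlas"
  by (simp add: euclidean_atlas_def)

lemma smooth_atlas_euclidean: "smooth_atlas (euclidean_atlas :: ('e::euclidean_space, 'e) chart set)"
proof -
  have "cinv (UNIV, id) = (id :: 'e \<Rightarrow> 'e)" by (simp add: cinv_def cdom_def cmap_def)
  moreover have "smooth_on UNIV (id :: 'e \<Rightarrow> 'e)" using smooth_on_id by (simp add: id_def)
  ultimately show ?thesis
    by (simp add: euclidean_atlas_def smooth_atlas_def is_chart_def cran_def transition_def cdom_def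
        cmap_def homeomorphism_def)
qed

section \<open>The product of the real line with a manifold\<close>

definition line_chart :: "('m, 'e) chart \<Rightarrow> (real \<times> 'm, real \<times> 'e) chart" where
  "line_chart c = (UNIV \<times> cdom c, \<lambda>(s, x). (s, cmap c x))"

lemma line_times_atlas_eq: "line_times_atlas A = line_chart ` A"
  by (simp add: line_times_atlas_def line_chart_def)

lemma cdom_line: "cdom (line_chart c) = UNIV \<times> cdom c"
  and cmap_line: "cmap (line_chart c) (s, x) = (s, cmap c x)"
  by (simp_all add: line_chart_def cdom_def cmap_def)

lemma cran_line: "cran (line_chart c) = UNIV \<times> cran c"
  unfolding cran_def cdom_line by (force simp: cmap_line)

lemma cinv_line:
  assumes "is_chart c" "y \<in> cran c"
  shows "cinv (line_chart c) (s, y) = (s, cinv c y)"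
  unfolding cinv_def[of "line_chart c"]
proof (rule inv_into_f_eq)
  show "inj_on (cmap (line_chart c)) (cdom (line_chart c))"
    using inj_on_cmap[OF assms(1)] by (auto simp: inj_on_def cmap_line cdom_line)
qed (use assms in \<open>auto simp: cmap_line cdom_line cinv_in_cdom cmap_cinv\<close>)

lemma is_chart_line:
  assumes "is_chart c"
  shows "is_chart (line_chart c)"
  unfolding is_chart_def
proof (intro conjI)
  let ?l = "line_chart c"
  show "open (cdom ?l)" "open (cran ?l)"
    using assms by (auto simp: cdom_line cran_line open_cdom open_cran intro: open_Times)
  show "homeomorphism (cdom ?l) (cran ?l) (cmap ?l) (cinv ?l)"
  proof (rule homeomorphismI)
    have "continuous_on (UNIV \<times> cdom c) (\<lambda>z. (fst z, cmap c (snd z)))"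
      by (intro continuous_intros continuous_on_compose2[OF continuous_on_cmap[OF assms]]) auto
    then show "continuous_on (cdom ?l) (cmap ?l)"
      unfolding cdom_line by (rule continuous_on_eq) (auto simp: cmap_line)
    have "continuous_on (UNIV \<times> cran c) (\<lambda>z. (fst z, cinv c (snd z)))"
      by (intro continuous_intros continuous_on_compose2[OF continuous_on_cinv[OF assms]]) auto
    then show "continuous_on (cran ?l) (cinv ?l)"
      unfolding cran_line by (rule continuous_on_eq) (auto simp: cinv_line[OF assms])
  qed (use assms in \<open>auto simp: cdom_line cran_line cmap_line cinv_line cinv_cmap cmap_cinv cmap_in_cran cinv_in_cdom\<close>)
qed

lemma smooth_atlas_line:
  assumes "smooth_atlas A"
  shows "smooth_atlas (line_times_atlas A)"
  unfolding smooth_atlas_def line_times_atlas_eq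
proof (intro conjI ballI)
  show "is_chart c" if "c \<in> line_chart ` A" for c
    using that assms is_chart_line smooth_atlas_is_chart by blast
  show "(\<Union>c\<in>line_chart ` A. cdom c) = UNIV"
    using chart_at_props[OF assms] by (auto simp: cdom_line)
  fix c' d' assume "c' \<in> line_chart ` A" "d' \<in> line_chart ` A"
  then obtain c d where cd: "c \<in> A" "d \<in> A" "c' = line_chart c" "d' = line_chart d" by auto
  note ch = smooth_atlas_is_chart[OF assms cd(1)]
  have im: "cmap c' ` (cdom c' \<inter> cdom d') = UNIV \<times> cmap c ` (cdom c \<inter> cdom d)"
    unfolding cd cdom_line by (force simp: cmap_line)
  show "smooth_on (cmap c' ` (cdom c' \<inter> cdom d')) (transition c' d')"
    unfolding im
  proof (rule smooth_on_if_smooth_at)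
    fix z assume "z \<in> (UNIV :: real set) \<times> cmap c ` (cdom c \<inter> cdom d)"
    then obtain s x where z: "z = (s, cmap c x)" "x \<in> cdom c" "x \<in> cdom d" by auto
    have "smooth_at (\<lambda>z. (fst z, cmap d (cinv c (snd z)))) z"
      using smooth_at_transition[OF assms cd(1,2) z(2,3)] z(1)
      by (intro smooth_at_Pair smooth_at_compose[of snd _ "\<lambda>y. cmap d (cinv c y)"])
         (auto intro!: smooth_atI[of UNIV] smooth_on_bounded_linear bounded_linear_fst bounded_linear_snd)
    then show "smooth_at (transition c' d') z"
      by (rule smooth_at_cong[where T = "UNIV \<times> cran c"])
         (use z ch in \<open>auto simp: open_cran open_Times cmap_in_cran transition_def cd cinv_line cmap_line\<close>)
  qed
qed

text \<open>Transition maps are smooth, so a single chart suffices as a test; from here on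
  smoothness is handled as \<open>smooth_at\<close> of a coordinate expression.\<close>

lemma smooth_near_iff:
  assumes "smooth_atlas A" "c \<in> A" "x \<in> cdom c"
  shows "smooth_near A x f \<longleftrightarrow> smooth_at (\<lambda>y. f (cinv c y)) (cmap c x)"
proof
  assume "smooth_near A x f"
  then obtain V where V: "open V" "x \<in> V" "smooth_map_on A euclidean_atlas V f"
    by (auto simp: smooth_near_def)
  have "f x \<in> cdom (UNIV, id)" by (simp add: cdom_def)
  from smooth_map_onD[OF assms(1) smooth_atlas_euclidean V(3) assms(2) euclidean_atlas_mem V(2) assms(3) this]
  have "smooth_at (\<lambda>y. cmap (UNIV, id) (f (cinv c y))) (cmap c x)" by blast
  then show "smooth_at (\<lambda>y. f (cinv c y)) (cmap c x)" by (simp add: cmap_def)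
next
  assume "smooth_at (\<lambda>y. f (cinv c y)) (cmap c x)"
  then obtain T where T: "open T" "cmap c x \<in> T" "smooth_on T (\<lambda>y. f (cinv c y))"
    by (auto simp: smooth_at_def)
  note ch = smooth_atlas_is_chart[OF assms(1,2)]
  let ?V = "cdom c \<inter> cmap c -` T"
  have "open ?V" by (rule open_cmap_vimage[OF ch T(1)])
  moreover have "smooth_on (cmap c ` ?V) (\<lambda>y. f (cinv c y))"
    using T(3) by (rule smooth_on_subset) auto
  ultimately have "smooth_map_on A euclidean_atlas ?V f"
    unfolding smooth_map_on_def using assms(2) euclidean_atlas_mem
    by (intro ballI bexI[of _ c] bexI[of _ "(UNIV, id)"] exI[of _ ?V])
       (auto simp: cdom_def cmap_def o_def)
  then show "smooth_near A x f"
    using \<open>open ?V\<close> T assms by (auto simp: smooth_near_def)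
qed

lemma smooth_map_on_imp_smooth_near:
  "smooth_map_on A euclidean_atlas W f \<Longrightarrow> open W \<Longrightarrow> x \<in> W \<Longrightarrow> smooth_near A x f"
  by (auto simp: smooth_near_def)

lemma smooth_map_onI:
  assumes "smooth_atlas A" "\<And>x. smooth_near A x f"
  shows "smooth_map_on A euclidean_atlas UNIV f"
  unfolding smooth_map_on_def
proof
  fix x
  obtain V where V: "open V" "x \<in> V" "smooth_map_on A euclidean_atlas V f"
    using assms(2)[of x] by (auto simp: smooth_near_def)
  then show "\<exists>c\<in>A. \<exists>d\<in>euclidean_atlas. \<exists>V. open V \<and> x \<in> V \<and> V \<subseteq> UNIV \<inter> cdom c \<and>
      f ` V \<subseteq> cdom d \<and> smooth_on (cmap c ` V) (cmap d \<circ> f \<circ> cinv c)"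
    unfolding smooth_map_on_def by (metis Int_subset_iff subset_UNIV)
qed

lemma smooth_near_linear_compose:
  assumes "smooth_atlas A" "bounded_linear h" "smooth_near A x f"
  shows "smooth_near A x (\<lambda>y. h (f y))"
  using assms(3) unfolding smooth_near_iff[OF assms(1) chart_at_props[OF assms(1)]]
  by (rule smooth_at_linear_compose[OF assms(2)])

lemma smooth_near_comp:
  assumes "smooth_atlas A" "smooth_atlas B" "smooth_map_on A B W F" "x \<in> W" "smooth_near B (F x) f"
  shows "smooth_near A x (\<lambda>y. f (F y))"
proof -
  let ?c = "chart_at A x" and ?d = "chart_at B (F x)"
  note c = chart_at_props[OF assms(1), of x] and d = chart_at_props[OF assms(2), of "F x"]
  note ch = smooth_atlas_is_chart[OF assms(1) c(1)] smooth_atlas_is_chart[OF assms(2) d(1)]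
  obtain V where V: "open V" "x \<in> V" "V \<subseteq> cdom ?c" "F ` V \<subseteq> cdom ?d"
    "smooth_at (\<lambda>y. cmap ?d (F (cinv ?c y))) (cmap ?c x)"
    using smooth_map_onD[OF assms(1-3) c(1) d(1) assms(4) c(2) d(2)] by metis
  have "smooth_at (\<lambda>y. f (cinv ?d y)) (cmap ?d (F x))"
    using assms(5) by (simp only: smooth_near_iff[OF assms(2) d])
  then have "smooth_at (\<lambda>y. f (cinv ?d (cmap ?d (F (cinv ?c y))))) (cmap ?c x)"
    using smooth_at_compose[OF V(5), of "\<lambda>y. f (cinv ?d y)"] cinv_cmap[OF ch(1) c(2)] by simp
  then have "smooth_at (\<lambda>y. f (F (cinv ?c y))) (cmap ?c x)"
    by (rule smooth_at_cong[where T = "cmap ?c ` V"])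
       (use V open_cmap_image[OF ch(1) V(1,3)] in
         \<open>auto simp: cinv_cmap[OF ch(1)] cinv_cmap[OF ch(2)] image_subset_iff subset_iff\<close>)
  then show ?thesis by (simp only: smooth_near_iff[OF assms(1) c])
qed

text \<open>The chain rule; on functions that are not smooth near x both sides are 0 by convention.
  The larger atlas \<open>A'\<close> admits a chart c that is merely compatible with A, as
  isothermal charts are.\<close>

lemma coord_vector_change:
  fixes A :: "('a::topological_space, 'e::euclidean_space) chart set"
  assumes "smooth_atlas A" "smooth_atlas A'" "A \<subseteq> A'" "c \<in> A'" "d \<in> A" "x \<in> cdom c" "x \<in> cdom d"
  shows "coord_vector A c x u = coord_vector A d x (dir_deriv u (transition c d) (cmap c x))"
proof
  fix f :: "'a \<Rightarrow> real"
  have "dir_deriv u (\<lambda>y. f (cinv c y)) (cmap c x)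
      = dir_deriv (dir_deriv u (transition c d) (cmap c x)) (\<lambda>y. f (cinv d y)) (cmap d x)"
    if "smooth_near A x f"
  proof -
    note ch = smooth_atlas_is_chart[OF assms(2,4)] smooth_atlas_is_chart[OF assms(1,5)]
    have tr: "transition c d (cmap c x) = cmap d x"
      using cinv_cmap[OF ch(1) assms(6)] by (simp add: transition_def)
    have "open (cmap c ` (cdom c \<inter> cdom d))"
      by (intro open_cmap_image open_Int open_cdom ch) auto
    then have "dir_deriv u (\<lambda>y. f (cinv c y)) (cmap c x)
        = dir_deriv u (\<lambda>y. f (cinv d (transition c d y))) (cmap c x)"
      by (rule dir_deriv_cong_open)
         (use assms cinv_cmap[OF ch(1)] cinv_cmap[OF ch(2)] in \<open>auto simp: transition_def\<close>)
    also have "\<dots> = dir_deriv (dir_deriv u (transition c d) (cmap c x)) (\<lambda>y. f (cinv d y))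
        (transition c d (cmap c x))"
    proof (rule dir_deriv_compose)
      show "transition c d differentiable at (cmap c x)"
        using smooth_at_differentiable[OF smooth_at_transition[OF assms(2,4) _ assms(6,7)]] assms
        by (auto simp: transition_def o_def)
      show "(\<lambda>y. f (cinv d y)) differentiable at (transition c d (cmap c x))"
        unfolding tr using that smooth_near_iff[OF assms(1,5,7)] smooth_at_differentiable by blast
    qed
    finally show ?thesis unfolding tr .
  qed
  then show "coord_vector A c x u f
      = coord_vector A d x (dir_deriv u (transition c d) (cmap c x)) f"
    by (simp add: coord_vector_def o_def)
qed

lemma vdiff_coord_vector:
  assumes "smooth_atlas A" "c \<in> A" "x \<in> cdom c" "smooth_near A x F"
  shows "vdiff F (coord_vector A c x u) = dir_deriv u (\<lambda>y. F (cinv c y)) (cmap c x)"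
proof -
  have "coord_vector A c x u (\<lambda>y. F y \<bullet> b) = dir_deriv u (\<lambda>y. F (cinv c y)) (cmap c x) \<bullet> b" for b
  proof -
    have "(\<lambda>y. F (cinv c y)) differentiable at (cmap c x)"
      using assms smooth_near_iff smooth_at_differentiable by blast
    then have "dir_deriv u (\<lambda>y. F (cinv c y) \<bullet> b) (cmap c x)
        = dir_deriv u (\<lambda>y. F (cinv c y)) (cmap c x) \<bullet> b"
      by (rule dir_deriv_linear_compose[OF bounded_linear_inner_left])
    then show ?thesis
      using smooth_near_linear_compose[OF assms(1) bounded_linear_inner_left assms(4)]
      by (simp add: coord_vector_def o_def)
  qed
  then show ?thesis by (simp add: vdiff_def euclidean_representation)
qed

lemma vdiff_pushforward:
  assumes "smooth_atlas B" "smooth_near B (F x) H"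
  shows "vdiff H (pushforward B F x X) = vdiff (\<lambda>y. H (F y)) X"
  using smooth_near_linear_compose[OF assms(1) bounded_linear_inner_left assms(2)]
  by (simp add: vdiff_def pushforward_def o_def)

lemma tangent_space_chart:
  assumes "smooth_atlas A" "c \<in> A" "x \<in> cdom c"
  shows "tangent_space A x = range (coord_vector A c x)"
proof
  show "tangent_space A x \<subseteq> range (coord_vector A c x)"
    unfolding tangent_space_def
    using coord_vector_change[OF assms(1,1) order_refl _ assms(2) _ assms(3)] by blast
  show "range (coord_vector A c x) \<subseteq> tangent_space A x"
    unfolding tangent_space_def using assms by blast
qed

lemma vdiff_linear_comb:
  "vdiff F (\<lambda>f. a * X f + b * Y f) = a *\<^sub>R vdiff F X + b *\<^sub>R vdiff F Y"
  by (simp add: vdiff_def scaleR_add_left sum.distrib scaleR_sum_right)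

lemma vdiff_cmap:
  assumes "smooth_atlas A" "c \<in> A" "x \<in> cdom c"
  shows "smooth_near A x (cmap c)" "vdiff (cmap c) (coord_vector A c x u) = u"
proof -
  note ch = smooth_atlas_is_chart[OF assms(1,2)]
  have e: "cmap c (cinv c y) = y" if "y \<in> cran c" for y using cmap_cinv[OF ch that] .
  have "smooth_at (\<lambda>y. y) (cmap c x)" by (rule smooth_atI[of UNIV]) (auto simp: smooth_on_id)
  then have "smooth_at (\<lambda>y. cmap c (cinv c y)) (cmap c x)"
    by (rule smooth_at_cong[OF _ open_cran[OF ch] cmap_in_cran[OF assms(3)]]) (rule e)
  then show s: "smooth_near A x (cmap c)" by (simp only: smooth_near_iff[OF assms])
  have "dir_deriv u (\<lambda>y. cmap c (cinv c y)) (cmap c x) = dir_deriv u (\<lambda>y. y) (cmap c x)"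
    by (rule dir_deriv_cong_open[OF open_cran[OF ch] e cmap_in_cran[OF assms(3)]])
  then show "vdiff (cmap c) (coord_vector A c x u) = u"
    using vdiff_coord_vector[OF assms s] by simp
qed

text \<open>Nothing is lost in passing from u to a derivation: applied to the coordinate functions
  it returns u (\<open>vdiff_cmap\<close>).\<close>

lemma coord_vector_eq_0_iff:
  assumes "smooth_atlas A" "c \<in> A" "x \<in> cdom c"
  shows "coord_vector A c x u = (\<lambda>_. 0) \<longleftrightarrow> u = 0"
proof
  assume "coord_vector A c x u = (\<lambda>_. 0)"
  then have "vdiff (cmap c) (coord_vector A c x u) = 0" by (simp add: vdiff_def)
  then show "u = 0" using vdiff_cmap(2)[OF assms] by simp
next
  assume "u = 0"
  then show "coord_vector A c x u = (\<lambda>_. 0)"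
    using smooth_near_iff[OF assms] linear_0[OF linear_dir_deriv[OF smooth_at_differentiable]]
    by (auto simp: coord_vector_def fun_eq_iff o_def)
qed

lemma coord_vector_comb:
  assumes "smooth_atlas A" "c \<in> A" "x \<in> cdom c"
  shows "coord_vector A c x (a *\<^sub>R u + b *\<^sub>R v)
    = (\<lambda>f. a * coord_vector A c x u f + b * coord_vector A c x v f)"
proof
  fix f
  show "coord_vector A c x (a *\<^sub>R u + b *\<^sub>R v) f
      = a * coord_vector A c x u f + b * coord_vector A c x v f"
  proof (cases "smooth_near A x f")
    case True
    then have "linear (\<lambda>v. dir_deriv v (\<lambda>y. f (cinv c y)) (cmap c x))"
      using smooth_near_iff[OF assms] linear_dir_deriv[OF smooth_at_differentiable] by blast
    then show ?thesis using True by (simp add: coord_vector_def o_def linear_add linear_cmul)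
  qed (simp add: coord_vector_def)
qed

section \<open>Change of variables\<close>

text \<open>
  The change of variables theorem of the library needs a well-ordered index type. The type
  below is a copy of an arbitrary finite type with such an order.
\<close>

typedef ('n::finite) idx = "{..<CARD('n)}"
  by (rule exI[of _ 0]) simp

instance idx :: (finite) finite
proof
  have "(UNIV :: 'a idx set) = Abs_idx ` {..<CARD('a)}"
    using type_definition.Abs_image[OF type_definition_idx] by metis
  then show "finite (UNIV :: 'a idx set)" by (metis finite_imageI finite_lessThan)
qed

instantiation idx :: (finite) wellorder
begin

definition "i \<le> j \<longleftrightarrow> Rep_idx i \<le> Rep_idx j"
definition "i < j \<longleftrightarrow> Rep_idx i < Rep_idx j"

instance
proof
  fix P :: "'a idx \<Rightarrow> bool" and a
  assume *: "\<And>x. (\<And>y. y < x \<Longrightarrow> P y) \<Longrightarrow> P x"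
  show "P a"
  proof (induction a rule: measure_induct_rule[of Rep_idx])
    case (less x)
    show ?case by (rule *, rule less) (simp only: less_idx_def)
  qed
qed (auto simp: less_eq_idx_def less_idx_def Rep_idx_inject)

end

lemma card_idx: "CARD('n::finite idx) = CARD('n)"
  by (simp add: type_definition.card[OF type_definition_idx])

section \<open>Invariance of determinants and Lebesgue measure under relabelling of
  coordinates\<close>

lemma sign_conjugate:
  fixes e :: "'a::finite \<Rightarrow> 'b::finite"
  assumes "bij e" "permutation p"
  shows "sign (e \<circ> p \<circ> inv e) = sign p"
proof -
  have inv: "inv e (e x) = x" "e (inv e y) = y" for x y
    using assms(1) by (simp_all add: bij_is_inj bij_is_surj surj_f_inv_f)
  \<comment> \<open>Conjugation by e turns the transposition of a and b into that of
    \<open>e a\<close> and \<open>e b\<close>, so the number of factors is kept.\<close>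
  have *: "swapidseq n (e \<circ> p \<circ> inv e)" if "swapidseq n p" for n p
    using that
  proof (induction n p rule: swapidseq.induct)
    case id
    have i: "e \<circ> id \<circ> inv e = id" by (simp add: fun_eq_iff inv)
    show ?case unfolding i by (rule swapidseq.id)
  next
    case (comp_Suc n p a b)
    have t: "e (Transposition.transpose a b z) = Transposition.transpose (e a) (e b) (e z)" for z
      by (auto simp: Transposition.transpose_def bij_is_inj[OF assms(1), THEN inj_eq])
    have eq: "e \<circ> (Transposition.transpose a b \<circ> p) \<circ> inv e
        = Transposition.transpose (e a) (e b) \<circ> (e \<circ> p \<circ> inv e)"
      by (rule ext) (simp add: t)
    have "e a \<noteq> e b" using comp_Suc.hyps inv(1) by metis
    then show ?case unfolding eq by (rule swapidseq.comp_Suc[OF comp_Suc.IH])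
  qed
  obtain n where "swapidseq n p" using assms(2) by (auto simp: permutation_def)
  then have "evenperm p = even n" "evenperm (e \<circ> p \<circ> inv e) = even n"
    using evenperm_unique[OF _ refl] * by auto
  then show ?thesis by (simp add: sign_def)
qed

text \<open>Conjugation by e matches the permutations in the two Leibniz sums and keeps their
  signs.\<close>

lemma det_reindex:
  fixes M :: "real ^ 'n ^ 'n" and e :: "'k::finite \<Rightarrow> 'n::finite"
  assumes "bij e"
  shows "det (\<chi> i j. M $ e i $ e j) = det M"
proof -
  let ?c = "\<lambda>p. e \<circ> p \<circ> inv e"
  have inv: "inv e (e x) = x" "e (inv e y) = y" for x y
    using assms by (simp_all add: bij_is_inj bij_is_surj surj_f_inv_f)
  have bij: "bij_betw ?c {p. p permutes UNIV} {p. p permutes UNIV}"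
  proof (rule bij_betwI[where g = "\<lambda>q. inv e \<circ> q \<circ> e"])
    show "?c \<in> {p. p permutes UNIV} \<rightarrow> {p. p permutes UNIV}"
      using assms bij_imp_bij_inv[OF assms]
      by (auto intro!: bij_imp_permutes bij_comp dest!: permutes_bij)
    show "(\<lambda>q. inv e \<circ> q \<circ> e) \<in> {p. p permutes UNIV} \<rightarrow> {p. p permutes UNIV}"
      using assms bij_imp_bij_inv[OF assms]
      by (auto intro!: bij_imp_permutes bij_comp dest!: permutes_bij)
  qed (auto simp: fun_eq_iff inv)
  have "det M = (\<Sum>p\<in>{p. p permutes (UNIV :: 'k set)}. of_int (sign (?c p)) * (\<Prod>i\<in>UNIV. M $ i $ ?c p i))"
    unfolding det_def by (rule sum.reindex_bij_betw[OF bij, symmetric])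
  also have "\<dots> = det (\<chi> i j. M $ e i $ e j)"
    unfolding det_def
  proof (rule sum.cong[OF refl])
    fix p :: "'k \<Rightarrow> 'k" assume "p \<in> {p. p permutes UNIV}"
    then have "permutation p" by (auto simp: permutation_permutes)
    moreover have "(\<Prod>i\<in>UNIV. M $ i $ ?c p i) = (\<Prod>i\<in>UNIV. M $ e i $ ?c p (e i))"
      using prod.reindex_bij_betw[OF assms, of "\<lambda>i. M $ i $ ?c p i"] by simp
    ultimately show "of_int (sign (?c p)) * (\<Prod>i\<in>UNIV. M $ i $ ?c p i)
        = of_int (sign p) * (\<Prod>i\<in>UNIV. (\<chi> i j. M $ e i $ e j) $ i $ p i)"
      using sign_conjugate[OF assms] by (simp add: inv)
  qed
  finally show ?thesis by simp
qed

definition reindex_vec :: "('k \<Rightarrow> 'n) \<Rightarrow> real ^ 'n \<Rightarrow> real ^ 'k" where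
  "reindex_vec e x = (\<chi> i. x $ e i)"

lemma linear_reindex_vec: "linear (reindex_vec e)"
  by (rule linearI) (auto simp: reindex_vec_def vec_eq_iff)

lemma reindex_vec_measurable: "reindex_vec e \<in> borel_measurable borel"
  using linear_reindex_vec linear_continuous_on linear_conv_bounded_linear
  by (intro borel_measurable_continuous_onI) blast

text \<open>The preimage of a box is a box with the same side lengths in another order, and boxes
  determine Lebesgue measure.\<close>

lemma distr_reindex_vec:
  fixes e :: "'k::finite \<Rightarrow> 'n::finite"
  assumes "bij e"
  shows "distr lborel lborel (reindex_vec e) = (lborel :: (real ^ 'k) measure)"
proof (rule lborel_eqI[symmetric])
  fix l u :: "real ^ 'k"
  assume "\<And>b. b \<in> Basis \<Longrightarrow> l \<bullet> b \<le> u \<bullet> b"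
  then have lu: "l $ i \<le> u $ i" for i by (metis axis_in_Basis_iff Basis_real_def cart_eq_inner_axis insertI1)
  let ?r = "reindex_vec (inv e)"
  have inv: "inv e (e x) = x" "e (inv e y) = y" for x y
    using assms by (simp_all add: bij_is_inj bij_is_surj surj_f_inv_f)
  have "reindex_vec e -` box l u = box (?r l) (?r u)"
    by (auto simp: mem_box_cart reindex_vec_def) (metis inv)+
  then have "emeasure (distr lborel lborel (reindex_vec e)) (box l u) = emeasure lborel (box (?r l) (?r u))"
    by (subst emeasure_distr) (auto simp: reindex_vec_measurable)
  also have "\<dots> = ennreal (\<Prod>b\<in>Basis. (?r u - ?r l) \<bullet> b)"
  proof (rule emeasure_lborel_box)
    fix b :: "real ^ 'n" assume "b \<in> Basis"
    then show "?r l \<bullet> b \<le> ?r u \<bullet> b"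
      using lu by (auto simp: Basis_vec_def inner_axis reindex_vec_def)
  qed
  also have "(\<Prod>b\<in>Basis. (?r u - ?r l) \<bullet> b) = (\<Prod>i\<in>UNIV. (?r u - ?r l) $ i)"
    using prod.reindex[of "\<lambda>i. axis i (1::real)" "UNIV :: 'n set" "\<lambda>b. (?r u - ?r l) \<bullet> b"]
    by (simp add: Basis_vec_def UNION_singleton_eq_range inner_axis o_def inj_on_def axis_eq_axis)
  also have "\<dots> = (\<Prod>i\<in>UNIV. (?r u - ?r l) $ e i)"
    using prod.reindex_bij_betw[OF assms, of "\<lambda>i. (?r u - ?r l) $ i"] by simp
  also have "\<dots> = (\<Prod>i\<in>UNIV. (u - l) $ i)" by (simp add: reindex_vec_def inv)
  also have "\<dots> = (\<Prod>b\<in>Basis. (u - l) \<bullet> b)"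
    using prod.reindex[of "\<lambda>i. axis i (1::real)" "UNIV :: 'k set" "\<lambda>b. (u - l) \<bullet> b"]
    by (simp add: Basis_vec_def UNION_singleton_eq_range inner_axis o_def inj_on_def axis_eq_axis)
  finally show "emeasure (distr lborel lborel (reindex_vec e)) (box l u) = ennreal (\<Prod>b\<in>Basis. (u - l) \<bullet> b)" .
qed simp

lemma set_lborel_reindex_vec:
  fixes e :: "'k::finite \<Rightarrow> 'n::finite" and h :: "real ^ 'k \<Rightarrow> real"
  assumes "bij e" "set_integrable lborel S h"
  shows "set_integrable lborel (reindex_vec e -` S) (\<lambda>x. h (reindex_vec e x))"
    "set_lebesgue_integral lborel (reindex_vec e -` S) (\<lambda>x. h (reindex_vec e x))
      = set_lebesgue_integral lborel S h"
proof -
  have m: "reindex_vec e \<in> measurable lborel lborel"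
    using reindex_vec_measurable by simp
  let ?h = "\<lambda>y. indicat_real S y *\<^sub>R h y"
  have i: "integrable (distr lborel lborel (reindex_vec e)) ?h"
    using assms(2) unfolding distr_reindex_vec[OF assms(1)] set_integrable_def .
  have e: "(\<lambda>x. ?h (reindex_vec e x))
      = (\<lambda>x. indicat_real (reindex_vec e -` S) x *\<^sub>R h (reindex_vec e x))"
    by (auto simp: indicator_def)
  have mh: "?h \<in> borel_measurable lborel"
    using assms(2) unfolding set_integrable_def by (rule borel_measurable_integrable)
  show "set_integrable lborel (reindex_vec e -` S) (\<lambda>x. h (reindex_vec e x))"
    using integrable_distr[OF m i] unfolding set_integrable_def e .
  show "set_lebesgue_integral lborel (reindex_vec e -` S) (\<lambda>x. h (reindex_vec e x))
      = set_lebesgue_integral lborel S h"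
    using integral_distr[OF m mh] unfolding distr_reindex_vec[OF assms(1)] set_lebesgue_integral_def e
    by simp
qed

lemma change_of_variables_wellorder:
  fixes g :: "real ^ 'm::{finite,wellorder} \<Rightarrow> real ^ 'm::_" and f :: "real ^ 'm::_ \<Rightarrow> real"
  assumes "S \<in> sets borel" "\<And>x. x \<in> S \<Longrightarrow> (g has_derivative g' x) (at x)" "inj_on g S"
    and f: "set_integrable lborel (g ` S) f"
    and h: "set_integrable lborel S (\<lambda>x. \<bar>det (matrix (g' x))\<bar> * f (g x))"
  shows "set_lebesgue_integral lborel (g ` S) f
    = set_lebesgue_integral lborel S (\<lambda>x. \<bar>det (matrix (g' x))\<bar> * f (g x))"
proof -
  \<comment> \<open>The theorem used below integrates vector-valued functions against the completed
    measure; a real integrand becomes a vector with one entry.\<close>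
  let ?F = "\<lambda>y. vec (f y) :: real ^ 1"
  let ?v = "vec :: real \<Rightarrow> real ^ 1"
  have bl: "bounded_linear ?v" by (simp add: linear_conv_bounded_linear[symmetric] linear_vec)
  have a: "(\<lambda>x. ?v (u x)) absolutely_integrable_on T \<and> integral T (\<lambda>x. ?v (u x)) = ?v (set_lebesgue_integral lborel T u)"
    if "set_integrable lborel T u" for T and u :: "real ^ 'm::_ \<Rightarrow> real"
  proof -
    have "u absolutely_integrable_on T"
      using that unfolding set_integrable_def
      by (simp add: integrable_completion borel_measurable_integrable)
    moreover have "u integrable_on T" "set_lebesgue_integral lborel T u = integral T u"
      using set_borel_integral_eq_integral[OF that] by auto
    ultimately show ?thesis
      using absolutely_integrable_linear[OF _ bl] integral_linear[OF _ bl] by (auto simp: o_def)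
  qed
  have S: "S \<in> sets lebesgue" using assms(1) by simp
  have d: "(g has_derivative g' x) (at x within S)" if "x \<in> S" for x
    using assms(2)[OF that] has_derivative_at_withinI by blast
  have "(\<lambda>x. \<bar>det (matrix (g' x))\<bar> *\<^sub>R ?F (g x)) = (\<lambda>x. ?v (\<bar>det (matrix (g' x))\<bar> * f (g x)))"
    by (auto simp: vec_eq_iff)
  then have "?v (set_lebesgue_integral lborel (g ` S) f)
      = ?v (set_lebesgue_integral lborel S (\<lambda>x. \<bar>det (matrix (g' x))\<bar> * f (g x)))"
    using has_absolute_integral_change_of_variables[OF S d assms(3), of ?F
        "?v (set_lebesgue_integral lborel (g ` S) f)"] a[OF f] a[OF h] by simp
  then show ?thesis by (simp add: vec_eq_iff)
qed

text \<open>Conjugating g with the relabelling r and its inverse s moves the problem to the ordered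
  index type \<open>'n idx\<close>; integrals and the Jacobian determinant are unaffected.\<close>

theorem change_of_variables_lborel:
  fixes g :: "real ^ 'n::finite \<Rightarrow> real ^ 'n" and f :: "real ^ 'n \<Rightarrow> real"
  assumes S: "S \<in> sets borel" and d: "\<And>x. x \<in> S \<Longrightarrow> (g has_derivative g' x) (at x)"
    and inj: "inj_on g S"
    and f: "set_integrable lborel (g ` S) f"
    and h: "set_integrable lborel S (\<lambda>x. \<bar>det (matrix (g' x))\<bar> * f (g x))"
  shows "set_lebesgue_integral lborel (g ` S) f
    = set_lebesgue_integral lborel S (\<lambda>x. \<bar>det (matrix (g' x))\<bar> * f (g x))"
proof -
  obtain e :: "'n idx \<Rightarrow> 'n" where e: "bij e"
    using card_idx finite_same_card_bij[of "UNIV :: 'n idx set" "UNIV :: 'n set"] by auto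
  have ie: "bij (inv e)" by (rule bij_imp_bij_inv[OF e])
  have inv: "inv e (e x) = x" "e (inv e y) = y" for x y
    using e by (simp_all add: bij_is_inj bij_is_surj surj_f_inv_f)
  define r where "r = (reindex_vec e :: real ^ 'n \<Rightarrow> real ^ ('n idx))"
  define s where "s = (reindex_vec (inv e) :: real ^ ('n idx) \<Rightarrow> real ^ 'n)"
  have rs: "r (s y) = y" "s (r x) = x" for x y
    by (simp_all add: r_def s_def reindex_vec_def inv vec_eq_iff)
  have lin: "linear r" "linear s" by (simp_all add: r_def s_def linear_reindex_vec)
  then have bl: "bounded_linear r" "bounded_linear s" by (simp_all add: linear_conv_bounded_linear)
  define G where "G y = r (g (s y))" for y
  define G' where "G' y v = r (g' (s y) (s v))" for y v
  define T where "T = s -` S"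
  have sT: "s ` T = S"
    unfolding T_def by (rule surj_image_vimage_eq[OF surjI[of s r, OF rs(2)]])
  have det: "det (matrix (G' y)) = det (matrix (g' (s y)))" for y
  proof -
    have "s (axis i 1) = axis (e i) 1" for i
    proof -
      have "inv e k = i \<longleftrightarrow> k = e i" for k by (auto simp: inv)
      then show ?thesis by (simp add: s_def reindex_vec_def axis_def vec_eq_iff)
    qed
    then have "matrix (G' y) = (\<chi> i j. matrix (g' (s y)) $ e i $ e j)"
      by (simp add: G'_def matrix_def r_def reindex_vec_def)
    then show ?thesis by (simp add: det_reindex[OF e])
  qed
  have "continuous_on UNIV s" using bl linear_continuous_on by blast
  then have "s \<in> borel_measurable borel" by (rule borel_measurable_continuous_onI)
  then have T: "T \<in> sets borel" using measurable_sets[OF _ S, of s borel] by (simp add: T_def)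
  have GT: "G ` T = s -` (g ` S)"
  proof -
    have "G ` T = r ` g ` S" by (simp add: G_def image_image sT[symmetric])
    also have "\<dots> = s -` (g ` S)"
    proof
      show "s -` (g ` S) \<subseteq> r ` g ` S"
        using rs(1) by (metis image_eqI subsetI vimageD)
    qed (auto simp: rs)
    finally show ?thesis .
  qed
  have "set_lebesgue_integral lborel (G ` T) (\<lambda>y. f (s y))
      = set_lebesgue_integral lborel T (\<lambda>y. \<bar>det (matrix (G' y))\<bar> * f (s (G y)))"
  proof (rule change_of_variables_wellorder[OF T])
    show "(G has_derivative G' y) (at y)" if "y \<in> T" for y
    proof -
      have "(g has_derivative g' (s y)) (at (s y))" using that d by (simp add: T_def)
      moreover have "(s has_derivative s) (at y)"
        using bl by (simp add: bounded_linear_imp_has_derivative)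
      ultimately have "((\<lambda>y. g (s y)) has_derivative (\<lambda>v. g' (s y) (s v))) (at y)"
        using diff_chain_at[of s s y g "g' (s y)"] by (simp add: o_def)
      then show ?thesis unfolding G_def[abs_def] G'_def[abs_def]
        by (rule bounded_linear.has_derivative[OF bl(1)])
    qed
    show "inj_on G T"
    proof (rule inj_onI)
      fix x y assume xy: "x \<in> T" "y \<in> T" "G x = G y"
      then have "g (s x) = g (s y)" using rs(2) by (metis G_def)
      then have "s x = s y" using xy inj by (auto simp: T_def inj_on_def)
      then show "x = y" using rs(1) by metis
    qed
    show "set_integrable lborel (G ` T) (\<lambda>y. f (s y))"
      unfolding GT s_def by (rule set_lborel_reindex_vec(1)[OF ie f])
    show "set_integrable lborel T (\<lambda>y. \<bar>det (matrix (G' y))\<bar> * f (s (G y)))"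
      using set_lborel_reindex_vec(1)[OF ie h, folded s_def T_def] by (simp add: det G_def rs)
  qed
  moreover have "set_lebesgue_integral lborel (G ` T) (\<lambda>y. f (s y)) = set_lebesgue_integral lborel (g ` S) f"
    unfolding GT s_def by (rule set_lborel_reindex_vec(2)[OF ie f])
  moreover have "set_lebesgue_integral lborel T (\<lambda>y. \<bar>det (matrix (G' y))\<bar> * f (s (G y)))
      = set_lebesgue_integral lborel S (\<lambda>x. \<bar>det (matrix (g' x))\<bar> * f (g x))"
    using set_lborel_reindex_vec(2)[OF ie h, folded s_def T_def] by (simp add: det G_def rs)
  ultimately show ?thesis by simp
qed

section \<open>Determinants near the identity\<close>

text \<open>In the Leibniz sum a permutation other than the identity moves at least two indices.
  After one factor has been differentiated at 0, another off-diagonal entry of the identity matrix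
  remains and kills the term.\<close>

lemma DERIV_det_identity:
  fixes D :: "real ^ 'n ^ 'n"
  shows "((\<lambda>r. det (mat 1 + r *\<^sub>R D)) has_real_derivative trace D) (at 0)"
proof -
  let ?f = "\<lambda>r i j. (mat 1 :: real ^ 'n ^ 'n) $ i $ j + r * D $ i $ j"
  let ?P = "\<lambda>p i. (\<Prod>j\<in>UNIV - {i}. (mat 1 :: real ^ 'n ^ 'n) $ j $ p j)"
  have "((\<lambda>r. \<Sum>p | p permutes UNIV. of_int (sign p) * (\<Prod>i\<in>UNIV. ?f r i (p i))) has_real_derivative
      (\<Sum>p | p permutes UNIV. of_int (sign p) * (\<Sum>i\<in>UNIV. D $ i $ p i * ?P p i))) (at 0)"
  proof (intro DERIV_sum DERIV_cmult)
    fix p :: "'n \<Rightarrow> 'n"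
    have "((\<lambda>r. ?f r i (p i)) has_real_derivative D $ i $ p i) (at 0)" for i
      by (auto intro!: derivative_eq_intros)
    then show "((\<lambda>r. \<Prod>i\<in>UNIV. ?f r i (p i)) has_real_derivative (\<Sum>i\<in>UNIV. D $ i $ p i * ?P p i)) (at 0)"
      using has_field_derivative_prod[where A = UNIV and f = "\<lambda>i r. ?f r i (p i)"
          and f' = "\<lambda>i. D $ i $ p i" and z = 0] by simp
  qed
  moreover have "(\<Sum>p | p permutes UNIV. of_int (sign p) * (\<Sum>i\<in>UNIV. D $ i $ p i * ?P p i))
      = (\<Sum>p | p permutes (UNIV :: 'n set). if p = id then trace D else 0)"
  proof (rule sum.cong[OF refl])
    fix p :: "'n \<Rightarrow> 'n" assume p: "p \<in> {p. p permutes UNIV}"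
    show "of_int (sign p) * (\<Sum>i\<in>UNIV. D $ i $ p i * ?P p i) = (if p = id then trace D else 0)"
    proof (cases "p = id")
      case True
      then show ?thesis by (simp add: trace_def mat_def)
    next
      case False
      have z: "?P p i = 0" for i
      proof -
        obtain a where a: "p a \<noteq> a" using False by (auto simp: fun_eq_iff)
        then have "p (p a) \<noteq> p a" using p by (metis mem_Collect_eq permutes_inj injD)
        then obtain j where "j \<noteq> i" "p j \<noteq> j" using a by metis
        then show ?thesis by (intro prod_zero) (auto simp: mat_def intro!: bexI[of _ j])
      qed
      show ?thesis using False by (simp only: z mult_zero_right sum.neutral_const if_False)
    qed
  qed
  moreover have "\<dots> = trace D"
    by (subst sum.delta) (auto simp: permutes_id finite_permutations)
  ultimately show ?thesis by (simp add: det_def)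
qed

lemma matrix_mult_scaleR:
  fixes A :: "real ^ 'n ^ 'm" and B :: "real ^ 'k ^ 'n"
  shows "(r *\<^sub>R A) ** B = r *\<^sub>R (A ** B)" "A ** (r *\<^sub>R B) = r *\<^sub>R (A ** B)"
  by (simp_all add: matrix_matrix_mult_def vec_eq_iff sum_distrib_left mult_ac)

lemma matrix_add_rdistrib:
  fixes A B :: "real ^ 'n ^ 'm" and C :: "real ^ 'k ^ 'n"
  shows "(A + B) ** C = A ** C + B ** C"
  by (simp add: matrix_matrix_mult_def vec_eq_iff sum.distrib distrib_right)

text \<open>Jacobi's formula. With C inverse to 1 + r D, the factorization 1 + s D = (1 + r D) (1 +
  (s - r) C D) shifts the derivative to the identity.\<close>

lemma DERIV_det_line:
  fixes D C :: "real ^ 'n ^ 'n"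
  assumes "(mat 1 + r *\<^sub>R D) ** C = mat 1"
  shows "((\<lambda>r. det (mat 1 + r *\<^sub>R D)) has_real_derivative
    det (mat 1 + r *\<^sub>R D) * trace (C ** D)) (at r)"
proof -
  have e: "det (mat 1 + s *\<^sub>R D) = det (mat 1 + r *\<^sub>R D) * det (mat 1 + (s - r) *\<^sub>R (C ** D))" for s
  proof -
    have "mat 1 + s *\<^sub>R D = (mat 1 + r *\<^sub>R D) + (s - r) *\<^sub>R D" by (simp add: algebra_simps)
    also have "\<dots> = (mat 1 + r *\<^sub>R D) ** (mat 1 + (s - r) *\<^sub>R (C ** D))"
      using assms by (simp add: matrix_add_ldistrib matrix_mult_scaleR matrix_mul_assoc)
    finally show ?thesis by (simp add: det_mul)
  qed
  have "((\<lambda>s. det (mat 1 + (s - r) *\<^sub>R (C ** D))) has_real_derivative trace (C ** D) * 1) (at r)"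
  proof (rule DERIV_chain2[where f = "\<lambda>t. det (mat 1 + t *\<^sub>R (C ** D))" and g = "\<lambda>s. s - r"])
    show "((\<lambda>t. det (mat 1 + t *\<^sub>R (C ** D))) has_real_derivative trace (C ** D)) (at (r - r))"
      using DERIV_det_identity[of "C ** D"] by simp
    show "((\<lambda>s. s - r) has_real_derivative 1) (at r)" by (auto intro!: derivative_eq_intros)
  qed
  from DERIV_cmult[OF this, of "det (mat 1 + r *\<^sub>R D)"] show ?thesis
    unfolding e[abs_def, symmetric] by simp
qed

text \<open>Cauchy-Schwarz row by row; \<open>norm M\<close> is the Frobenius norm, the Euclidean
  norm of the nested vector.\<close>

lemma inner_matrix_vector_le:
  fixes M :: "real ^ 'n ^ 'm"
  shows "norm (M *v x) \<le> norm M * norm x"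
proof -
  have "(norm (M *v x))\<^sup>2 = (\<Sum>i\<in>UNIV. (M $ i \<bullet> x)\<^sup>2)"
    unfolding power2_norm_eq_inner
    by (simp add: inner_vec_def matrix_vector_mult_def power2_eq_square)
  also have "\<dots> \<le> (\<Sum>i\<in>UNIV. (norm (M $ i))\<^sup>2 * (norm x)\<^sup>2)"
    using Cauchy_Schwarz_ineq[of "M $ _" x] by (intro sum_mono) (simp add: power2_norm_eq_inner)
  also have "\<dots> = (norm M * norm x)\<^sup>2"
    by (simp add: norm_vec_def[of M] L2_set_def power_mult_distrib sum_distrib_right sum_nonneg)
  finally show ?thesis by (rule power2_le_imp_le) simp
qed

text \<open>The segment from the identity to H consists of positive definite forms, hence of
  invertible matrices; along it the determinant starts at 1 and cannot change sign.\<close>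

lemma pos_def_det_pos:
  fixes H :: "real ^ 'n ^ 'n"
  assumes "\<And>x. x \<noteq> 0 \<Longrightarrow> x \<bullet> (H *v x) > 0"
  shows "det H > 0"
proof (rule ccontr)
  assume "\<not> det H > 0"
  let ?M = "\<lambda>r. (1 - r) *\<^sub>R (mat 1) + r *\<^sub>R H"
  have nz: "det (?M r) \<noteq> 0" if "0 \<le> r" "r \<le> 1" for r
  proof
    assume "det (?M r) = 0"
    then obtain x where x: "x \<noteq> 0" "?M r *v x = 0"
      using matrix_left_invertible_ker[of "?M r"] invertible_left_inverse[of "?M r"]
        invertible_det_nz[of "?M r"] by blast
    have "x \<bullet> (?M r *v x) = (1 - r) * (x \<bullet> x) + r * (x \<bullet> (H *v x))"
      by (simp add: matrix_vector_mult_add_rdistrib scaleR_matrix_vector_assoc[symmetric] inner_add_right)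
    moreover have "x \<bullet> x > 0" "x \<bullet> (H *v x) > 0" using x assms by auto
    then have "(1 - r) * (x \<bullet> x) + r * (x \<bullet> (H *v x)) > 0"
      using that by (cases "r = 0") (auto intro!: add_nonneg_pos)
    ultimately show False using x(2) by simp
  qed
  have "continuous_on {0..1} (\<lambda>r. det (?M r))"
    unfolding det_def by (intro continuous_intros)
  moreover have "det (?M 0) = 1" "det (?M 1) \<le> 0" using \<open>\<not> det H > 0\<close> by auto
  ultimately obtain r where "0 \<le> r" "r \<le> 1" "det (?M r) = 0"
    using IVT2'[of "\<lambda>r. det (?M r)" 1 0 0] by auto
  then show False using nz by blast
qed

text \<open>|x . S x| \<le> |S| |x|^2 < |x|^2 for nonzero x, so r S is too small to spoil the
  positivity of the identity.\<close>

lemma det_symmetric_pos: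
  fixes S :: "real ^ 'n ^ 'n"
  assumes "norm S < 1" "0 \<le> r" "r \<le> 1"
  shows "det (mat 1 + r *\<^sub>R S) > 0" "x \<noteq> 0 \<Longrightarrow> x \<bullet> ((mat 1 + r *\<^sub>R S) *v x) > 0"
proof -
  have *: "x \<bullet> ((mat 1 + r *\<^sub>R S) *v x) > 0" if "x \<noteq> 0" for x
  proof -
    have "x \<bullet> ((mat 1 + r *\<^sub>R S) *v x) = x \<bullet> x + r * (x \<bullet> (S *v x))"
      by (simp add: matrix_vector_mult_add_rdistrib scaleR_matrix_vector_assoc[symmetric] inner_add_right)
    moreover have "\<bar>x \<bullet> (S *v x)\<bar> \<le> norm x * (norm S * norm x)"
      using Cauchy_Schwarz_ineq2[of x "S *v x"] inner_matrix_vector_le[of S x]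
      by (meson mult_left_mono norm_ge_zero order_trans)
    moreover have "norm x * (norm S * norm x) < x \<bullet> x"
      using that assms(1) by (simp add: dot_square_norm power2_eq_square mult.left_commute)
    ultimately have "r * \<bar>x \<bullet> (S *v x)\<bar> < x \<bullet> x"
      using assms(2,3) by (smt (verit) abs_ge_zero mult_left_le_one_le)
    then have "\<bar>r * (x \<bullet> (S *v x))\<bar> < x \<bullet> x" using assms(2) by (simp add: abs_mult)
    then show ?thesis
      using \<open>x \<bullet> ((mat 1 + r *\<^sub>R S) *v x) = x \<bullet> x + r * (x \<bullet> (S *v x))\<close> by linarith
  qed
  then show "det (mat 1 + r *\<^sub>R S) > 0" "x \<noteq> 0 \<Longrightarrow> x \<bullet> ((mat 1 + r *\<^sub>R S) *v x) > 0"
    using pos_def_det_pos by blast+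
qed

text \<open>
  With \<open>C = (1 + r S)\<^sup>-\<^sup>1 = 1 - r S C\<close> the logarithmic derivative of \<open>det (1 + r S)\<close> is
  \<open>tr (C S) = tr S - r tr (S C S)\<close>, which is nonpositive if \<open>tr S = 0\<close>.
\<close>

lemma det_symmetric_traceless_le_1:
  fixes S :: "real ^ 'n ^ 'n"
  assumes "transpose S = S" "trace S = 0" "norm S < 1"
  shows "det (mat 1 + S) \<le> 1"
proof -
  let ?P = "\<lambda>r. det (mat 1 + r *\<^sub>R S)"
  have "\<exists>y. (?P has_real_derivative y) (at r) \<and> y \<le> 0" if r: "0 \<le> r" "r \<le> 1" for r
  proof -
    let ?M = "mat 1 + r *\<^sub>R S"
    have dpos: "det ?M > 0" using det_symmetric_pos[OF assms(3) r] by blast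
    define C where "C = matrix_inv ?M"
    have C: "?M ** C = mat 1" "C ** ?M = mat 1"
      using matrix_inv_inverse[of ?M] dpos by (auto simp: C_def)
    have "C + r *\<^sub>R (S ** C) = mat 1"
      using C(1) by (simp add: matrix_add_rdistrib matrix_mult_scaleR)
    then have "C = mat 1 - r *\<^sub>R (S ** C)" by (simp add: eq_diff_eq)
    then have "C ** S = S - r *\<^sub>R (S ** C ** S)"
      using matrix_add_rdistrib[of C "r *\<^sub>R (S ** C)" S] \<open>C + r *\<^sub>R (S ** C) = mat 1\<close>
      by (simp add: matrix_mult_scaleR eq_diff_eq)
    then have "trace (C ** S) = - r * trace (S ** C ** S)"
      using assms(2) by (simp add: trace_def sum_subtractf sum_distrib_left sum_negf)
    moreover have "trace (S ** C ** S) \<ge> 0"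
    proof -
      have "(S ** C ** S) $ i $ i \<ge> 0" for i
      proof -
        \<comment> \<open>With z = (1 + r S)^-1 S e_i the diagonal entry becomes z . (1 + r S) z,
          and 1 + r S is positive definite.\<close>
        define y where "y = S *v axis i 1"
        define z where "z = C *v y"
        have "?M *v z = y" using C(1) by (simp add: z_def matrix_vector_mul_assoc)
        have "(S ** C ** S) $ i $ i = axis i 1 \<bullet> ((S ** C ** S) *v axis i 1)"
          by (simp add: matrix_vector_mult_basis inner_axis' column_def)
        also have "\<dots> = (transpose S *v axis i 1) \<bullet> (C *v y)"
          by (simp add: y_def dot_lmul_matrix[symmetric] vector_transpose_matrix flip: matrix_vector_mul_assoc)
        also have "\<dots> = z \<bullet> (?M *v z)"
          using \<open>?M *v z = y\<close> by (simp add: assms(1) y_def z_def inner_commute)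
        also have "\<dots> \<ge> 0" using det_symmetric_pos(2)[OF assms(3) r, of z] by (cases "z = 0") auto
        finally show ?thesis .
      qed
      then show ?thesis by (simp add: trace_def sum_nonneg)
    qed
    ultimately have "det ?M * trace (C ** S) \<le> 0"
      using dpos r by (simp add: mult_nonneg_nonpos)
    then show ?thesis using DERIV_det_line[OF C(1)] by blast
  qed
  then have "?P 1 \<le> ?P 0" by (intro DERIV_nonpos_imp_nonincreasing[of 0 1]) auto
  then show ?thesis by simp
qed


lemma norm_power2_symmetric_matrix:
  fixes S :: "real ^ 'n ^ 'n"
  assumes "transpose S = S"
  shows "(norm S)\<^sup>2 = trace (S ** S)"
proof -
  have "S $ i $ j = S $ j $ i" for i j using assms by (metis transpose_def vec_lambda_beta)
  then show ?thesis
    by (simp add: power2_norm_eq_inner inner_vec_def trace_def matrix_matrix_mult_def)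
qed

text \<open>\<open>W\<close> is self-adjoint for the inner product with Gram matrix \<open>R R\<^sup>T\<close>.\<close>

lemma
  fixes W R :: "real ^ 'n ^ 'n"
  assumes "det R \<noteq> 0" "transpose (W ** (R ** transpose R)) = W ** (R ** transpose R)"
    "s\<^sup>2 * trace (W ** W) < 1"
  shows det_selfadjoint_pos: "det (mat 1 + s *\<^sub>R W) > 0"
    and det_selfadjoint_traceless_le_1: "trace W = 0 \<Longrightarrow> det (mat 1 + s *\<^sub>R W) \<le> 1"
proof -
  define Q where "Q = matrix_inv R"
  have Q: "R ** Q = mat 1" "Q ** R = mat 1" using matrix_inv_inverse[OF assms(1)] by (auto simp: Q_def)
  \<comment> \<open>After conjugation with R, that is in an orthonormal frame, self-adjointness
    becomes symmetry; determinants and traces do not notice the conjugation.\<close>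
  define T where "T = Q ** W ** R"
  have QT: "transpose R ** transpose Q = mat 1" "transpose Q ** transpose R = mat 1"
    using Q by (metis matrix_transpose_mul transpose_mat)+
  have T: "T = Q ** (W ** (R ** transpose R)) ** transpose Q"
  proof -
    have "Q ** (W ** (R ** transpose R)) ** transpose Q = Q ** W ** R ** (transpose R ** transpose Q)"
      by (simp add: matrix_mul_assoc)
    then show ?thesis by (simp add: QT T_def)
  qed
  have "transpose T = T"
  proof -
    have "transpose (Q ** X ** transpose Q) = Q ** transpose X ** transpose Q" for X :: "real ^ 'n ^ 'n"
      by (simp add: matrix_transpose_mul matrix_mul_assoc)
    then show ?thesis unfolding T by (simp only: assms(2))
  qed
  have TT: "T ** T = Q ** (W ** W) ** R"
  proof -
    have "T ** T = Q ** W ** (R ** Q) ** W ** R" by (simp add: T_def matrix_mul_assoc)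
    then show ?thesis by (simp add: Q matrix_mul_assoc)
  qed
  have tr: "trace (Q ** X ** R) = trace X" for X
    using trace_mul_sym[of "Q ** X" R] by (simp add: matrix_mul_assoc Q)
  define S where "S = s *\<^sub>R T"
  have S: "transpose S = S" using \<open>transpose T = T\<close> by (simp add: S_def transpose_def vec_eq_iff)
  \<comment> \<open>The squared Frobenius norm of a symmetric matrix is a trace, so the smallness
    condition can be stated for W without reference to R.\<close>
  have "(norm S)\<^sup>2 = s\<^sup>2 * trace (W ** W)"
  proof -
    have "trace (S ** S) = s * s * trace (T ** T)"
      by (simp add: S_def matrix_mult_scaleR trace_def sum_distrib_left)
    then show ?thesis using norm_power2_symmetric_matrix[OF S] by (simp add: TT tr power2_eq_square)
  qed
  then have n: "norm S < 1" using assms(3) power2_less_imp_less[of "norm S" 1] by simp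
  have "mat 1 + S = Q ** (mat 1 + s *\<^sub>R W) ** R"
    by (simp add: S_def T_def matrix_add_ldistrib matrix_add_rdistrib matrix_mult_scaleR Q)
  then have d: "det (mat 1 + s *\<^sub>R W) = det (mat 1 + S)"
    using arg_cong[OF Q(2), of det] by (simp add: det_mul)
  show "det (mat 1 + s *\<^sub>R W) > 0"
    using det_symmetric_pos(1)[OF n, of 1] by (simp add: d)
  have "trace S = s * trace W"
  proof -
    have "trace S = s * trace T" by (simp add: S_def trace_def sum_distrib_left)
    then show ?thesis by (simp add: T_def tr)
  qed
  then show "det (mat 1 + s *\<^sub>R W) \<le> 1" if "trace W = 0"
    using det_symmetric_traceless_le_1[OF S _ n] that by (simp add: d)
qed

section \<open>Immersions into the light-cone in coordinates\<close>

lemma lorentz_eq_inner: "lorentz v w = (- fst v, snd v) \<bullet> w"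
  by (cases w) (simp add: lorentz_def inner_prod_def)

lemma bounded_bilinear_lorentz: "bounded_bilinear lorentz"
proof -
  have "bounded_linear (\<lambda>v. (- fst v, snd v :: real \<times> (real ^ 'n)))"
    by (intro bounded_linear_intros bounded_linear_minus bounded_linear_fst bounded_linear_snd)
  then show ?thesis
    using bounded_bilinear.comp1[OF bounded_bilinear_inner] by (simp add: lorentz_eq_inner[abs_def])
qed

interpretation lorentz: bounded_bilinear lorentz
  by (rule bounded_bilinear_lorentz)

lemma lorentz_commute: "lorentz v w = lorentz w v"
  by (simp add: lorentz_def inner_commute)

lemma lorentz_nondegenerate:
  assumes "\<And>w. lorentz v w = 0"
  shows "v = 0"
proof -
  have "(- fst v, snd v) \<bullet> (- fst v, snd v) = 0" using assms lorentz_eq_inner by metis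
  then have "(- fst v, snd v) = 0" by (simp only: inner_eq_zero_iff)
  then show ?thesis by (simp add: prod_eq_iff)
qed

text \<open>The Leibniz rule for a constant product: the source of the relations between the frame
  vectors and their derivatives.\<close>

lemma dir_deriv_lorentz_const:
  assumes "open U" "y \<in> U" "f differentiable (at y)" "g differentiable (at y)"
    "\<And>z. z \<in> U \<Longrightarrow> lorentz (f z) (g z) = c"
  shows "lorentz (dir_deriv v f y) (g y) = - lorentz (f y) (dir_deriv v g y)"
proof -
  have "dir_deriv v (\<lambda>z. lorentz (f z) (g z)) y = dir_deriv v (\<lambda>z. c) y"
    by (rule dir_deriv_cong_open[OF assms(1,5,2)])
  then show ?thesis
    using dir_deriv_bilinear[OF bounded_bilinear_lorentz assms(3,4)] by simp
qed

lemma dir_deriv_sum_axis: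
  fixes f :: "real ^ 'n \<Rightarrow> 'b::real_normed_vector"
  assumes "f differentiable (at y)"
  shows "dir_deriv v f y = (\<Sum>i\<in>UNIV. v $ i *\<^sub>R dir_deriv (axis i 1) f y)"
proof -
  have "v = (\<Sum>i\<in>UNIV. v $ i *\<^sub>R axis i 1)" using basis_expansion[of v] by (simp add: scalar_mult_eq_scaleR)
  then have "dir_deriv v f y = dir_deriv (\<Sum>i\<in>UNIV. v $ i *\<^sub>R axis i 1) f y" by simp
  then show ?thesis by (simp add: linear_sum[OF linear_dir_deriv[OF assms]] linear_cmul[OF linear_dir_deriv[OF assms]])
qed

text \<open>The immersion in one chart, stripped of the manifold. \<open>spacelike\<close> encodes
  that the induced metric is Riemannian.\<close>

locale light_cone_patch =
  fixes U :: "(real ^ 'n::finite) set" and P :: "real ^ 'n \<Rightarrow> 'n minkowski"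
  assumes open_U: "open U" and smooth_P: "smooth_on U P"
    and null_P: "y \<in> U \<Longrightarrow> lorentz (P y) (P y) = 0"
    and spacelike: "y \<in> U \<Longrightarrow> v \<noteq> 0 \<Longrightarrow> lorentz (dir_deriv v P y) (dir_deriv v P y) > 0"
begin

definition E :: "'n \<Rightarrow> real ^ 'n \<Rightarrow> 'n minkowski" where
  "E i = dir_deriv (axis i 1) P"

definition H :: "real ^ 'n \<Rightarrow> real ^ 'n ^ 'n" where
  "H y = (\<chi> i j. lorentz (E i y) (E j y))"

definition Hi :: "real ^ 'n \<Rightarrow> real ^ 'n ^ 'n" where
  "Hi y = matrix_inv (H y)"

text \<open>The reciprocal frame: the index is raised with the inverse Gram matrix, so pairing with
  \<open>Eu k\<close> reads off the k-th tangential component.\<close>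

definition Eu :: "'n \<Rightarrow> real ^ 'n \<Rightarrow> 'n minkowski" where
  "Eu k y = (\<Sum>l\<in>UNIV. Hi y $ k $ l *\<^sub>R E l y)"

lemma E_apply: "dir_deriv (axis i 1) P y = E i y"
  by (simp add: E_def)

lemma smooth_E: "smooth_on U (E i)"
  unfolding E_def by (rule smooth_on_dir_deriv[OF smooth_P])

lemmas diff_P = smooth_on_differentiable[OF smooth_P]
  and diff_E = smooth_on_differentiable[OF smooth_E]

lemma dir_deriv_P: "y \<in> U \<Longrightarrow> dir_deriv v P y = (\<Sum>i\<in>UNIV. v $ i *\<^sub>R E i y)"
  unfolding E_def by (rule dir_deriv_sum_axis[OF smooth_on_differentiable[OF smooth_P]])

lemma H_commute: "H y $ i $ j = H y $ j $ i"
  by (simp add: H_def lorentz_commute)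

lemma transpose_H: "transpose (H y) = H y"
  using H_commute[of y] by (simp add: transpose_def vec_eq_iff)

lemma H_form: "y \<in> U \<Longrightarrow> v \<bullet> (H y *v w) = lorentz (dir_deriv v P y) (dir_deriv w P y)"
  by (simp add: dir_deriv_P inner_vec_def matrix_vector_mult_def H_def lorentz.sum_left lorentz.sum_right
      lorentz.scaleR_left lorentz.scaleR_right sum_distrib_left mult_ac) (rule sum.swap)

lemma det_H: "y \<in> U \<Longrightarrow> det (H y) > 0"
  using spacelike by (intro pos_def_det_pos) (simp add: H_form)

lemma H_Hi: "y \<in> U \<Longrightarrow> H y ** Hi y = mat 1" "y \<in> U \<Longrightarrow> Hi y ** H y = mat 1"
  using matrix_inv_inverse[of "H y"] det_H[of y] by (auto simp: Hi_def)

lemma smooth_H: "smooth_on U (\<lambda>y. H y $ i $ j)"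
  unfolding H_def by (simp add: smooth_on_bilinear[OF open_U bounded_bilinear_lorentz smooth_E smooth_E])

lemma smooth_Hi: "smooth_on U (\<lambda>y. Hi y $ i $ j)"
  unfolding Hi_def using det_H
  by (intro smooth_on_matrix_inv open_U smooth_H) (simp add: less_imp_neq[symmetric])

lemma smooth_Eu: "smooth_on U (Eu k)"
  unfolding Eu_def[abs_def] by (intro smooth_on_sum smooth_on_scaleR open_U smooth_Hi smooth_E)

lemma lorentz_Eu_E: "y \<in> U \<Longrightarrow> lorentz (Eu k y) (E j y) = (if k = j then 1 else 0)"
proof -
  assume "y \<in> U"
  have "lorentz (Eu k y) (E j y) = (Hi y ** H y) $ k $ j"
    by (simp add: Eu_def lorentz.sum_left lorentz.scaleR_left matrix_matrix_mult_def H_def)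
  then show ?thesis by (simp add: H_Hi \<open>y \<in> U\<close> mat_def)
qed

lemma E_eq_sum_Eu: "y \<in> U \<Longrightarrow> E j y = (\<Sum>k\<in>UNIV. H y $ j $ k *\<^sub>R Eu k y)"
proof -
  assume "y \<in> U"
  have "(\<Sum>k\<in>UNIV. H y $ j $ k *\<^sub>R Eu k y) = (\<Sum>l\<in>UNIV. (\<Sum>k\<in>UNIV. H y $ j $ k * Hi y $ k $ l) *\<^sub>R E l y)"
    unfolding Eu_def scaleR_sum_right scaleR_sum_left by (subst sum.swap) simp
  also have "\<dots> = (\<Sum>l\<in>UNIV. (H y ** Hi y) $ j $ l *\<^sub>R E l y)"
    by (simp add: matrix_matrix_mult_def)
  also have "\<dots> = (\<Sum>l\<in>UNIV. if l = j then E l y else 0)"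
    by (intro sum.cong) (auto simp: H_Hi \<open>y \<in> U\<close> mat_def)
  finally show ?thesis by simp
qed

lemma sum_lorentz_Eu: "y \<in> U \<Longrightarrow> (\<Sum>k\<in>UNIV. lorentz w (Eu k y) * H y $ k $ j) = lorentz w (E j y)"
  using E_eq_sum_Eu[of y j]
  by (simp add: lorentz.sum_right lorentz.scaleR_right H_commute[of y _ j] mult.commute)

lemma lorentz_dP_P:
  assumes y: "y \<in> U"
  shows "lorentz (dir_deriv v P y) (P y) = 0"
proof -
  have "lorentz (dir_deriv v P y) (P y) = - lorentz (P y) (dir_deriv v P y)"
    by (rule dir_deriv_lorentz_const[OF open_U y diff_P[OF y] diff_P[OF y]]) (rule null_P)
  then show ?thesis using lorentz_commute[of "P y"] by simp
qed

lemma lorentz_E_P: "y \<in> U \<Longrightarrow> lorentz (E i y) (P y) = 0"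
  by (simp add: E_def lorentz_dP_P)

lemma lorentz_Eu_P: "y \<in> U \<Longrightarrow> lorentz (Eu i y) (P y) = 0"
  by (simp add: Eu_def lorentz.sum_left lorentz.scaleR_left lorentz_E_P)

text \<open>Differentiate the relation that \<open>E j\<close> is orthogonal to P. As the normal
  vector P is also the position vector, the metric itself appears, up to sign, as the second
  fundamental form along P.\<close>

lemma lorentz_dE_P:
  assumes y: "y \<in> U"
  shows "lorentz (dir_deriv (axis i 1) (E j) y) (P y) = - H y $ i $ j"
proof -
  have "lorentz (dir_deriv (axis i 1) (E j) y) (P y) = - lorentz (E j y) (dir_deriv (axis i 1) P y)"
    by (rule dir_deriv_lorentz_const[OF open_U y diff_E[OF y] diff_P[OF y]]) (rule lorentz_E_P)
  then show ?thesis by (simp add: H_def E_apply lorentz_commute)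
qed

text \<open>A null vector without time component is 0; then the second fundamental form along P,
  which is minus the metric, would vanish on the diagonal.\<close>

lemma time_P: "y \<in> U \<Longrightarrow> fst (P y) \<noteq> 0"
proof
  assume y: "y \<in> U" and "fst (P y) = 0"
  then have "P y = 0" using null_P[OF y] by (simp add: lorentz_def prod_eq_iff)
  then have "H y $ i $ i = 0" for i using lorentz_dE_P[OF y, of i i] by (simp add: lorentz.zero_right)
  moreover have "H y $ i $ i > 0" for i
    using spacelike[OF y, of "axis i 1"] by (simp add: H_def E_def axis_eq_0_iff)
  ultimately show False by (metis less_irrefl)
qed

text \<open>
  The normal plane contains the null vector \<open>P\<close>; its other null direction is computed from the
  projection \<open>V\<close> of the time direction.
\<close>

definition V :: "real ^ 'n \<Rightarrow> 'n minkowski" where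
  "V y = (1, 0) - (\<Sum>k\<in>UNIV. lorentz (1, 0) (Eu k y) *\<^sub>R E k y)"

text \<open>In the ansatz a V + b P the pairing with P forces a = 1 / <V, P>, and nullity then
  determines b.\<close>

definition dual :: "real ^ 'n \<Rightarrow> 'n minkowski" where
  "dual y = (1 / lorentz (V y) (P y)) *\<^sub>R V y
     - (lorentz (V y) (V y) / (2 * (lorentz (V y) (P y) * lorentz (V y) (P y)))) *\<^sub>R P y"

lemma lorentz_V_P: "y \<in> U \<Longrightarrow> lorentz (V y) (P y) \<noteq> 0"
  using time_P[of y] lorentz_E_P[of y]
  by (simp add: V_def lorentz.diff_left lorentz.sum_left lorentz.scaleR_left) (simp add: lorentz_def)

lemma lorentz_E_V: "y \<in> U \<Longrightarrow> lorentz (E j y) (V y) = 0"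
  using sum_lorentz_Eu[of y "(1, 0)" j]
  by (simp add: V_def lorentz.diff_right lorentz.sum_right lorentz.scaleR_right H_commute[of y _ j]
      lorentz_commute[of "E j y"] lorentz.diff_left lorentz.sum_left lorentz.scaleR_left H_def)

lemma smooth_V: "smooth_on U V"
  unfolding V_def[abs_def]
  by (intro smooth_on_diff smooth_on_sum smooth_on_scaleR open_U smooth_E smooth_on_const
      smooth_on_bilinear[OF _ bounded_bilinear_lorentz] smooth_Eu)

lemma smooth_dual: "smooth_on U dual"
  unfolding dual_def[abs_def] using lorentz_V_P
  by (intro smooth_on_diff smooth_on_scaleR open_U smooth_P smooth_V smooth_on_divide smooth_on_mult
      smooth_on_bilinear[OF _ bounded_bilinear_lorentz] smooth_on_const) auto

lemma dual_props:
  assumes "y \<in> U"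
  shows "lorentz (dual y) (dual y) = 0" "lorentz (P y) (dual y) = 1" "lorentz (dir_deriv v P y) (dual y) = 0"
proof -
  note n = lorentz_V_P[OF assms] null_P[OF assms] lorentz_commute[of "P y" "V y"]
  show "lorentz (dual y) (dual y) = 0"
    using n by (simp add: dual_def lorentz.diff_left lorentz.diff_right lorentz.scaleR_left
        lorentz.scaleR_right field_simps)
  show "lorentz (P y) (dual y) = 1"
    using n by (simp add: dual_def lorentz.diff_right lorentz.scaleR_right)
  show "lorentz (dir_deriv v P y) (dual y) = 0"
    using lorentz_E_V[OF assms] lorentz_E_P[OF assms]
    by (simp add: dual_def dir_deriv_P[OF assms] lorentz.diff_right lorentz.scaleR_right lorentz.sum_left
        lorentz.scaleR_left)
qed

text \<open>Pairing a linear relation with q, P and \<open>Eu j\<close> isolates its coefficients,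
  so the n + 2 frame vectors are independent and span; the Lorentz product is nondegenerate. The
  coefficients are packed into a Minkowski vector to make T an endomorphism.\<close>

lemma frame_complete:
  assumes y: "y \<in> U" and q: "lorentz q q = 0" "lorentz (P y) q = 1" "\<And>i. lorentz (E i y) q = 0"
    and w: "\<And>i. lorentz w (E i y) = 0" "lorentz w (P y) = 0" "lorentz w q = 0"
  shows "w = 0"
proof -
  define T where "T z = fst z *\<^sub>R P y + fst (snd z) *\<^sub>R q + (\<Sum>k\<in>UNIV. snd (snd z) $ k *\<^sub>R E k y)"
    for z :: "'n minkowski"
  have lin: "linear T"
    by (rule linearI) (simp_all add: T_def algebra_simps sum.distrib scaleR_sum_right)
  have "inj T"
    unfolding linear_injective_0[OF lin]
  proof (intro allI impI)
    fix z assume z: "T z = 0"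
    have "lorentz (T z) q = fst z" "lorentz (T z) (P y) = fst (snd z)"
      using q null_P[OF y] lorentz_E_P[OF y]
      by (simp_all add: T_def lorentz.add_left lorentz.scaleR_left lorentz.sum_left lorentz_commute[of q "P y"])
    moreover have "lorentz (T z) (Eu j y) = snd (snd z) $ j" for j
    proof -
      have "lorentz q (Eu j y) = 0"
        using q(3) by (simp add: lorentz_commute[of q] Eu_def lorentz.sum_left lorentz.scaleR_left)
      then have "lorentz (T z) (Eu j y) = (\<Sum>k\<in>UNIV. snd (snd z) $ k * (if j = k then 1 else 0))"
        using lorentz_Eu_P[OF y] lorentz_Eu_E[OF y]
        by (simp add: T_def lorentz.add_left lorentz.scaleR_left lorentz.sum_left
            lorentz_commute[of "P y"] lorentz_commute[of "E _ y" "Eu j y"])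
      also have "\<dots> = (\<Sum>k\<in>UNIV. if j = k then snd (snd z) $ k else 0)"
        by (intro sum.cong) auto
      finally show ?thesis by simp
    qed
    ultimately show "z = 0" by (simp add: z lorentz.zero_left prod_eq_iff vec_eq_iff)
  qed
  then have "surj T" by (rule eucl.linear_inj_imp_surj[OF lin])
  moreover have "lorentz w (T z) = 0" for z
    using w by (simp add: T_def lorentz.add_right lorentz.scaleR_right lorentz.sum_right)
  ultimately show ?thesis by (metis lorentz_nondegenerate surjD)
qed

text \<open>By completeness of the frame, q differs from \<open>dual y\<close> by a multiple c P;
  nullity of q then reads 2 c = 0.\<close>

lemma dual_unique:
  assumes y: "y \<in> U" and q: "lorentz q q = 0" "lorentz (P y) q = 1" "\<And>v. lorentz (dir_deriv v P y) q = 0"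
  shows "q = dual y"
proof -
  note d = dual_props[OF y]
  define c where "c = lorentz q (dual y)"
  have "q - dual y - c *\<^sub>R P y = 0"
  proof (rule frame_complete[OF y d(1,2)])
    show Ed: "lorentz (E i y) (dual y) = 0" for i
      using d(3)[of "axis i 1"] by (simp add: E_apply)
    show "lorentz (q - dual y - c *\<^sub>R P y) (E i y) = 0" for i
    proof -
      have "lorentz q (E i y) = 0" using q(3)[of "axis i 1"] by (simp add: E_apply lorentz_commute[of q])
      moreover have "lorentz (dual y) (E i y) = 0" using Ed lorentz_commute by metis
      moreover have "lorentz (P y) (E i y) = 0" using lorentz_E_P[OF y] lorentz_commute by metis
      ultimately show ?thesis by (simp add: lorentz.diff_left lorentz.scaleR_left)
    qed
    show "lorentz (q - dual y - c *\<^sub>R P y) (P y) = 0"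
      using q(2) d(2) null_P[OF y] lorentz_commute[of q "P y"] lorentz_commute[of "dual y" "P y"]
      by (simp add: lorentz.diff_left lorentz.scaleR_left)
    show "lorentz (q - dual y - c *\<^sub>R P y) (dual y) = 0"
      using d by (simp add: lorentz.diff_left lorentz.scaleR_left c_def)
  qed
  then have e: "q = dual y + c *\<^sub>R P y" by (simp add: algebra_simps)
  have "lorentz q q = 2 * c"
    using d null_P[OF y] unfolding e
    by (simp add: lorentz.add_left lorentz.add_right lorentz.scaleR_left lorentz.scaleR_right lorentz_commute[of "dual y" "P y"])
  then show ?thesis using q(1) e by simp
qed

end

locale dual_patch = light_cone_patch U P
    for U :: "(real ^ 'n::finite) set" and P :: "real ^ 'n \<Rightarrow> 'n minkowski" +
  fixes Q :: "real ^ 'n \<Rightarrow> 'n minkowski"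
  assumes smooth_Q: "smooth_on U Q"
    and null_Q: "y \<in> U \<Longrightarrow> lorentz (Q y) (Q y) = 0"
    and lorentz_P_Q: "y \<in> U \<Longrightarrow> lorentz (P y) (Q y) = 1"
    and lorentz_dP_Q: "y \<in> U \<Longrightarrow> lorentz (dir_deriv v P y) (Q y) = 0"
begin

definition F :: "'n \<Rightarrow> real ^ 'n \<Rightarrow> 'n minkowski" where
  "F i = dir_deriv (axis i 1) Q"

text \<open>Row convention: row k lists the coefficients of \<open>F k\<close> in the frame E
  (\<open>F_eq_sum_E\<close>), so W H is the form <dQ, dP>.\<close>

definition W :: "real ^ 'n \<Rightarrow> real ^ 'n ^ 'n" where
  "W y = (\<chi> k l. lorentz (F k y) (Eu l y))"

lemmas diff_Q = smooth_on_differentiable[OF smooth_Q]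

lemma F_apply: "dir_deriv (axis i 1) Q y = F i y"
  by (simp add: F_def)

lemma smooth_F: "smooth_on U (F i)"
  unfolding F_def by (rule smooth_on_dir_deriv[OF smooth_Q])

lemma smooth_W: "smooth_on U (\<lambda>y. W y $ k $ l)"
  unfolding W_def by (simp add: smooth_on_bilinear[OF open_U bounded_bilinear_lorentz smooth_F smooth_Eu])

lemma dir_deriv_Q: "y \<in> U \<Longrightarrow> dir_deriv v Q y = (\<Sum>i\<in>UNIV. v $ i *\<^sub>R F i y)"
  unfolding F_def by (rule dir_deriv_sum_axis[OF smooth_on_differentiable[OF smooth_Q]])

lemma lorentz_E_Q: "y \<in> U \<Longrightarrow> lorentz (E i y) (Q y) = 0"
  by (simp add: E_def lorentz_dP_Q)

lemma lorentz_Eu_Q: "y \<in> U \<Longrightarrow> lorentz (Eu i y) (Q y) = 0"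
  by (simp add: Eu_def lorentz.sum_left lorentz.scaleR_left lorentz_E_Q)

lemma lorentz_F_Q:
  assumes y: "y \<in> U"
  shows "lorentz (F i y) (Q y) = 0"
proof -
  have "lorentz (dir_deriv (axis i 1) Q y) (Q y) = - lorentz (Q y) (dir_deriv (axis i 1) Q y)"
    by (rule dir_deriv_lorentz_const[OF open_U y diff_Q[OF y] diff_Q[OF y]]) (rule null_Q)
  then show ?thesis using lorentz_commute[of "Q y"] by (simp add: F_def)
qed

lemma lorentz_F_P:
  assumes y: "y \<in> U"
  shows "lorentz (F i y) (P y) = 0"
proof -
  have "lorentz (dir_deriv (axis i 1) P y) (Q y) = - lorentz (P y) (dir_deriv (axis i 1) Q y)"
    by (rule dir_deriv_lorentz_const[OF open_U y diff_P[OF y] diff_Q[OF y]]) (rule lorentz_P_Q)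
  then show ?thesis
    using lorentz_dP_Q[OF y, of "axis i 1"] by (simp add: F_def lorentz_commute[of _ "P y"])
qed

lemma lorentz_dE_Q:
  assumes y: "y \<in> U"
  shows "lorentz (dir_deriv (axis i 1) (E j) y) (Q y) = - lorentz (F i y) (E j y)"
proof -
  have "lorentz (dir_deriv (axis i 1) (E j) y) (Q y) = - lorentz (E j y) (dir_deriv (axis i 1) Q y)"
    by (rule dir_deriv_lorentz_const[OF open_U y diff_E[OF y] diff_Q[OF y]]) (rule lorentz_E_Q)
  then show ?thesis by (simp add: F_apply lorentz_commute)
qed

lemma dE_commute: "y \<in> U \<Longrightarrow> dir_deriv (axis i 1) (E j) y = dir_deriv (axis j 1) (E i) y"
  unfolding E_def by (rule dir_deriv_commute[OF open_U smooth_P])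

text \<open>Both sides are minus the pairing of Q with a second derivative of P, and second
  derivatives commute. This is the self-adjointness of W.\<close>

lemma lorentz_F_E_commute: "y \<in> U \<Longrightarrow> lorentz (F i y) (E j y) = lorentz (F j y) (E i y)"
  using lorentz_dE_Q[of y i j] lorentz_dE_Q[of y j i] dE_commute[of y i j] by simp

text \<open>The null vectors are dual to each other, <P, Q> = 1, so the coefficient of P is the
  pairing with Q and conversely.\<close>

lemma frame_expansion:
  assumes y: "y \<in> U"
  shows "w = (\<Sum>k\<in>UNIV. lorentz w (Eu k y) *\<^sub>R E k y) + lorentz w (Q y) *\<^sub>R P y + lorentz w (P y) *\<^sub>R Q y"
    (is "w = ?r")
proof -
  have "w - ?r = 0"
  proof (rule frame_complete[OF y null_Q[OF y] lorentz_P_Q[OF y] lorentz_E_Q[OF y]])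
    show "lorentz (w - ?r) (E i y) = 0" for i
      using sum_lorentz_Eu[OF y, of w i] lorentz_E_P[OF y, of i] lorentz_E_Q[OF y, of i]
      by (simp add: lorentz.diff_left lorentz.add_left lorentz.sum_left lorentz.scaleR_left H_def
          lorentz_commute[of "P y"] lorentz_commute[of "Q y"])
    show "lorentz (w - ?r) (P y) = 0"
      using lorentz_E_P[OF y] null_P[OF y] lorentz_P_Q[OF y]
      by (simp add: lorentz.diff_left lorentz.add_left lorentz.sum_left lorentz.scaleR_left
          lorentz_commute[of "Q y"])
    show "lorentz (w - ?r) (Q y) = 0"
      using lorentz_E_Q[OF y] null_Q[OF y] lorentz_P_Q[OF y]
      by (simp add: lorentz.diff_left lorentz.add_left lorentz.sum_left lorentz.scaleR_left)
  qed
  then show ?thesis by simp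
qed

lemma F_eq_sum_E: "y \<in> U \<Longrightarrow> F k y = (\<Sum>l\<in>UNIV. W y $ k $ l *\<^sub>R E l y)"
  using frame_expansion[of y "F k y"] by (simp add: W_def lorentz_F_Q lorentz_F_P)

lemma W_H: "y \<in> U \<Longrightarrow> (W y ** H y) $ k $ j = lorentz (F k y) (E j y)"
  using sum_lorentz_Eu[of y "F k y" j] by (simp add: matrix_matrix_mult_def W_def)

lemma transpose_W_H: "y \<in> U \<Longrightarrow> transpose (W y ** H y) = W y ** H y"
  using W_H lorentz_F_E_commute by (simp add: transpose_def vec_eq_iff)

text \<open>The Gram matrix of the leaf P + s Q at constant height s: the rows of 1 + s W are the
  frame coefficients of \<open>E i\<close> + s \<open>F i\<close>.\<close>

lemma gram_P_Q:
  assumes y: "y \<in> U"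
  shows "(\<chi> i j. lorentz (E i y + s *\<^sub>R F i y) (E j y + s *\<^sub>R F j y))
    = (mat 1 + s *\<^sub>R W y) ** H y ** transpose (mat 1 + s *\<^sub>R W y)"
proof -
  define N where "N = mat 1 + s *\<^sub>R W y"
  have e: "E i y + s *\<^sub>R F i y = (\<Sum>k\<in>UNIV. N $ i $ k *\<^sub>R E k y)" for i
  proof -
    have "(\<Sum>k\<in>UNIV. (mat 1 + s *\<^sub>R W y) $ i $ k *\<^sub>R E k y)
        = (\<Sum>k\<in>UNIV. if k = i then E k y else 0) + s *\<^sub>R (\<Sum>k\<in>UNIV. W y $ i $ k *\<^sub>R E k y)"
      unfolding scaleR_sum_right sum.distrib[symmetric]
      by (intro sum.cong) (auto simp: mat_def algebra_simps)
    then show ?thesis by (simp add: F_eq_sum_E[OF y] N_def)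
  qed
  have m: "lorentz (\<Sum>k\<in>UNIV. N $ i $ k *\<^sub>R E k y) (\<Sum>k\<in>UNIV. N $ j $ k *\<^sub>R E k y)
      = (N ** H y ** transpose N) $ i $ j" for i j
  proof -
    have "lorentz (\<Sum>k\<in>UNIV. N $ i $ k *\<^sub>R E k y) (\<Sum>l\<in>UNIV. N $ j $ l *\<^sub>R E l y)
        = (\<Sum>l\<in>UNIV. \<Sum>k\<in>UNIV. N $ j $ l * (N $ i $ k * H y $ k $ l))"
      by (simp only: lorentz.sum_left lorentz.scaleR_left lorentz.sum_right lorentz.scaleR_right
          H_def vec_lambda_beta real_scaleR_def sum_distrib_left)
    also have "\<dots> = (N ** H y ** transpose N) $ i $ j"
      by (simp add: matrix_matrix_mult_def transpose_def sum_distrib_left mult_ac)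
    finally show ?thesis .
  qed
  show ?thesis unfolding N_def[symmetric] by (simp add: vec_eq_iff e m)
qed

section \<open>The Gauss equation and the scalar curvature\<close>

definition Gam :: "'n \<Rightarrow> 'n \<Rightarrow> 'n \<Rightarrow> real ^ 'n \<Rightarrow> real" where
  "Gam k i j y = lorentz (dir_deriv (axis i 1) (E j) y) (Eu k y)"

text \<open>Commuting second derivatives collapse the Koszul combination of three metric derivatives
  to 2 <D_i E_j, E_l>. Agreement of h with H is asked for on U, as chart components are arbitrary
  elsewhere.\<close>

lemma christoffel_eq:
  assumes h: "\<And>z. z \<in> U \<Longrightarrow> h z = H z" and y: "y \<in> U"
  shows "christoffel h k i j y = Gam k i j y"
proof -
  let ?D = "\<lambda>i j. dir_deriv (axis i 1) (E j) y"
  have p: "partial i (\<lambda>z. h z $ j $ l) y = lorentz (E j y) (?D i l) + lorentz (?D i j) (E l y)" for i j l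
  proof -
    have "partial i (\<lambda>z. h z $ j $ l) y = dir_deriv (axis i 1) (\<lambda>z. lorentz (E j z) (E l z)) y"
      unfolding partial_def by (rule dir_deriv_cong_open[OF open_U _ y]) (simp add: h H_def)
    then show ?thesis
      using dir_deriv_bilinear[OF bounded_bilinear_lorentz smooth_on_differentiable[OF smooth_E y]
          smooth_on_differentiable[OF smooth_E y]] by simp
  qed
  have "partial i (\<lambda>z. h z $ j $ l) y + partial j (\<lambda>z. h z $ i $ l) y - partial l (\<lambda>z. h z $ i $ j) y
      = 2 * lorentz (?D i j) (E l y)" for l
    unfolding p using dE_commute[OF y, of i l] dE_commute[OF y, of j l] dE_commute[OF y, of i j]
      lorentz_commute[of "E j y"] lorentz_commute[of "E i y"] by simp
  then show ?thesis
    by (simp add: christoffel_def h[OF y] Hi_def[symmetric] Gam_def Eu_def lorentz.sum_right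
        lorentz.scaleR_right sum_divide_distrib)
qed

text \<open>The Leibniz rule gives a third derivative of \<open>E\<close>-type, symmetric in i and
  j, and the pairing of D_j E_k with D_i Eu_l. Expanding D_j E_k in the frame, its tangential part
  yields the quadratic Christoffel terms, its P and Q parts the terms with F and W.\<close>

lemma partial_Gam:
  assumes y: "y \<in> U"
  shows "partial i (Gam l j k) y = lorentz (dir_deriv (axis i 1) (dir_deriv (axis j 1) (E k)) y) (Eu l y)
    - (\<Sum>m\<in>UNIV. Gam m j k y * Gam l i m y)
    + (if l = i then lorentz (F j y) (E k y) else 0) + H y $ j $ k * W y $ i $ l"
proof -
  let ?X = "dir_deriv (axis j 1) (E k) y" and ?Y = "dir_deriv (axis i 1) (Eu l) y"
  note dEu = smooth_on_differentiable[OF smooth_Eu y]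
    and ddE = smooth_on_differentiable[OF smooth_on_dir_deriv[OF smooth_E] y]
  have "lorentz ?Y (E m y) = - lorentz (Eu l y) (dir_deriv (axis i 1) (E m) y)" for m
    by (rule dir_deriv_lorentz_const[OF open_U y dEu diff_E[OF y]]) (rule lorentz_Eu_E)
  then have "lorentz ?Y (E m y) = - Gam l i m y" for m
    by (simp add: Gam_def lorentz_commute)
  moreover have "lorentz ?Y (P y) = - lorentz (Eu l y) (dir_deriv (axis i 1) P y)"
    by (rule dir_deriv_lorentz_const[OF open_U y dEu diff_P[OF y]]) (rule lorentz_Eu_P)
  then have "lorentz ?Y (P y) = - (if l = i then 1 else 0)"
    using lorentz_Eu_E[OF y, of l i] by (simp add: E_apply)
  moreover have "lorentz ?Y (Q y) = - lorentz (Eu l y) (dir_deriv (axis i 1) Q y)"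
    by (rule dir_deriv_lorentz_const[OF open_U y dEu diff_Q[OF y]]) (rule lorentz_Eu_Q)
  then have "lorentz ?Y (Q y) = - W y $ i $ l"
    by (simp add: F_apply W_def lorentz_commute)
  moreover have "lorentz ?Y ?X = (\<Sum>m\<in>UNIV. Gam m j k y * lorentz ?Y (E m y))
      - lorentz (F j y) (E k y) * lorentz ?Y (P y) - H y $ j $ k * lorentz ?Y (Q y)"
    by (subst frame_expansion[OF y, of ?X])
       (simp add: lorentz.add_right lorentz.diff_right lorentz.sum_right lorentz.scaleR_right lorentz_dE_P[OF y]
         lorentz_dE_Q[OF y] Gam_def)
  ultimately have "lorentz ?X ?Y = - (\<Sum>m\<in>UNIV. Gam m j k y * Gam l i m y)
    + (if l = i then lorentz (F j y) (E k y) else 0) + H y $ j $ k * W y $ i $ l"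
    by (simp add: lorentz_commute[of ?X] sum_negf)
  moreover have "partial i (Gam l j k) y = lorentz ?X ?Y
      + lorentz (dir_deriv (axis i 1) (dir_deriv (axis j 1) (E k)) y) (Eu l y)"
    unfolding partial_def Gam_def[abs_def] by (rule dir_deriv_bilinear[OF bounded_bilinear_lorentz ddE dEu])
  ultimately show ?thesis by simp
qed

text \<open>In the antisymmetrization over i and j the third derivatives cancel, the ambient space
  being flat, and the Christoffel products cancel against those in the definition; only the normal
  terms survive.\<close>

lemma riemann_eq:
  assumes h: "\<And>z. z \<in> U \<Longrightarrow> h z = H z" and y: "y \<in> U"
  shows "riemann h l k i j y = (if l = i then lorentz (F j y) (E k y) else 0) + H y $ j $ k * W y $ i $ l
    - (if l = j then lorentz (F i y) (E k y) else 0) - H y $ i $ k * W y $ j $ l"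
proof -
  have "partial i (christoffel h l j k) y = partial i (Gam l j k) y" for i j
    unfolding partial_def by (rule dir_deriv_cong_open[OF open_U _ y]) (rule christoffel_eq[OF h])
  moreover have "dir_deriv (axis i 1) (dir_deriv (axis j 1) (E k)) y
      = dir_deriv (axis j 1) (dir_deriv (axis i 1) (E k)) y"
    by (rule dir_deriv_commute[OF open_U smooth_E y])
  ultimately show ?thesis
    by (simp add: riemann_def christoffel_eq[OF h y] partial_Gam[OF y] sum_subtractf mult.commute)
qed

text \<open>Contracting \<open>riemann_eq\<close> gives Ric = (n - 2) W H + (tr W) H; its trace with
  the inverse of H is (n - 2) tr W + n tr W.\<close>

theorem scalar_curvature_patch:
  assumes h: "\<And>z. z \<in> U \<Longrightarrow> h z = H z" and y: "y \<in> U"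
  shows "(\<Sum>j\<in>UNIV. \<Sum>k\<in>UNIV. matrix_inv (h y) $ j $ k * ricci h j k y)
    = 2 * (real CARD('n) - 1) * trace (W y)"
proof -
  let ?b = "W y ** H y"
  have "(\<Sum>i\<in>UNIV. H y $ i $ k * W y $ j $ i) = ?b $ j $ k" for j k
    by (simp add: matrix_matrix_mult_def mult.commute)
  then have r: "ricci h j k y = (real CARD('n) - 2) * ?b $ j $ k + H y $ j $ k * trace (W y)" for j k
    by (simp add: ricci_def riemann_eq[OF h y] sum.distrib sum_subtractf W_H[OF y, symmetric]
        sum_distrib_left[symmetric] trace_def algebra_simps)
  have e: "matrix_inv (h y) $ j $ k * ricci h j k y
      = (real CARD('n) - 2) * (Hi y $ j $ k * ?b $ j $ k) + trace (W y) * (Hi y $ j $ k * H y $ j $ k)"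
    for j k unfolding r h[OF y] Hi_def[symmetric] by (simp add: algebra_simps)
  have "(\<Sum>j\<in>UNIV. \<Sum>k\<in>UNIV. matrix_inv (h y) $ j $ k * ricci h j k y)
      = (real CARD('n) - 2) * (\<Sum>j\<in>UNIV. \<Sum>k\<in>UNIV. Hi y $ j $ k * ?b $ j $ k)
        + trace (W y) * (\<Sum>j\<in>UNIV. \<Sum>k\<in>UNIV. Hi y $ j $ k * H y $ j $ k)"
    by (simp only: e sum.distrib sum_distrib_left[symmetric])
  moreover have "(\<Sum>j\<in>UNIV. \<Sum>k\<in>UNIV. Hi y $ j $ k * X $ j $ k) = trace (Hi y ** X)"
    if "transpose X = X" for X
  proof -
    have "X $ j $ k = X $ k $ j" for j k using that by (metis transpose_def vec_lambda_beta)
    then show ?thesis by (simp add: trace_def matrix_matrix_mult_def)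
  qed
  moreover have "trace (Hi y ** ?b) = trace (W y)"
    using trace_mul_sym[of "Hi y" ?b] by (simp add: matrix_mul_assoc[symmetric] H_Hi[OF y])
  ultimately show ?thesis
    using transpose_W_H[OF y] transpose_H[of y] by (simp add: H_Hi[OF y] trace_def mat_def algebra_simps)
qed

end

section \<open>The volume of a compact set\<close>

text \<open>A variant of \<open>local_metric\<close> indexed by the point instead of its
  coordinates, which suits the comparison of two charts at one point.\<close>

definition metric_matrix ::
    "('m::topological_space, real ^ 'n::finite) chart set \<Rightarrow> 'm tensor2 \<Rightarrow> ('m, real ^ 'n) chart \<Rightarrow>
     'm \<Rightarrow> real ^ 'n ^ 'n" where
  "metric_matrix A h c x = (\<chi> i j. h x (coord_frame A c x i) (coord_frame A c x j))"

lemma bilinear_eq_matrix: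
  fixes B :: "real ^ 'n \<Rightarrow> real ^ 'n \<Rightarrow> real"
  assumes "\<And>w. linear (\<lambda>u. B u w)" "\<And>u. linear (B u)"
  shows "B u v = u \<bullet> ((\<chi> i j. B (axis i 1) (axis j 1)) *v v)"
proof -
  have u: "w = (\<Sum>i\<in>UNIV. w $ i *\<^sub>R axis i 1)" for w :: "real ^ 'n"
    using basis_expansion[of w] by (simp add: scalar_mult_eq_scaleR)
  have "B u v = B (\<Sum>i\<in>UNIV. u $ i *\<^sub>R axis i 1) v" using u[of u] by simp
  also have "\<dots> = (\<Sum>i\<in>UNIV. u $ i * B (axis i 1) v)"
    by (simp add: linear_sum[OF assms(1)] linear_cmul[OF assms(1)])
  also have "\<dots> = (\<Sum>i\<in>UNIV. u $ i * B (axis i 1) (\<Sum>j\<in>UNIV. v $ j *\<^sub>R axis j 1))"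
    using u[of v] by simp
  also have "\<dots> = (\<Sum>i\<in>UNIV. u $ i * (\<Sum>j\<in>UNIV. v $ j * B (axis i 1) (axis j 1)))"
    by (simp add: linear_sum[OF assms(2)] linear_cmul[OF assms(2)])
  finally show ?thesis by (simp add: inner_vec_def matrix_vector_mult_def mult_ac)
qed

lemma metric_coord_form:
  assumes "smooth_atlas A" "riemannian_metric A h" "d \<in> A" "x \<in> cdom d"
  shows "h x (coord_vector A d x u) (coord_vector A d x v) = u \<bullet> (metric_matrix A h d x *v v)"
proof -
  let ?c = "coord_vector A d x"
  have T: "?c u \<in> tangent_space A x" for u
    unfolding tangent_space_def using assms by blast
  have sym: "h x (?c u) (?c v) = h x (?c v) (?c u)" for u v
    using assms(2) T by (auto simp: riemannian_metric_def)
  have comb: "h x (?c (a *\<^sub>R u + b *\<^sub>R v)) (?c w) = a * h x (?c u) (?c w) + b * h x (?c v) (?c w)"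
    for a b u v w
    using assms(2) T unfolding riemannian_metric_def coord_vector_comb[OF assms(1,3,4)] by blast
  have 1: "linear (\<lambda>u. h x (?c u) (?c w))" for w
    using comb[of 1 _ 1] comb[of _ _ 0 0] by (intro linearI) auto
  then have "linear (\<lambda>w. h x (?c u) (?c w))" for u
    by (simp only: sym[of u])
  from bilinear_eq_matrix[of "\<lambda>u v. h x (?c u) (?c v)", OF 1 this] show ?thesis
    unfolding metric_matrix_def coord_frame_def .
qed

lemma metric_matrix_pos:
  assumes "smooth_atlas A" "riemannian_metric A h" "d \<in> A" "x \<in> cdom d"
  shows "v \<noteq> 0 \<Longrightarrow> v \<bullet> (metric_matrix A h d x *v v) > 0" "det (metric_matrix A h d x) > 0"
proof -
  have "coord_vector A d x v \<in> tangent_space A x" for v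
    unfolding tangent_space_def using assms by blast
  then have *: "v \<bullet> (metric_matrix A h d x *v v) > 0" if "v \<noteq> 0" for v
    using assms(2) that coord_vector_eq_0_iff[OF assms(1,3,4)] metric_coord_form[OF assms]
    unfolding riemannian_metric_def by metis
  then show "v \<noteq> 0 \<Longrightarrow> v \<bullet> (metric_matrix A h d x *v v) > 0" "det (metric_matrix A h d x) > 0"
    using pos_def_det_pos by blast+
qed

lemma gram_matrix_compose:
  fixes M L :: "real ^ 'n ^ 'n"
  shows "(\<chi> i j. (L *v axis i 1) \<bullet> (M *v (L *v axis j 1))) = transpose L ** M ** L"
proof -
  have "(L *v axis i 1) \<bullet> (M *v (L *v axis j 1)) = (transpose L ** (M ** L)) $ i $ j" for i j
    unfolding matrix_vector_mult_basis
    by (simp add: inner_vec_def column_def matrix_matrix_mult_def transpose_def matrix_vector_mult_def)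
  then show ?thesis by (simp add: vec_eq_iff matrix_mul_assoc)
qed

lemma metric_matrix_change:
  assumes "smooth_atlas A" "riemannian_metric A h" "smooth_atlas A'" "A \<subseteq> A'" "c \<in> A'" "d \<in> A"
    "x \<in> cdom c" "x \<in> cdom d"
  defines "L \<equiv> matrix (frechet_derivative (transition c d) (at (cmap c x)))"
  shows "metric_matrix A h c x = transpose L ** metric_matrix A h d x ** L"
proof -
  have "smooth_at (transition c d) (cmap c x)"
    using smooth_at_transition[OF assms(3,5) _ assms(7,8)] assms by (auto simp: transition_def o_def)
  then have L: "L *v u = dir_deriv u (transition c d) (cmap c x)" for u
    unfolding L_def
    by (simp add: matrix_works linear_matrix_vector_mul_eq linear_frechet_derivative smooth_at_differentiable)
  have "metric_matrix A h c x
      = (\<chi> i j. (L *v axis i 1) \<bullet> (metric_matrix A h d x *v (L *v axis j 1)))"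
    by (simp only: metric_matrix_def[of A h c] coord_frame_def coord_vector_change[OF assms(1,3-8)]
        metric_coord_form[OF assms(1,2,6,8)] L)
  then show ?thesis by (simp add: gram_matrix_compose)
qed

section \<open>Decompositions and the well-definedness of the volume\<close>

definition vol_density ::
    "('m::topological_space, real ^ 'n::finite) chart set \<Rightarrow> 'm tensor2 \<Rightarrow> ('m, real ^ 'n) chart \<Rightarrow>
     real ^ 'n \<Rightarrow> real" where
  "vol_density A h c y = sqrt (det (metric_matrix A h c (cinv c y)))"

lemma vol_density_change:
  assumes "smooth_atlas A" "riemannian_metric A h" "c \<in> A" "d \<in> A" "x \<in> cdom c" "x \<in> cdom d"
  shows "vol_density A h c (cmap c x)
    = \<bar>det (matrix (frechet_derivative (transition c d) (at (cmap c x))))\<bar> * vol_density A h d (cmap d x)"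
proof -
  have "cinv c (cmap c x) = x" "cinv d (cmap d x) = x"
    using assms smooth_atlas_is_chart cinv_cmap by metis+
  then show ?thesis
    using metric_matrix_change[OF assms(1,2,1) order_refl assms(3-6)]
    by (simp add: vol_density_def det_mul det_transpose real_sqrt_mult)
qed

text \<open>A coordinate frame of the oriented atlas is positive with respect to
  \<open>chart_at A x\<close>, so the sign in \<open>volume_form\<close> is 1.\<close>

lemma volume_form_coord_frame:
  assumes "oriented_atlas A" "riemannian_metric A h" "c \<in> A" "x \<in> cdom c"
  shows "volume_form A h x (coord_frame A c x) = sqrt (det (metric_matrix A h c x))"
proof -
  let ?d = "chart_at A x" and ?y = "cmap c x"
  have A: "smooth_atlas A" using assms(1) by (simp add: oriented_atlas_def)
  note d = chart_at_props[OF A, of x]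
  let ?L = "matrix (frechet_derivative (transition c ?d) (at ?y))"
  have "coord_frame A c x i (\<lambda>z. cmap ?d z $ j) = transpose ?L $ i $ j" for i j
  proof -
    have t: "transition c ?d differentiable at ?y"
      using smooth_at_differentiable[OF smooth_at_transition[OF A assms(3) d(1) assms(4) d(2)]]
      by (simp add: transition_def o_def)
    have "smooth_near A x (\<lambda>z. cmap ?d z $ j)"
      by (rule smooth_near_linear_compose[OF A bounded_linear_vec_nth vdiff_cmap(1)[OF A d]])
    moreover have "dir_deriv (axis i 1) (\<lambda>y. transition c ?d y $ j) ?y
        = dir_deriv (axis i 1) (transition c ?d) ?y $ j"
      by (rule dir_deriv_linear_compose[OF bounded_linear_vec_nth t])
    ultimately show ?thesis
      by (simp add: coord_frame_def coord_vector_def o_def transition_def transpose_def matrix_def)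
  qed
  then have "(\<chi> i j. coord_frame A c x i (\<lambda>z. cmap ?d z $ j)) = transpose ?L" by (simp add: vec_eq_iff)
  moreover have "det ?L > 0" using assms d by (auto simp: oriented_atlas_def)
  ultimately show ?thesis by (simp add: volume_form_def metric_matrix_def det_transpose)
qed

lemma borel_vimage_continuous_on:
  assumes "continuous_on S f" "S \<in> sets borel" "B \<in> sets borel"
  shows "S \<inter> f -` B \<in> sets borel"
proof -
  have "f \<in> borel_measurable (restrict_space borel S)"
    by (rule borel_measurable_continuous_on_restrict[OF assms(1)])
  from measurable_sets[OF this assms(3)] show ?thesis
    using assms(2) by (simp add: sets_restrict_space_iff space_restrict_space Int_commute)
qed

lemma borel_cmap_image:
  assumes "is_chart c" "B \<in> sets borel" "B \<subseteq> cdom c"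
  shows "cmap c ` B \<in> sets borel"
  unfolding cmap_image_eq_vimage[OF assms(1,3)]
  by (rule borel_vimage_continuous_on[OF continuous_on_cinv[OF assms(1)] _ assms(2)])
     (simp add: open_cran[OF assms(1)])

definition vol_piece ::
    "('m::topological_space, real ^ 'n::finite) chart set \<Rightarrow> 'm tensor2 \<Rightarrow> ('m, real ^ 'n) chart \<Rightarrow>
     'm set \<Rightarrow> real" where
  "vol_piece A h c B = set_lebesgue_integral lborel (cmap c ` B) (vol_density A h c)"

definition vol_piece_integrable ::
    "('m::topological_space, real ^ 'n::finite) chart set \<Rightarrow> 'm tensor2 \<Rightarrow> ('m, real ^ 'n) chart \<Rightarrow>
     'm set \<Rightarrow> bool" where
  "vol_piece_integrable A h c B \<longleftrightarrow> set_integrable lborel (cmap c ` B) (vol_density A h c)"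

text \<open>The ratio of the two densities is exactly the Jacobian of the transition map.\<close>

lemma vol_piece_change:
  assumes A: "smooth_atlas A" "riemannian_metric A h" and c: "c \<in> A" "d \<in> A"
    and B: "B \<in> sets borel" "B \<subseteq> cdom c" "B \<subseteq> cdom d"
    and i: "vol_piece_integrable A h c B" "vol_piece_integrable A h d B"
  shows "vol_piece A h c B = vol_piece A h d B"
proof -
  note ch = smooth_atlas_is_chart[OF A(1) c(1)] smooth_atlas_is_chart[OF A(1) c(2)]
  let ?S = "cmap c ` B" and ?g = "transition c d"
  have e: "?g (cmap c x) = cmap d x" if "x \<in> B" for x
    using that B cinv_cmap[OF ch(1)] by (auto simp: transition_def)
  have im: "?g ` ?S = cmap d ` B" using e by (auto simp: image_image)
  have eq: "\<bar>det (matrix (frechet_derivative ?g (at y)))\<bar> * vol_density A h d (?g y) = vol_density A h c y"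
    if "y \<in> ?S" for y
  proof -
    obtain x where x: "x \<in> B" "y = cmap c x" using \<open>y \<in> ?S\<close> by auto
    then show ?thesis using vol_density_change[OF A c, of x] B e[OF x(1)] by (simp add: subset_iff)
  qed
  have S: "?S \<in> sets borel" by (rule borel_cmap_image[OF ch(1) B(1,2)])
  have int: "set_integrable lborel ?S (\<lambda>y. \<bar>det (matrix (frechet_derivative ?g (at y)))\<bar> * vol_density A h d (?g y))
      \<longleftrightarrow> set_integrable lborel ?S (vol_density A h c)"
    by (rule set_integrable_cong[OF refl refl]) (rule eq)
  have "set_lebesgue_integral lborel (?g ` ?S) (vol_density A h d)
      = set_lebesgue_integral lborel ?S (\<lambda>y. \<bar>det (matrix (frechet_derivative ?g (at y)))\<bar> * vol_density A h d (?g y))"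
  proof (rule change_of_variables_lborel[OF S])
    fix y assume "y \<in> ?S"
    then obtain x where "x \<in> B" "y = cmap c x" by auto
    then have "smooth_at ?g y"
      using smooth_at_transition[OF A(1) c, of x] B by (auto simp: transition_def o_def)
    then show "(?g has_derivative frechet_derivative ?g (at y)) (at y)"
      using smooth_at_differentiable frechet_derivative_works by blast
  next
    show "inj_on ?g ?S"
    proof (rule inj_onI)
      fix y z assume "y \<in> ?S" "z \<in> ?S" and yz: "?g y = ?g z"
      then obtain x w where x: "x \<in> B" "y = cmap c x" "w \<in> B" "z = cmap c w" by auto
      then have "cmap d x = cmap d w" using yz e by simp
      then show "y = z" using inj_on_cmap[OF ch(2)] x B by (auto simp: inj_on_def)
    qed
    show "set_integrable lborel (?g ` ?S) (vol_density A h d)"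
      using i(2) by (simp add: im vol_piece_integrable_def)
    show "set_integrable lborel ?S (\<lambda>y. \<bar>det (matrix (frechet_derivative ?g (at y)))\<bar> * vol_density A h d (?g y))"
      using i(1) by (simp add: int vol_piece_integrable_def)
  qed
  also have "\<dots> = set_lebesgue_integral lborel ?S (vol_density A h c)"
    by (rule set_lebesgue_integral_cong) (use S eq in auto)
  finally show ?thesis by (simp add: im vol_piece_def)
qed

lemma vol_piece_split:
  assumes "is_chart c" "B \<in> sets borel" "B \<subseteq> cdom c" "vol_piece_integrable A h c B"
    and "\<And>j. j < (N::nat) \<Longrightarrow> B' j \<in> sets borel" "disjoint_family_on B' {..<N}" "B \<subseteq> (\<Union>j<N. B' j)"
  shows "vol_piece A h c B = (\<Sum>j<N. vol_piece A h c (B \<inter> B' j))"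
    "j < N \<Longrightarrow> vol_piece_integrable A h c (B \<inter> B' j)"
proof -
  have b: "cmap c ` (B \<inter> B' j) \<in> sets borel" if "j < N" for j
    using assms that by (intro borel_cmap_image) auto
  have i: "set_integrable lborel (cmap c ` (B \<inter> B' j)) (vol_density A h c)" if "j < N" for j
    by (rule set_integrable_subset[of _ "cmap c ` B"]) (use assms(4) b that in \<open>auto simp: vol_piece_integrable_def\<close>)
  then show "j < N \<Longrightarrow> vol_piece_integrable A h c (B \<inter> B' j)" by (simp add: vol_piece_integrable_def)
  have "cmap c ` B = (\<Union>j\<in>{..<N}. cmap c ` (B \<inter> B' j))" using assms(7) by blast
  moreover have "disjoint_family_on (\<lambda>j. cmap c ` (B \<inter> B' j)) {..<N}"
    using assms(3,6) inj_on_cmap[OF assms(1)] unfolding disjoint_family_on_def inj_on_def by blast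
  ultimately show "vol_piece A h c B = (\<Sum>j<N. vol_piece A h c (B \<inter> B' j))"
    unfolding vol_piece_def
    by (simp only:) (rule set_integral_finite_Union, use i b in auto)
qed

definition vol_decomp ::
    "('m::topological_space, real ^ 'n::finite) chart set \<Rightarrow> 'm tensor2 \<Rightarrow> 'm set \<Rightarrow> nat \<Rightarrow>
     (nat \<Rightarrow> ('m, real ^ 'n) chart) \<Rightarrow> (nat \<Rightarrow> 'm set) \<Rightarrow> bool" where
  "vol_decomp A h K N c B \<longleftrightarrow>
     (\<forall>i<N. c i \<in> A \<and> B i \<in> sets borel \<and> B i \<subseteq> cdom (c i) \<and> vol_piece_integrable A h (c i) (B i)) \<and>
     disjoint_family_on B {..<N} \<and> (\<Union>i<N. B i) = K"

text \<open>Both sums are refined to the pieces \<open>B i \<inter> B' j\<close>, each of which lies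
  in a chart of either family.\<close>

lemma vol_decomp_unique:
  assumes A: "smooth_atlas A" "riemannian_metric A h"
    and d: "vol_decomp A h K N c B" "vol_decomp A h K N' c' B'"
  shows "(\<Sum>i<N. vol_piece A h (c i) (B i)) = (\<Sum>i<N'. vol_piece A h (c' i) (B' i))"
proof -
  have ch: "is_chart (c i)" if "i < N" for i
    using that d(1) smooth_atlas_is_chart[OF A(1)] unfolding vol_decomp_def by blast
  have ch': "is_chart (c' i)" if "i < N'" for i
    using that d(2) smooth_atlas_is_chart[OF A(1)] unfolding vol_decomp_def by blast
  have sub: "B i \<subseteq> (\<Union>j<N'. B' j)" if "i < N" for i using d that unfolding vol_decomp_def by blast
  have sub': "B' i \<subseteq> (\<Union>j<N. B j)" if "i < N'" for i using d that unfolding vol_decomp_def by blast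
  have s: "vol_piece A h (c i) (B i) = (\<Sum>j<N'. vol_piece A h (c i) (B i \<inter> B' j))"
    "j < N' \<Longrightarrow> vol_piece_integrable A h (c i) (B i \<inter> B' j)" if "i < N" for i j
    using vol_piece_split[OF ch[OF that], where N = N' and B = "B i" and B' = B' and A = A and h = h] that d sub[OF that]
    by (auto simp: vol_decomp_def)
  have s': "vol_piece A h (c' i) (B' i) = (\<Sum>j<N. vol_piece A h (c' i) (B' i \<inter> B j))"
    "j < N \<Longrightarrow> vol_piece_integrable A h (c' i) (B' i \<inter> B j)" if "i < N'" for i j
    using vol_piece_split[OF ch'[OF that], where N = N and B = "B' i" and B' = B and A = A and h = h] that d sub'[OF that]
    by (auto simp: vol_decomp_def)
  have "(\<Sum>i<N. vol_piece A h (c i) (B i)) = (\<Sum>i<N. \<Sum>j<N'. vol_piece A h (c i) (B i \<inter> B' j))"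
    by (rule sum.cong) (use s in auto)
  also have "\<dots> = (\<Sum>i<N. \<Sum>j<N'. vol_piece A h (c' j) (B' j \<inter> B i))"
  proof (intro sum.cong refl)
    fix i j assume ij: "i \<in> {..<N}" "j \<in> {..<N'}"
    have e: "B i \<inter> B' j = B' j \<inter> B i" by blast
    have "vol_piece_integrable A h (c i) (B' j \<inter> B i)" using s(2)[of i j] ij by (simp add: e)
    moreover have "vol_piece_integrable A h (c' j) (B' j \<inter> B i)" using s'(2)[of j i] ij by simp
    ultimately    show "vol_piece A h (c i) (B i \<inter> B' j) = vol_piece A h (c' j) (B' j \<inter> B i)"
      unfolding e
      by (intro vol_piece_change[OF A]) (use ij d in \<open>auto simp: vol_decomp_def\<close>)
  qed
  also have "\<dots> = (\<Sum>j<N'. \<Sum>i<N. vol_piece A h (c' j) (B' j \<inter> B i))" by (rule sum.swap)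
  also have "\<dots> = (\<Sum>i<N'. vol_piece A h (c' i) (B' i))"
    by (rule sum.cong) (use s' in auto)
  finally show ?thesis .
qed

text \<open>Replaces the oriented form by its positive density; from here on volume is a matter of
  \<open>vol_decomp\<close>.\<close>

lemma has_form_integral_volume_form:
  assumes "oriented_atlas A" "riemannian_metric A h"
  shows "has_form_integral A (volume_form A h) K I \<longleftrightarrow>
    (\<exists>N c B. vol_decomp A h K N c B \<and> I = (\<Sum>i<N. vol_piece A h (c i) (B i)))"
proof -
  have A: "smooth_atlas A" using assms(1) by (simp add: oriented_atlas_def)
  let ?f = "\<lambda>c y. volume_form A h (cinv c y) (coord_frame A c (cinv c y))"
  have v: "?f c y = vol_density A h c y" if "c \<in> A" "B \<subseteq> cdom c" "y \<in> cmap c ` B" for c B y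
    using that volume_form_coord_frame[OF assms that(1)] cinv_cmap[OF smooth_atlas_is_chart[OF A that(1)]]
    by (auto simp: vol_density_def)
  have 1: "set_integrable lborel (cmap c ` B) (?f c) \<longleftrightarrow> vol_piece_integrable A h c B"
    if "c \<in> A" "B \<subseteq> cdom c" for c B
    unfolding vol_piece_integrable_def using v[OF that] by (intro set_integrable_cong) auto
  have 2: "set_lebesgue_integral lborel (cmap c ` B) (?f c) = vol_piece A h c B"
    if "c \<in> A" "B \<subseteq> cdom c" "B \<in> sets borel" for c B
    unfolding vol_piece_def using v[OF that(1,2)] borel_cmap_image[OF smooth_atlas_is_chart[OF A that(1)] that(3,2)]
    by (intro set_lebesgue_integral_cong) auto
  have 3: "(\<forall>i<N. c i \<in> A \<and> B i \<in> sets borel \<and> B i \<subseteq> cdom (c i) \<and>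
         set_integrable lborel (cmap (c i) ` B i) (?f (c i))) \<and>
       disjoint_family_on B {..<N} \<and> (\<Union>i<N. B i) = K \<longleftrightarrow> vol_decomp A h K N c B"
    (is "?X N c B \<and> ?Y N B \<and> ?Z N B \<longleftrightarrow> _") for N c B
  proof -
    have "?X N c B \<longleftrightarrow> (\<forall>i<N. c i \<in> A \<and> B i \<in> sets borel \<and> B i \<subseteq> cdom (c i) \<and>
        vol_piece_integrable A h (c i) (B i))"
      by (intro all_cong1 imp_cong conj_cong refl 1)
    then show ?thesis unfolding vol_decomp_def by (simp only:)
  qed
  have 4: "(\<Sum>i<N. set_lebesgue_integral lborel (cmap (c i) ` B i) (?f (c i)))
      = (\<Sum>i<N. vol_piece A h (c i) (B i))" (is "?S N c B = ?T N c B")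
    if "vol_decomp A h K N c B" for N c B
  proof (rule sum.cong[OF refl])
    fix i assume "i \<in> {..<N}"
    then show "set_lebesgue_integral lborel (cmap (c i) ` B i) (?f (c i)) = vol_piece A h (c i) (B i)"
      using that unfolding vol_decomp_def by (intro 2) blast+
  qed
  show ?thesis
    unfolding has_form_integral_def
  proof (intro iff_exI)
    fix N c B
    have "I = ?S N c B \<longleftrightarrow> I = ?T N c B" if "vol_decomp A h K N c B"
      unfolding 4[OF that] by (rule refl)
    then show "?X N c B \<and> ?Y N B \<and> ?Z N B \<and> I = ?S N c B
        \<longleftrightarrow> vol_decomp A h K N c B \<and> I = ?T N c B"
      using 3[of N c B] by blast
  qed
qed

text \<open>The definite description in \<open>form_integral\<close> has a single candidate by
  \<open>vol_decomp_unique\<close>, so any one decomposition evaluates it.\<close>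

lemma volume_eq:
  assumes "oriented_atlas A" "riemannian_metric A h" "vol_decomp A h K N c B"
  shows "volume A h K = (\<Sum>i<N. vol_piece A h (c i) (B i))"
proof -
  have A: "smooth_atlas A" using assms(1) by (simp add: oriented_atlas_def)
  show ?thesis
    unfolding volume_def form_integral_def has_form_integral_volume_form[OF assms(1,2)]
  proof (rule the_equality)
    fix I assume "\<exists>N c B. vol_decomp A h K N c B \<and> I = (\<Sum>i<N. vol_piece A h (c i) (B i))"
    then obtain N' c' B' where "vol_decomp A h K N' c' B'" "I = (\<Sum>i<N'. vol_piece A h (c' i) (B' i))"
      by blast
    then show "I = (\<Sum>i<N. vol_piece A h (c i) (B i))"
      using vol_decomp_unique[OF A assms(2) _ assms(3)] by metis
  qed (use assms(3) in blast)
qed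

section \<open>Differentiation under the integral sign\<close>

lemma set_integrable_continuous_compact:
  fixes f :: "'a::euclidean_space \<Rightarrow> real"
  assumes "compact C" "B \<in> sets borel" "B \<subseteq> C" "continuous_on C f"
  shows "set_integrable lborel B f"
proof -
  have "set_integrable lborel C f"
    unfolding set_integrable_def using borel_integrable_compact[OF assms(1,4)]
    by (simp add: indicator_def if_distrib cong: if_cong)
  then show ?thesis by (rule set_integrable_subset) (use assms in auto)
qed

lemma set_integral_le_const:
  fixes f :: "'a::euclidean_space \<Rightarrow> real"
  assumes "compact C" "B \<in> sets borel" "B \<subseteq> C" "set_integrable lborel B f"
    "\<And>y. y \<in> B \<Longrightarrow> \<bar>f y\<bar> \<le> e"
  shows "\<bar>set_lebesgue_integral lborel B f\<bar> \<le> e * measure lborel B"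
proof -
  have c: "set_integrable lborel B (\<lambda>y. e)"
    by (rule set_integrable_continuous_compact[OF assms(1-3)]) auto
  have "\<bar>set_lebesgue_integral lborel B f\<bar> \<le> (LINT y:B|lborel. \<bar>f y\<bar>)"
    using set_integral_norm_bound[OF assms(4)] by simp
  also have "\<dots> \<le> (LINT y:B|lborel. e)"
    by (rule set_integral_mono) (use assms c set_integrable_abs in auto)
  also have "\<dots> = e * measure lborel B" by (simp add: set_lebesgue_integral_def)
  finally show ?thesis .
qed

text \<open>By the mean value theorem the difference quotient at y is \<open>F' s y\<close> with s
  near t0, and F' is uniformly continuous on a compact strip around t0; the error is therefore
  uniform in y.\<close>

lemma DERIV_set_integral:
  fixes F F' :: "real \<Rightarrow> 'a::euclidean_space \<Rightarrow> real"
  assumes C: "compact C" "B \<in> sets borel" "B \<subseteq> C"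
    and der: "\<And>t y. \<bar>t\<bar> < \<delta> \<Longrightarrow> y \<in> C \<Longrightarrow> ((\<lambda>t. F t y) has_real_derivative F' t y) (at t)"
    and contF: "\<And>t. \<bar>t\<bar> < \<delta> \<Longrightarrow> continuous_on C (F t)"
    and contF': "continuous_on ({-\<delta><..<\<delta>} \<times> C) (\<lambda>(t, y). F' t y)"
    and t0: "\<bar>t0\<bar> < \<delta>"
  shows "((\<lambda>t. set_lebesgue_integral lborel B (F t)) has_real_derivative
    set_lebesgue_integral lborel B (F' t0)) (at t0)"
proof -
  \<comment> \<open>Half the distance from t0 to the ends of the interval, so that the closed strip
    around t0 stays inside.\<close>
  define r where "r = (\<delta> - \<bar>t0\<bar>) / 2"
  have r: "r > 0" "\<And>t. \<bar>t - t0\<bar> \<le> r \<Longrightarrow> \<bar>t\<bar> < \<delta>" using t0 by (auto simp: r_def field_simps abs_if split: if_splits)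
  have iF: "set_integrable lborel B (F t)" if "\<bar>t\<bar> < \<delta>" for t
    by (rule set_integrable_continuous_compact[OF C contF[OF that]])
  have "continuous_on C (\<lambda>y. (\<lambda>(t, y). F' t y) (t0, y))"
    by (rule continuous_on_compose2[OF contF'])
       (use t0 in \<open>auto intro!: continuous_intros simp: abs_less_iff\<close>)
  then have "continuous_on C (F' t0)" by simp
  then have iF': "set_integrable lborel B (F' t0)" by (rule set_integrable_continuous_compact[OF C])
  let ?m = "measure lborel B"
  let ?K = "{t0 - r..t0 + r} \<times> C"
  have K: "?K \<subseteq> {-\<delta><..<\<delta>} \<times> C"
  proof
    fix z assume "z \<in> ?K"
    then show "z \<in> {-\<delta><..<\<delta>} \<times> C" using r(2)[of "fst z"] by (cases z) (auto simp: abs_le_iff)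
  qed
  have "uniformly_continuous_on ?K (\<lambda>(t, y). F' t y)"
    by (intro compact_uniformly_continuous continuous_on_subset[OF contF' K] compact_Times C compact_Icc)
  show ?thesis
    unfolding has_field_derivative_iff LIM_def
  proof (intro allI impI)
    fix e :: real assume "e > 0"
    \<comment> \<open>The summand 1 admits a null set B.\<close>
    define e' where "e' = e / (?m + 1)"
    have m: "?m + 1 > 0" using measure_nonneg[of lborel B] by linarith
    then have e'0: "e' > 0" unfolding e'_def by (rule divide_pos_pos[OF \<open>e > 0\<close>])
    have "e' * (?m + 1) = e" using m by (simp only: e'_def) simp
    then have e': "e' > 0" "e' * ?m < e" using e'0 by (simp_all add: distrib_left)
    obtain d where d: "d > 0" "\<And>z w. z \<in> ?K \<Longrightarrow> w \<in> ?K \<Longrightarrow> dist w z < d \<Longrightarrow>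
        dist ((\<lambda>(t, y). F' t y) w) ((\<lambda>(t, y). F' t y) z) < e'"
      using \<open>uniformly_continuous_on ?K _\<close> e'(1) unfolding uniformly_continuous_on_def by metis
    have "dist ((set_lebesgue_integral lborel B (F t) - set_lebesgue_integral lborel B (F t0)) / (t - t0))
        (set_lebesgue_integral lborel B (F' t0)) < e" if t: "t \<noteq> t0 \<and> dist t t0 < min d r" for t
    proof -
      have tr: "\<bar>t - t0\<bar> < d" "\<bar>t - t0\<bar> < r" using t by (auto simp: dist_real_def)
      have t\<delta>: "\<bar>t\<bar> < \<delta>" using r(2)[of t] tr by simp
      let ?q = "\<lambda>y. (F t y - F t0 y) / (t - t0) - F' t0 y"
      have q: "\<bar>?q y\<bar> \<le> e'" if y: "y \<in> B" for y
      proof -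
        have yC: "y \<in> C" using y C by auto
        have seg: "\<bar>s\<bar> < \<delta>" "\<bar>s - t0\<bar> < d" "\<bar>s - t0\<bar> \<le> r" if "min t t0 \<le> s" "s \<le> max t t0" for s
          using that tr r(2)[of s] by (auto simp: min_def max_def abs_if split: if_splits)
        obtain s where s: "min t t0 < s" "s < max t t0"
          "F (max t t0) y - F (min t t0) y = (max t t0 - min t t0) * F' s y"
          using MVT2[of "min t t0" "max t t0" "\<lambda>t. F t y" "\<lambda>t. F' t y"] t der[OF _ yC] seg
          by (metis less_le max_def min_def linorder_not_le)
        then have "(F t y - F t0 y) / (t - t0) = F' s y"
          using t by (auto simp: min_def max_def field_simps split: if_splits)
        moreover have "dist (F' s y) (F' t0 y) < e'"
          using d(2)[of "(t0, y)" "(s, y)"] seg[of s] s yC r(1)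
          by (auto simp: dist_Pair_Pair dist_real_def abs_le_iff)
        ultimately show ?thesis by (simp add: dist_real_def)
      qed
      have i: "set_integrable lborel B (\<lambda>y. (F t y - F t0 y) / (t - t0))"
        by (intro set_integrable_divide set_integral_diff iF t\<delta> t0)
      have iq: "set_integrable lborel B ?q" by (rule set_integral_diff(1)[OF i iF'])
      have "(set_lebesgue_integral lborel B (F t) - set_lebesgue_integral lborel B (F t0)) / (t - t0)
          - set_lebesgue_integral lborel B (F' t0) = set_lebesgue_integral lborel B ?q"
        using set_integral_diff[OF i iF'] set_integral_diff[OF iF[OF t\<delta>] iF[OF t0]] by simp
      then show ?thesis
        using set_integral_le_const[OF C iq q] e'(2) by (simp add: dist_real_def)
    qed
    then show "\<exists>s>0. \<forall>x. x \<noteq> t0 \<and> dist x t0 < s \<longrightarrow>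
        dist ((set_lebesgue_integral lborel B (F x) - set_lebesgue_integral lborel B (F t0)) / (x - t0))
          (set_lebesgue_integral lborel B (F' t0)) < e"
      using d(1) r(1) by (intro exI[of _ "min d r"]) auto
  qed
qed

lemma smooth_on_time_derivative:
  fixes F :: "real \<times> 'a::euclidean_space \<Rightarrow> real"
  assumes "smooth_on O' F" "(t, y) \<in> O'"
  shows "((\<lambda>t. F (t, y)) has_real_derivative dir_deriv (1, 0) F (t, y)) (at t)"
  using DERIV_along_line[of F "(0, y)" t "(1, 0)"] smooth_on_differentiable[OF assms] by simp

lemma DERIV_integral_smooth:
  fixes F :: "real \<times> 'a::euclidean_space \<Rightarrow> real"
  assumes F: "smooth_on O' F" "{-\<delta><..<\<delta>} \<times> C \<subseteq> O'" and C: "compact C" "B \<in> sets borel" "B \<subseteq> C"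
    and t: "\<bar>t\<bar> < \<delta>"
  shows "((\<lambda>t. LINT y:B|lborel. F (t, y)) has_real_derivative (LINT y:B|lborel. dir_deriv (1, 0) F (t, y))) (at t)"
proof (rule DERIV_set_integral[OF C _ _ _ t])
  show "((\<lambda>t. F (t, y)) has_real_derivative dir_deriv (1, 0) F (t, y)) (at t)"
    if "\<bar>t\<bar> < \<delta>" "y \<in> C" for t y
    using that F(2) by (intro smooth_on_time_derivative[OF F(1)]) (auto simp: abs_less_iff)
  show "continuous_on C (\<lambda>y. F (t, y))" if "\<bar>t\<bar> < \<delta>" for t
    by (rule continuous_on_compose2[OF smooth_on_imp_continuous_on[OF F(1)]])
       (use that F(2) in \<open>auto intro!: continuous_intros simp: abs_less_iff\<close>)
  show "continuous_on ({-\<delta><..<\<delta>} \<times> C) (\<lambda>(t, y). dir_deriv (1, 0) F (t, y))"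
    using continuous_on_subset[OF smooth_on_imp_continuous_on[OF smooth_on_dir_deriv[OF F(1)]] F(2)]
    by (simp add: case_prod_unfold)
qed

text \<open>If D were positive, f' would be positive just to the right of 0, and by the mean value
  theorem f would exceed its maximum there.\<close>

lemma second_derivative_at_max:
  fixes f f' :: "real \<Rightarrow> real"
  assumes "\<forall>\<^sub>F t in nhds 0. (f has_real_derivative f' t) (at t)" "(f' has_real_derivative D) (at 0)"
    "\<forall>\<^sub>F t in nhds 0. f t \<le> f 0"
  shows "f' 0 = 0" "D \<le> 0"
proof -
  obtain d where d: "d > 0" "\<And>t. \<bar>t\<bar> < d \<Longrightarrow> (f has_real_derivative f' t) (at t) \<and> f t \<le> f 0"
    using eventually_conj[OF assms(1,3)] unfolding eventually_nhds_metric by (auto simp: dist_real_def)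
  show f0: "f' 0 = 0" by (rule DERIV_local_max[of f "f' 0" 0 d]) (use d in auto)
  show "D \<le> 0"
  proof (rule ccontr)
    assume "\<not> D \<le> 0"
    then obtain r where r: "r > 0" "\<And>h. h > 0 \<Longrightarrow> h < r \<Longrightarrow> f' 0 < f' (0 + h)"
      using DERIV_pos_inc_right[OF assms(2)] by auto
    define h where "h = min d r / 2"
    have h: "h > 0" "h < d" "h < r" using d(1) r(1) by (auto simp: h_def)
    obtain z where z: "0 < z" "z < h" "f h - f 0 = (h - 0) * f' z"
      using MVT2[of 0 h f f'] d(2) h by auto
    then have "f h - f 0 > 0" using r(2)[of z] h f0 by simp
    moreover have "f h \<le> f 0" using d(2)[of h] h by simp
    ultimately show False by simp
  qed
qed

section \<open>Deformations of the identity\<close>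

text \<open>A finite subcover and the least of its times. In the proof, the 1 under
  \<open>Min\<close> covers an empty K.\<close>

lemma compact_uniform_time:
  fixes K :: "'a::topological_space set" and R :: "real \<Rightarrow> 'a \<Rightarrow> bool"
  assumes "compact K"
    "\<And>x. x \<in> K \<Longrightarrow> \<exists>V \<delta>. open V \<and> x \<in> V \<and> \<delta> > 0 \<and> (\<forall>t. \<bar>t\<bar> < \<delta> \<longrightarrow> (\<forall>z\<in>V. R t z))"
  shows "\<exists>\<delta>>0. \<forall>t. \<bar>t\<bar> < \<delta> \<longrightarrow> (\<forall>z\<in>K. R t z)"
proof -
  obtain V \<delta> where V: "\<And>x. x \<in> K \<Longrightarrow> open (V x)" "\<And>x. x \<in> K \<Longrightarrow> x \<in> V x"
    "\<And>x. x \<in> K \<Longrightarrow> \<delta> x > 0" "\<And>x t z. x \<in> K \<Longrightarrow> \<bar>t\<bar> < \<delta> x \<Longrightarrow> z \<in> V x \<Longrightarrow> R t z"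
    using assms(2) by metis
  have "K \<subseteq> (\<Union>x\<in>K. V x)" using V(2) by blast
  then obtain J where J: "J \<subseteq> K" "finite J" "K \<subseteq> (\<Union>x\<in>J. V x)"
    using compactE_image[OF assms(1), of K V] V(1) by blast
  define d where "d = Min (insert 1 (\<delta> ` J))"
  have "d > 0" using J V(3) by (auto simp: d_def)
  moreover have "R t z" if tz: "\<bar>t\<bar> < d" "z \<in> K" for t z
  proof -
    obtain x where x: "x \<in> J" "z \<in> V x" using J(3) tz(2) by blast
    then have "d \<le> \<delta> x" using J(2) by (auto simp: d_def)
    then show ?thesis using V(4)[of x t z] x J(1) tz(1) by auto
  qed
  ultimately show ?thesis by blast
qed

lemma eventually_time_nhds:
  fixes x :: "'a::topological_space"
  assumes "open T" "(0, x) \<in> T"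
  obtains V \<delta> where "open V" "x \<in> V" "\<delta> > 0" "\<And>t z. \<bar>t\<bar> < \<delta> \<Longrightarrow> z \<in> V \<Longrightarrow> (t :: real, z) \<in> T"
proof -
  obtain S V where SV: "open S" "open V" "(0, x) \<in> S \<times> V" "S \<times> V \<subseteq> T"
    using assms open_prod_elim by blast
  then obtain \<delta> where "\<delta> > 0" "ball 0 \<delta> \<subseteq> S" using openE by (metis mem_Times_iff fst_conv)
  then show ?thesis using that[of V \<delta>] SV by (auto simp: subset_iff dist_real_def)
qed

text \<open>Local injectivity of \<Psi> (t, y) = (t, f (t, y)) at (0, a), instead of each slice
  separately, makes the radius uniform in t. Since the slice at time 0 is the identity, the
  derivative of \<Psi> there is a shear, inverted by \<open>g'\<close>.\<close>

lemma locally_injective_deformation: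
  fixes f :: "real \<times> 'a::euclidean_space \<Rightarrow> 'a"
  assumes "open T" "smooth_on T f" "(0, a) \<in> T" and id: "\<And>y. (0, y) \<in> T \<Longrightarrow> f (0, y) = y"
  obtains r where "r > 0" "\<And>t. \<bar>t\<bar> < r \<Longrightarrow> inj_on (\<lambda>y. f (t, y)) (ball a r)"
proof -
  define \<Psi> where "\<Psi> z = (fst z, f z)" for z :: "real \<times> 'a"
  have sm: "smooth_on T \<Psi>"
    unfolding \<Psi>_def[abs_def] by (intro smooth_on_Pair assms smooth_on_bounded_linear bounded_linear_fst)
  define D where "D z v = dir_deriv v \<Psi> z" for z v
  have der: "(\<Psi> has_derivative D z) (at z)" if "z \<in> T" for z
    unfolding D_def by (rule smooth_on_has_derivative[OF sm that])
  define w where "w = dir_deriv (1, 0) f (0, a)"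
  define g' where "g' v = (fst v, snd v - fst v *\<^sub>R w)" for v :: "real \<times> 'a"
  have bl: "bounded_linear g'"
    unfolding g'_def[abs_def]
    by (intro bounded_linear_Pair bounded_linear_sub bounded_linear_fst bounded_linear_snd
        bounded_linear_scaleR_const)
  have Da: "D (0, a) v = (fst v, fst v *\<^sub>R w + snd v)" for v
  proof -
    let ?f' = "\<lambda>v. dir_deriv v f (0, a)"
    have df: "(f has_derivative ?f') (at (0, a))" by (rule smooth_on_has_derivative[OF assms(2,3)])
    have "(\<Psi> has_derivative (\<lambda>v. (fst v, ?f' v))) (at (0, a))"
      unfolding \<Psi>_def[abs_def] by (intro has_derivative_Pair df has_derivative_fst has_derivative_ident)
    then have "D (0, a) v = (fst v, ?f' v)" unfolding D_def by (rule dir_deriv_eqI)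
    moreover have "?f' (0, u) = u" for u
    proof -
      have "((\<lambda>y. (0 :: real, y)) has_derivative (\<lambda>u. (0, u))) (at a)"
        by (auto intro!: derivative_eq_intros)
      from diff_chain_at[OF this df] have d1: "((\<lambda>y. f (0, y)) has_derivative (\<lambda>u. ?f' (0, u))) (at a)"
        by (simp add: o_def)
      have o: "open ((\<lambda>y. (0 :: real, y)) -` T)"
        using assms(1) by (intro open_vimage continuous_intros) auto
      have "((\<lambda>y. y) has_derivative (\<lambda>u. ?f' (0, u))) (at a)"
        by (rule has_derivative_transform_within_open[OF d1 o]) (use assms id in auto)
      moreover have "((\<lambda>y. y) has_derivative (\<lambda>u. u)) (at a)" by simp
      ultimately have "(\<lambda>u. ?f' (0, u)) = (\<lambda>u. u)" by (rule has_derivative_unique)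
      then show ?thesis by metis
    qed
    moreover have "?f' v = fst v *\<^sub>R w + ?f' (0, snd v)"
    proof -
      note L = has_derivative_linear[OF df]
      have e: "fst v *\<^sub>R (1, 0) + (0, snd v) = v" by (simp add: prod_eq_iff)
      have "?f' (fst v *\<^sub>R (1, 0) + (0, snd v)) = fst v *\<^sub>R w + ?f' (0, snd v)"
        unfolding w_def by (simp only: linear_add[OF L] linear_cmul[OF L])
      then show ?thesis by (simp only: e)
    qed
    ultimately show ?thesis by simp
  qed
  have gD: "g' \<circ> D (0, a) = id" by (auto simp: fun_eq_iff g'_def Da)
  have on: "\<exists>d>0. \<forall>x. dist (0, a) x < d \<longrightarrow> onorm (\<lambda>v. D x v - D (0, a) v) < e" if "e > 0" for e
  proof -
    \<comment> \<open>Summing the errors on the basis vectors gives a continuous upper bound for the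
      operator norm of the difference of the derivatives.\<close>
    define N where "N x = (\<Sum>b\<in>Basis. norm (D x b - D (0, a) b))" for x
    have "continuous_on T N"
      unfolding N_def D_def
      by (intro continuous_intros smooth_on_imp_continuous_on smooth_on_dir_deriv sm)
    then have "isCont N (0, a)" using assms by (simp add: continuous_on_eq_continuous_at)
    moreover have "N (0, a) = 0" by (simp add: N_def)
    ultimately obtain d1 where d1: "d1 > 0" "\<And>x. dist x (0, a) < d1 \<Longrightarrow> N x < e"
      using \<open>e > 0\<close> unfolding continuous_at_eps_delta by (metis abs_less_iff diff_zero dist_real_def)
    obtain d2 where d2: "d2 > 0" "ball (0, a) d2 \<subseteq> T" using assms openE by blast
    have "onorm (\<lambda>v. D x v - D (0, a) v) < e" if "dist (0, a) x < min d1 d2" for x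
    proof -
      have xT: "x \<in> T" using that d2 by auto
      have "norm (D x v - D (0, a) v) \<le> N x * norm v" for v
      proof -
        let ?L = "\<lambda>v. D x v - D (0, a) v"
        have lin: "linear ?L"
          by (intro linear_compose_sub has_derivative_linear[OF der] xT assms)
        have "?L v = ?L (\<Sum>b\<in>Basis. (v \<bullet> b) *\<^sub>R b)" by (simp add: euclidean_representation)
        also have "\<dots> = (\<Sum>b\<in>Basis. (v \<bullet> b) *\<^sub>R ?L b)"
          by (simp only: linear_sum[OF lin] linear_cmul[OF lin])
        also have "norm \<dots> \<le> (\<Sum>b\<in>Basis. norm v * norm (?L b))"
          by (intro sum_norm_le) (simp add: Basis_le_norm mult_right_mono)
        also have "\<dots> = N x * norm v" by (simp add: N_def sum_distrib_left mult.commute)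
        finally show ?thesis .
      qed
      then have "onorm (\<lambda>v. D x v - D (0, a) v) \<le> N x" by (rule onorm_le)
      then show ?thesis using d1(2)[of x] that by (simp add: dist_commute)
    qed
    then show ?thesis using d1 d2 by (intro exI[of _ "min d1 d2"]) auto
  qed
  obtain r where r: "r > 0" "inj_on \<Psi> (ball (0, a) r)"
    using has_derivative_locally_injective[OF assms(3,1) bl gD der on] by blast
  have "inj_on (\<lambda>y. f (t, y)) (ball a (r / 2))" if "\<bar>t\<bar> < r / 2" for t
  proof (rule inj_onI)
    fix y z assume yz: "y \<in> ball a (r / 2)" "z \<in> ball a (r / 2)" "f (t, y) = f (t, z)"
    have "(t, u) \<in> ball (0, a) r" if "u \<in> ball a (r / 2)" for u
    proof -
      have "dist (0, a) (t, u) \<le> \<bar>t\<bar> + dist a u"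
        using sqrt_sum_squares_le_sum_abs[of t "dist a u"] by (simp add: dist_Pair_Pair dist_real_def)
      then show ?thesis using that \<open>\<bar>t\<bar> < r / 2\<close> by simp
    qed
    then have "(t, y) \<in> ball (0, a) r" "(t, z) \<in> ball (0, a) r" using yz by auto
    moreover have "\<Psi> (t, y) = \<Psi> (t, z)" using yz by (simp add: \<Psi>_def)
    ultimately have "(t, y) = (t, z)" using r(2) by (meson inj_onD)
    then show "y = z" by simp
  qed
  then show ?thesis using that[of "r / 2"] r by auto
qed

text \<open>Brouwer: for small t the slice moves the points of a closed ball by less than half its
  radius, so z \<mapsto> y + z - f (t, z) maps that ball to itself if y is near a; a fixed point is
  a preimage of y.\<close>

lemma locally_surjective_deformation:
  fixes f :: "real \<times> 'a::euclidean_space \<Rightarrow> 'a"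
  assumes "open T" "continuous_on T f" "(0, a) \<in> T" and id: "\<And>y. (0, y) \<in> T \<Longrightarrow> f (0, y) = y" and "e > 0"
  obtains r where "r > 0" "\<And>t y. \<bar>t\<bar> < r \<Longrightarrow> y \<in> ball a r \<Longrightarrow> \<exists>z\<in>ball a e. f (t, z) = y"
proof -
  obtain V \<delta> where V: "open V" "a \<in> V" "\<delta> > 0" "\<And>t z. \<bar>t\<bar> < \<delta> \<Longrightarrow> z \<in> V \<Longrightarrow> (t, z) \<in> T"
    using eventually_time_nhds[OF assms(1,3)] by metis
  obtain \<rho>0 where \<rho>0: "\<rho>0 > 0" "ball a \<rho>0 \<subseteq> V" using V openE by blast
  define \<rho> where "\<rho> = min \<rho>0 e / 2"
  have \<rho>: "\<rho> > 0" "cball a \<rho> \<subseteq> V" "\<rho> < e" using \<rho>0 \<open>e > 0\<close> by (auto simp: \<rho>_def subset_iff)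
  have "\<exists>W \<delta>. open W \<and> x \<in> W \<and> \<delta> > 0 \<and> (\<forall>t. \<bar>t\<bar> < \<delta> \<longrightarrow> (\<forall>z\<in>W. dist (f (t, z)) z < \<rho> / 2))"
    if x: "x \<in> cball a \<rho>" for x
  proof -
    have x0: "(0, x) \<in> T" using V(3,4) x \<rho> by auto
    have "continuous_on T (\<lambda>z. dist (f z) (snd z))" by (intro continuous_intros assms)
    then have o: "open (T \<inter> (\<lambda>z. dist (f z) (snd z)) -` {..<\<rho> / 2})"
      using continuous_on_open_vimage[OF assms(1)] by (metis Int_commute open_lessThan)
    have "(0, x) \<in> T \<inter> (\<lambda>z. dist (f z) (snd z)) -` {..<\<rho> / 2}" using x0 id \<rho> by simp
    from eventually_time_nhds[OF o this] obtain W \<delta>' where W: "open W" "x \<in> W" "\<delta>' > 0"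
      "\<And>t z. \<bar>t\<bar> < \<delta>' \<Longrightarrow> z \<in> W \<Longrightarrow> (t, z) \<in> T \<inter> (\<lambda>z. dist (f z) (snd z)) -` {..<\<rho> / 2}"
      by blast
    then have "dist (f (t, z)) z < \<rho> / 2" if "\<bar>t\<bar> < \<delta>'" "z \<in> W" for t z
      using W(4)[OF that] by simp
    then show ?thesis using W(1-3) by blast
  qed
  then obtain d where d: "d > 0" "\<And>t z. \<bar>t\<bar> < d \<Longrightarrow> z \<in> cball a \<rho> \<Longrightarrow> dist (f (t, z)) z < \<rho> / 2"
    using compact_uniform_time[of "cball a \<rho>" "\<lambda>t z. dist (f (t, z)) z < \<rho> / 2"] by auto
  \<comment> \<open>The displacement uses up \<rho> / 2 of the radius and the distance from the
    centre at most the other half; \<delta> keeps the ball in T.\<close>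
  define r where "r = min (min d \<delta>) (\<rho> / 2)"
  have "\<exists>z\<in>ball a e. f (t, z) = y" if t: "\<bar>t\<bar> < r" and y: "y \<in> ball a r" for t y
  proof -
    have "\<exists>z\<in>cball a \<rho>. f (t, z) = y"
    proof (rule brouwer_surjective_cball[OF _ \<rho>(1) y])
      show "continuous_on (cball a \<rho>) (\<lambda>z. f (t, z))"
        using V(4) t \<rho> by (intro continuous_on_compose2[OF assms(2)] continuous_intros) (auto simp: r_def)
      fix x z assume x: "x \<in> ball a r" and z: "z \<in> cball a \<rho>"
      have "dist a (x + (z - f (t, z))) \<le> dist a x + dist (f (t, z)) z"
        using norm_triangle_ineq4[of "a - x" "z - f (t, z)"]
        by (simp add: dist_norm norm_minus_commute algebra_simps)
      also have "\<dots> \<le> \<rho> / 2 + \<rho> / 2" using x d(2)[OF _ z, of t] t by (intro add_mono) (auto simp: r_def)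
      finally show "x + (z - f (t, z)) \<in> cball a \<rho>" by simp
    qed
    then show ?thesis using \<rho> by auto
  qed
  then show ?thesis using that[of r] d V \<rho> by (auto simp: r_def)
qed

text \<open>By invariance of domain f is a homeomorphism onto an open set, so the image is a
  preimage under its continuous inverse.\<close>

lemma borel_injective_image:
  fixes f :: "'a::euclidean_space \<Rightarrow> 'a"
  assumes "open U" "continuous_on U f" "inj_on f U" "S \<in> sets borel" "S \<subseteq> U"
  shows "f ` S \<in> sets borel"
proof -
  obtain g where g: "homeomorphism U (f ` U) f g"
    using invariance_of_domain_homeomorphism[OF assms(1,2) order_refl assms(3)] by blast
  have "f ` S = f ` U \<inter> g -` S"
    using g assms(5) unfolding homeomorphism_def by (auto simp: subset_iff)
  moreover have "open (f ` U)" by (rule invariance_of_domain[OF assms(2,1,3)])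
  moreover have "continuous_on (f ` U) g" using g by (simp add: homeomorphism_def)
  ultimately show ?thesis using borel_vimage_continuous_on[of "f ` U" g S] assms(4) by simp
qed

section \<open>The dual map and the shape operator\<close>

locale immersed =
  fixes A :: "('m::{t2_space, second_countable_topology}, real ^ 'n::finite) chart set"
    and g :: "'m tensor2" and p :: "'m \<Rightarrow> 'n minkowski"
  assumes card: "CARD('n) \<ge> 2"
    and oriented: "oriented_atlas A"
    and riem: "riemannian_metric A g"
    and flat: "conformally_flat A g"
    and immersion: "isometric_immersion_in_light_cone A g p"
begin

lemma A: "smooth_atlas A"
  using oriented by (simp add: oriented_atlas_def)

lemmas chart = smooth_atlas_is_chart[OF A]

lemma smooth_on_chart:
  assumes "c \<in> A" "\<And>x. smooth_near A x f"
  shows "smooth_on (cran c) (\<lambda>y. f (cinv c y))"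
proof (rule smooth_on_if_smooth_at)
  fix y assume "y \<in> cran c"
  then show "smooth_at (\<lambda>y. f (cinv c y)) y"
    using smooth_near_iff[OF A assms(1), of "cinv c y" f] assms(2)[of "cinv c y"]
    by (simp add: cinv_in_cdom[OF chart[OF assms(1)]] cmap_cinv[OF chart[OF assms(1)]])
qed

lemma vdiff_chart:
  assumes "c \<in> A" "\<And>x. smooth_near A x f" "y \<in> cran c"
  shows "vdiff f (coord_vector A c (cinv c y) u) = dir_deriv u (\<lambda>y. f (cinv c y)) y"
  using vdiff_coord_vector[OF A assms(1) cinv_in_cdom[OF chart[OF assms(1)] assms(3)] assms(2)]
  by (simp add: cmap_cinv[OF chart[OF assms(1)] assms(3)])

lemma near_p: "smooth_near A x p"
  using immersion smooth_map_on_imp_smooth_near[of A UNIV p x]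
  by (simp add: isometric_immersion_in_light_cone_def)

lemma coord_vector_in_tangent_space:
  "c \<in> A \<Longrightarrow> x \<in> cdom c \<Longrightarrow> coord_vector A c x u \<in> tangent_space A x"
  unfolding tangent_space_def by blast

lemma lorentz_vdiff_p:
  "X \<in> tangent_space A x \<Longrightarrow> Y \<in> tangent_space A x \<Longrightarrow> lorentz (vdiff p X) (vdiff p Y) = g x X Y"
  using immersion by (simp add: isometric_immersion_in_light_cone_def lorentz_pullback_def)

definition P :: "('m, real ^ 'n) chart \<Rightarrow> real ^ 'n \<Rightarrow> 'n minkowski" where
  "P c y = p (cinv c y)"

lemma vdiff_p: "c \<in> A \<Longrightarrow> y \<in> cran c \<Longrightarrow> vdiff p (coord_vector A c (cinv c y) u) = dir_deriv u (P c) y"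
  unfolding P_def[abs_def] by (rule vdiff_chart[OF _ near_p])

lemma light_cone_patch_P:
  assumes c: "c \<in> A"
  shows "light_cone_patch (cran c) (P c)"
proof
  show "open (cran c)" by (rule open_cran[OF chart[OF c]])
  show "smooth_on (cran c) (P c)" unfolding P_def[abs_def] by (rule smooth_on_chart[OF c near_p])
  show "lorentz (P c y) (P c y) = 0" for y
    using immersion by (auto simp: isometric_immersion_in_light_cone_def light_cone_def P_def)
  fix y v assume y: "y \<in> cran c" and v: "(v :: real ^ 'n) \<noteq> 0"
  let ?X = "coord_vector A c (cinv c y) v"
  have x: "cinv c y \<in> cdom c" by (rule cinv_in_cdom[OF chart[OF c] y])
  note T = coord_vector_in_tangent_space[OF c x]
  have "?X \<noteq> (\<lambda>_. 0)" using coord_vector_eq_0_iff[OF A c x] v by simp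
  then have "g (cinv c y) ?X ?X > 0" using riem T unfolding riemannian_metric_def by blast
  then show "lorentz (dir_deriv v (P c) y) (dir_deriv v (P c) y) > 0"
    using lorentz_vdiff_p[OF T T] by (simp add: vdiff_p[OF c y])
qed

text \<open>The pointwise content of \<open>is_dual_map\<close>. It has exactly one solution,
  computable in any chart, so the local dual vectors agree on overlaps and form a smooth global
  map.\<close>

definition is_dual_at :: "'m \<Rightarrow> 'n minkowski \<Rightarrow> bool" where
  "is_dual_at x q0 \<longleftrightarrow> lorentz q0 q0 = 0 \<and> lorentz (p x) q0 = 1 \<and>
    (\<forall>X\<in>tangent_space A x. lorentz (vdiff p X) q0 = 0)"

lemma is_dual_at_iff:
  assumes c: "c \<in> A" and x: "x \<in> cdom c"
  shows "is_dual_at x q0 \<longleftrightarrow> q0 = light_cone_patch.dual (P c) (cmap c x)"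
proof -
  interpret light_cone_patch "cran c" "P c" by (rule light_cone_patch_P[OF c])
  note y = cmap_in_cran[OF x] and ci = cinv_cmap[OF chart[OF c] x]
  have Px: "P c (cmap c x) = p x" by (simp add: P_def ci)
  have T: "(\<forall>X\<in>tangent_space A x. lorentz (vdiff p X) q0 = 0)
      \<longleftrightarrow> (\<forall>v. lorentz (dir_deriv v (P c) (cmap c x)) q0 = 0)" for q0
    using vdiff_p[OF c y] unfolding ci tangent_space_chart[OF A c x] by simp
  show ?thesis
    unfolding is_dual_at_def T Px[symmetric]
    using dual_props[OF y] dual_unique[OF y, of q0] by blast
qed

definition q :: "'m \<Rightarrow> 'n minkowski" where
  "q x = light_cone_patch.dual (P (chart_at A x)) (cmap (chart_at A x) x)"

lemma is_dual_at_q: "is_dual_at x q0 \<longleftrightarrow> q0 = q x"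
  unfolding q_def by (rule is_dual_at_iff[OF chart_at_props[OF A]])

lemma q_chart: "c \<in> A \<Longrightarrow> x \<in> cdom c \<Longrightarrow> q x = light_cone_patch.dual (P c) (cmap c x)"
  using is_dual_at_iff[of c x "q x"] is_dual_at_q[of x "q x"] by simp

lemma near_q: "smooth_near A x q"
proof -
  let ?c = "chart_at A x"
  note c = chart_at_props[OF A, of x]
  interpret light_cone_patch "cran ?c" "P ?c" by (rule light_cone_patch_P[OF c(1)])
  have "smooth_at dual (cmap ?c x)"
    by (rule smooth_atI[OF open_U cmap_in_cran[OF c(2)] smooth_dual])
  then have "smooth_at (\<lambda>y. q (cinv ?c y)) (cmap ?c x)"
    by (rule smooth_at_cong[OF _ open_U cmap_in_cran[OF c(2)]])
       (simp add: q_chart[OF c(1)] cinv_in_cdom[OF chart[OF c(1)]] cmap_cinv[OF chart[OF c(1)]])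
  then show ?thesis by (simp only: smooth_near_iff[OF A c])
qed

lemma dual_map_eq: "dual_map A p = q"
  unfolding dual_map_def
proof (rule the_equality)
  have "is_dual_at x (q x)" for x using is_dual_at_q by simp
  then show "is_dual_map A p q"
    using smooth_map_onI[OF A near_q] by (auto simp: is_dual_map_def is_dual_at_def light_cone_def)
  fix q' assume "is_dual_map A p q'"
  then have "is_dual_at x (q' x)" for x by (auto simp: is_dual_map_def is_dual_at_def light_cone_def)
  then show "q' = q" using is_dual_at_q by (simp add: fun_eq_iff)
qed

definition Q :: "('m, real ^ 'n) chart \<Rightarrow> real ^ 'n \<Rightarrow> 'n minkowski" where
  "Q c y = q (cinv c y)"

lemma dual_patch_P_Q:
  assumes c: "c \<in> A"
  shows "dual_patch (cran c) (P c) (Q c)"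
proof -
  interpret light_cone_patch "cran c" "P c" by (rule light_cone_patch_P[OF c])
  have Q: "Q c y = dual y" if "y \<in> cran c" for y
    using q_chart[OF c cinv_in_cdom[OF chart[OF c] that]] cmap_cinv[OF chart[OF c] that] by (simp add: Q_def)
  show ?thesis
  proof
    show "smooth_on (cran c) (Q c)" unfolding Q_def[abs_def] by (rule smooth_on_chart[OF c near_q])
  qed (simp_all add: Q dual_props)
qed

lemma vdiff_q: "c \<in> A \<Longrightarrow> y \<in> cran c \<Longrightarrow> vdiff q (coord_vector A c (cinv c y) u) = dir_deriv u (Q c) y"
  unfolding Q_def[abs_def] by (rule vdiff_chart[OF _ near_q])

definition H :: "('m, real ^ 'n) chart \<Rightarrow> real ^ 'n \<Rightarrow> real ^ 'n ^ 'n" where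
  "H c = light_cone_patch.H (P c)"

definition W :: "('m, real ^ 'n) chart \<Rightarrow> real ^ 'n \<Rightarrow> real ^ 'n ^ 'n" where
  "W c = dual_patch.W (P c) (Q c)"

lemma metric_matrix_g:
  assumes c: "c \<in> A" and y: "y \<in> cran c"
  shows "metric_matrix A g c (cinv c y) = H c y"
proof -
  interpret pt: light_cone_patch "cran c" "P c" by (rule light_cone_patch_P[OF c])
  note T = coord_vector_in_tangent_space[OF c cinv_in_cdom[OF chart[OF c] y]]
  show ?thesis
    unfolding H_def pt.H_def metric_matrix_def coord_frame_def
      lorentz_vdiff_p[OF T T, symmetric] vdiff_p[OF c y] pt.E_def by (rule refl)
qed

lemma scalar_curvature_eq:
  "scalar_curvature A g x
    = 2 * (real CARD('n) - 1) * trace (W (chart_at A x) (cmap (chart_at A x) x))"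
proof -
  let ?c = "chart_at A x"
  note c = chart_at_props[OF A, of x]
  interpret pt: dual_patch "cran ?c" "P ?c" "Q ?c" by (rule dual_patch_P_Q[OF c(1)])
  have "local_metric A g ?c z = light_cone_patch.H (P ?c) z" if "z \<in> cran ?c" for z
    using metric_matrix_g[OF c(1) that]
    by (simp add: local_metric_def metric_matrix_def H_def)
  from pt.scalar_curvature_patch[OF this cmap_in_cran[OF c(2)]] show ?thesis
    by (simp add: scalar_curvature_def Let_def W_def)
qed

lemma dir_deriv_chart_change:
  assumes c: "c \<in> A" "d \<in> A" and x: "x \<in> cdom c" "x \<in> cdom d"
  defines "L \<equiv> matrix (frechet_derivative (transition c d) (at (cmap c x)))"
  shows "dir_deriv u (P c) (cmap c x) = dir_deriv (L *v u) (P d) (cmap d x)"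
    and "dir_deriv u (Q c) (cmap c x) = dir_deriv (L *v u) (Q d) (cmap d x)"
proof -
  have "smooth_at (transition c d) (cmap c x)"
    using smooth_at_transition[OF A c x] by (simp add: transition_def o_def)
  then have L: "L *v u = dir_deriv u (transition c d) (cmap c x)" for u
    unfolding L_def
    by (simp add: matrix_works linear_matrix_vector_mul_eq linear_frechet_derivative smooth_at_differentiable)
  have "coord_vector A c x u = coord_vector A d x (L *v u)"
    unfolding L by (rule coord_vector_change[OF A A order_refl c x])
  then show "dir_deriv u (P c) (cmap c x) = dir_deriv (L *v u) (P d) (cmap d x)"
    "dir_deriv u (Q c) (cmap c x) = dir_deriv (L *v u) (Q d) (cmap d x)"
    using vdiff_p[OF c(1) cmap_in_cran[OF x(1)]] vdiff_p[OF c(2) cmap_in_cran[OF x(2)]]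
      vdiff_q[OF c(1) cmap_in_cran[OF x(1)]] vdiff_q[OF c(2) cmap_in_cran[OF x(2)]]
    unfolding cinv_cmap[OF chart[OF c(1)] x(1)] cinv_cmap[OF chart[OF c(2)] x(2)] by metis+
qed

text \<open>Expresses W H by the differentials of p and q, whose behaviour under a change of chart
  is known.\<close>

lemma W_H_form:
  assumes c: "c \<in> A" and y: "y \<in> cran c"
  shows "u \<bullet> ((W c y ** H c y) *v v) = lorentz (dir_deriv u (Q c) y) (dir_deriv v (P c) y)"
proof -
  interpret pt: dual_patch "cran c" "P c" "Q c" by (rule dual_patch_P_Q[OF c])
  let ?B = "\<lambda>u v. lorentz (dir_deriv u (Q c) y) (dir_deriv v (P c) y)"
  have l: "linear (\<lambda>u. dir_deriv u (Q c) y)" "linear (\<lambda>u. dir_deriv u (P c) y)"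
    by (rule linear_dir_deriv[OF pt.diff_Q[OF y]], rule linear_dir_deriv[OF pt.diff_P[OF y]])
  have "linear (\<lambda>u. ?B u v)" for v
    by (rule linearI) (simp_all add: linear_add[OF l(1)] linear_cmul[OF l(1)] lorentz.add_left lorentz.scaleR_left)
  moreover have "linear (?B u)" for u
    by (rule linearI) (simp_all add: linear_add[OF l(2)] linear_cmul[OF l(2)] lorentz.add_right lorentz.scaleR_right)
  ultimately have "?B u v = u \<bullet> ((\<chi> i j. ?B (axis i 1) (axis j 1)) *v v)"
    by (rule bilinear_eq_matrix)
  moreover have "(\<chi> i j. ?B (axis i 1) (axis j 1)) = W c y ** H c y"
    unfolding W_def H_def
    by (simp add: vec_eq_iff pt.W_H[OF y] pt.E_def pt.F_def)
  ultimately show ?thesis by simp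
qed

lemma det_H_pos: "c \<in> A \<Longrightarrow> y \<in> cran c \<Longrightarrow> det (H c y) > 0"
  using light_cone_patch.det_H[OF light_cone_patch_P] by (simp add: H_def)

text \<open>W H and H both transform as bilinear forms under the Jacobian L, so W is conjugated by
  the transpose of L. This carries tr W = 0 from the charts picked by \<open>chart_at\<close> to all
  others.\<close>

lemma trace_W_chart:
  assumes c: "c \<in> A" "d \<in> A" and x: "x \<in> cdom c" "x \<in> cdom d"
  shows "trace (W c (cmap c x)) = trace (W d (cmap d x))"
proof -
  define L where "L = matrix (frechet_derivative (transition c d) (at (cmap c x)))"
  let ?y = "cmap c x" and ?z = "cmap d x"
  note y = cmap_in_cran[OF x(1)] and z = cmap_in_cran[OF x(2)]
  have Hc: "H c ?y = transpose L ** H d ?z ** L"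
    using metric_matrix_change[OF A riem A order_refl c x] metric_matrix_g[OF c(1) y] metric_matrix_g[OF c(2) z]
    by (simp add: cinv_cmap[OF chart[OF c(1)] x(1)] cinv_cmap[OF chart[OF c(2)] x(2)] L_def)
  have e: "M = N" if "\<And>u v. u \<bullet> (M *v v) = u \<bullet> (N *v v)" for M N :: "real ^ 'n ^ 'n"
    using that by (metis matrix_eq vector_eq_ldot)
  have Wc: "W c ?y ** H c ?y = transpose L ** (W d ?z ** H d ?z) ** L"
  proof (rule e)
    fix u v
    have "u \<bullet> ((W c ?y ** H c ?y) *v v) = (L *v u) \<bullet> ((W d ?z ** H d ?z) *v (L *v v))"
      unfolding W_H_form[OF c(1) y] W_H_form[OF c(2) z] L_def
      by (simp only: dir_deriv_chart_change[OF c x])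
    also have "\<dots> = u \<bullet> ((transpose L ** (W d ?z ** H d ?z) ** L) *v v)"
      using dot_lmul_matrix[of u "transpose L"]
      by (simp add: vector_transpose_matrix flip: matrix_vector_mul_assoc)
    finally show "u \<bullet> ((W c ?y ** H c ?y) *v v) = u \<bullet> ((transpose L ** (W d ?z ** H d ?z) ** L) *v v)" .
  qed
  have dL: "det L \<noteq> 0" using det_H_pos[OF c(1) y] by (auto simp: Hc det_mul)
  then have "det (H d ?z ** L) \<noteq> 0" "det (transpose L) \<noteq> 0"
    using det_H_pos[OF c(2) z] by (auto simp: det_mul det_transpose)
  note inv = matrix_inv_inverse(1)[OF this(1)] matrix_inv_inverse(1)[OF this(2)] matrix_inv_inverse(2)[OF this(2)]
  have "(W c ?y ** transpose L) ** (H d ?z ** L) = (transpose L ** W d ?z) ** (H d ?z ** L)"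
    using Wc unfolding Hc by (simp add: matrix_mul_assoc)
  then have "W c ?y ** transpose L = transpose L ** W d ?z"
    using inv(1) by (metis matrix_mul_assoc matrix_mul_rid)
  then have "W c ?y = transpose L ** W d ?z ** matrix_inv (transpose L)"
    using inv(2) by (metis matrix_mul_assoc matrix_mul_rid)
  then have "trace (W c ?y) = trace (matrix_inv (transpose L) ** (transpose L ** W d ?z))"
    using trace_mul_sym by metis
  then show ?thesis by (simp add: matrix_mul_assoc inv(3))
qed

lemma traceless_if_scalar_flat:
  assumes "\<forall>x. scalar_curvature A g x = 0" "c \<in> A" "y \<in> cran c"
  shows "trace (W c y) = 0"
proof -
  note x = cinv_in_cdom[OF chart[OF assms(2)] assms(3)]
  note d = chart_at_props[OF A, of "cinv c y"]
  have "trace (W (chart_at A (cinv c y)) (cmap (chart_at A (cinv c y)) (cinv c y))) = 0"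
    using assms(1) card by (simp add: scalar_curvature_eq)
  then show ?thesis
    using trace_W_chart[OF assms(2) d(1) x d(2)] cmap_cinv[OF chart[OF assms(2)] assms(3)] by simp
qed

text \<open>An isothermal chart supplies an orthogonal frame, hence a square root of the Gram matrix.\<close>

lemma H_square_root:
  assumes c: "c \<in> A" and y: "y \<in> cran c"
  obtains R :: "real ^ 'n ^ 'n" where "det R \<noteq> 0" "H c y = R ** transpose R"
proof -
  let ?x = "cinv c y"
  note x = cinv_in_cdom[OF chart[OF c] y]
  obtain c' \<rho> where c': "smooth_atlas (insert c' A)" "?x \<in> cdom c'"
    "\<forall>y\<in>cran c'. \<rho> y > 0 \<and> local_metric A g c' y = \<rho> y *\<^sub>R mat 1"
    using flat unfolding conformally_flat_def by blast
  define r where "r = \<rho> (cmap c' ?x)"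
  have ch': "is_chart c'" using c'(1) smooth_atlas_is_chart by blast
  have r: "r > 0" "local_metric A g c' (cmap c' ?x) = r *\<^sub>R mat 1"
    using c'(3) cmap_in_cran[OF c'(2)] by (auto simp: r_def)
  define L where "L = matrix (frechet_derivative (transition c' c) (at (cmap c' ?x)))"
  have "metric_matrix A g c' ?x = transpose L ** metric_matrix A g c ?x ** L"
    unfolding L_def by (rule metric_matrix_change[OF A riem c'(1) _ _ c c'(2) x]) auto
  moreover have "metric_matrix A g c' ?x = local_metric A g c' (cmap c' ?x)"
    by (simp add: local_metric_def metric_matrix_def cinv_cmap[OF ch' c'(2)])
  ultimately have e: "transpose L ** H c y ** L = r *\<^sub>R mat 1"
    using r(2) metric_matrix_g[OF c y] by simp
  have "det (transpose L ** H c y ** L) \<noteq> 0"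
    unfolding e using r(1) det_diagonal[of "r *\<^sub>R mat 1 :: real ^ 'n ^ 'n"] by (simp add: mat_def)
  then have dL: "det L \<noteq> 0" by (auto simp: det_mul)
  define Li where "Li = matrix_inv L"
  have Li: "L ** Li = mat 1" "Li ** L = mat 1" using matrix_inv_inverse[OF dL] by (auto simp: Li_def)
  have Lt: "transpose Li ** transpose L = mat 1" using Li(1) by (metis matrix_transpose_mul transpose_mat)
  \<comment> \<open>From L^T H L = r 1 one reads off H = r (L^-1)^T L^-1.\<close>
  define R where "R = sqrt r *\<^sub>R transpose Li"
  have "H c y = transpose Li ** (transpose L ** H c y ** L) ** Li"
  proof -
    have "transpose Li ** (transpose L ** H c y ** L) ** Li
        = (transpose Li ** transpose L) ** H c y ** (L ** Li)" by (simp add: matrix_mul_assoc)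
    then show ?thesis by (simp add: Lt Li)
  qed
  also have "\<dots> = r *\<^sub>R (transpose Li ** Li)" unfolding e by (simp add: matrix_mult_scaleR)
  also have "\<dots> = R ** transpose R"
  proof -
    have "transpose R = sqrt r *\<^sub>R Li" by (simp add: R_def transpose_def vec_eq_iff)
    then show ?thesis using r(1) by (simp add: R_def matrix_mult_scaleR)
  qed
  finally have HR: "H c y = R ** transpose R" .
  moreover have "det R \<noteq> 0" using det_H_pos[OF c y] by (auto simp: HR det_mul)
  ultimately show ?thesis using that by blast
qed

lemma
  assumes c: "c \<in> A" and y: "y \<in> cran c" and s: "s\<^sup>2 * trace (W c y ** W c y) < 1"
  shows det_1_W_pos: "det (mat 1 + s *\<^sub>R W c y) > 0"
    and det_1_W_le_1: "trace (W c y) = 0 \<Longrightarrow> det (mat 1 + s *\<^sub>R W c y) \<le> 1"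
proof -
  obtain R where R: "det R \<noteq> 0" "H c y = R ** transpose R" using H_square_root[OF c y] .
  have "transpose (W c y ** H c y) = W c y ** H c y"
    using dual_patch.transpose_W_H[OF dual_patch_P_Q[OF c] y] by (simp add: W_def H_def)
  then show "det (mat 1 + s *\<^sub>R W c y) > 0"
    "trace (W c y) = 0 \<Longrightarrow> det (mat 1 + s *\<^sub>R W c y) \<le> 1"
    using det_selfadjoint_pos[OF R(1) _ s] det_selfadjoint_traceless_le_1[OF R(1) _ s] unfolding R(2) by blast+
qed

text \<open>The Gram matrix of the leaf at constant height s, in the factored form of
  \<open>gram_P_Q\<close>.\<close>

definition gram :: "('m, real ^ 'n) chart \<Rightarrow> real \<Rightarrow> real ^ 'n \<Rightarrow> real ^ 'n ^ 'n" where
  "gram c s y = (mat 1 + s *\<^sub>R W c y) ** H c y ** transpose (mat 1 + s *\<^sub>R W c y)"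

lemma gram_form:
  assumes c: "c \<in> A" and y: "y \<in> cran c"
  shows "u \<bullet> (gram c s y *v v) = lorentz (dir_deriv u (P c) y + s *\<^sub>R dir_deriv u (Q c) y)
    (dir_deriv v (P c) y + s *\<^sub>R dir_deriv v (Q c) y)"
proof -
  interpret pt: dual_patch "cran c" "P c" "Q c" by (rule dual_patch_P_Q[OF c])
  let ?D = "\<lambda>u. dir_deriv u (P c) y + s *\<^sub>R dir_deriv u (Q c) y"
  let ?B = "\<lambda>u v. lorentz (?D u) (?D v)"
  have l: "linear ?D"
    by (intro linear_compose_add linear_compose_scale_right linear_dir_deriv pt.diff_P pt.diff_Q y)
  have "linear (\<lambda>u. ?B u v)" for v
    by (rule linearI) (simp_all only: linear_add[OF l] linear_cmul[OF l] lorentz.add_left lorentz.scaleR_left real_scaleR_def)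
  moreover have "linear (?B u)" for u
    by (rule linearI) (simp_all only: linear_add[OF l] linear_cmul[OF l] lorentz.add_right lorentz.scaleR_right real_scaleR_def)
  ultimately have "?B u v = u \<bullet> ((\<chi> i j. ?B (axis i 1) (axis j 1)) *v v)"
    by (rule bilinear_eq_matrix)
  moreover have "(\<chi> i j. ?B (axis i 1) (axis j 1)) = gram c s y"
    unfolding gram_def W_def H_def
    using pt.gram_P_Q[OF y, of s] by (simp add: pt.E_def pt.F_def)
  ultimately show ?thesis by simp
qed

lemma det_gram: "det (gram c s y) = (det (mat 1 + s *\<^sub>R W c y))\<^sup>2 * det (H c y)"
  by (simp add: gram_def det_mul det_transpose power2_eq_square)

lemma smooth_on_H: "c \<in> A \<Longrightarrow> smooth_on (cran c) (\<lambda>y. H c y $ i $ j)"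
  unfolding H_def by (rule light_cone_patch.smooth_H[OF light_cone_patch_P])

lemma smooth_on_W: "c \<in> A \<Longrightarrow> smooth_on (cran c) (\<lambda>y. W c y $ i $ j)"
  unfolding W_def by (rule dual_patch.smooth_W[OF dual_patch_P_Q])

lemma vol_density_g: "c \<in> A \<Longrightarrow> y \<in> cran c \<Longrightarrow> vol_density A g c y = sqrt (det (H c y))"
  by (simp add: vol_density_def metric_matrix_g)

end

section \<open>Variations\<close>

lemma dir_deriv_add:
  assumes "f differentiable (at y)" "g differentiable (at y)"
  shows "dir_deriv v (\<lambda>x. f x + g x) y = dir_deriv v f y + dir_deriv v g y"
  by (rule dir_deriv_eqI[OF has_derivative_add]) (use assms has_derivative_frechet in auto)

lemma dir_deriv_snd:
  fixes f :: "'a::real_normed_vector \<times> 'b::real_normed_vector \<Rightarrow> 'c::real_normed_vector"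
  assumes "f differentiable (at (t, y))"
  shows "dir_deriv u (\<lambda>y. f (t, y)) y = dir_deriv (0, u) f (t, y)"
proof -
  have d: "((\<lambda>y. (t, y)) has_derivative (\<lambda>u. (0, u))) (at y)"
    by (auto intro!: derivative_eq_intros)
  have "(\<lambda>y. (t, y)) differentiable (at y)" using d by (auto simp: differentiable_def)
  from dir_deriv_compose[OF this, of f] assms show ?thesis by (simp add: dir_deriv_eqI[OF d])
qed

context immersed
begin

abbreviation "LA \<equiv> line_times_atlas A"

lemma LA: "smooth_atlas LA"
  by (rule smooth_atlas_line[OF A])

lemma line_chart_LA: "c \<in> A \<Longrightarrow> line_chart c \<in> LA"
  by (simp add: line_times_atlas_eq)

definition \<Phi> :: "real \<times> 'm \<Rightarrow> 'n minkowski" where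
  "\<Phi> z = p (snd z) + fst z *\<^sub>R q (snd z)"

lemma extended_ruled_map_eq: "extended_ruled_map A p = \<Phi>"
  by (auto simp: extended_ruled_map_def dual_map_eq \<Phi>_def)

lemma near_\<Phi>: "smooth_near LA z \<Phi>"
proof -
  obtain s x where z: "z = (s, x)" by (cases z)
  let ?c = "chart_at A x"
  note c = chart_at_props[OF A, of x]
  interpret pt: dual_patch "cran ?c" "P ?c" "Q ?c" by (rule dual_patch_P_Q[OF c(1)])
  have o: "open ((UNIV :: real set) \<times> cran ?c)" by (simp add: open_Times pt.open_U)
  have sn: "smooth_on ((UNIV :: real set) \<times> cran ?c) (\<lambda>w. f (snd w))"
    if "smooth_on (cran ?c) f" for f :: "real ^ 'n \<Rightarrow> 'n minkowski"
    by (rule smooth_on_compose[OF o pt.open_U _ that smooth_on_bounded_linear[OF bounded_linear_snd]]) auto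
  have "smooth_on (UNIV \<times> cran ?c) (\<lambda>w. P ?c (snd w) + fst w *\<^sub>R Q ?c (snd w))"
    by (intro smooth_on_add smooth_on_scaleR o sn pt.smooth_P pt.smooth_Q
        smooth_on_bounded_linear[OF bounded_linear_fst])
  then have "smooth_at (\<lambda>w. P ?c (snd w) + fst w *\<^sub>R Q ?c (snd w)) (s, cmap ?c x)"
    using o cmap_in_cran[OF c(2)] by (intro smooth_atI[of "UNIV \<times> cran ?c"]) auto
  then have "smooth_at (\<lambda>w. \<Phi> (cinv (line_chart ?c) w)) (s, cmap ?c x)"
    by (rule smooth_at_cong[OF _ o])
       (use cmap_in_cran[OF c(2)] in \<open>auto simp: cinv_line[OF chart[OF c(1)]] \<Phi>_def P_def Q_def\<close>)
  then show ?thesis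
    using smooth_near_iff[OF LA line_chart_LA[OF c(1)], of z \<Phi>] c(2) by (simp add: z cdom_line cmap_line)
qed

lemma variation_metric_eq:
  "variation_metric A p G t x X Y = lorentz (vdiff (\<lambda>x. \<Phi> (G t x)) X) (vdiff (\<lambda>x. \<Phi> (G t x)) Y)"
  by (simp add: variation_metric_def pullback_def null_metric_def lorentz_pullback_def
      extended_ruled_map_eq vdiff_pushforward[OF LA near_\<Phi>])

end

locale varied = immersed A g p
  for A :: "('m::{t2_space, second_countable_topology}, real ^ 'n::finite) chart set"
    and g :: "'m tensor2" and p :: "'m \<Rightarrow> 'n minkowski" +
  fixes \<epsilon> :: real and G :: "real \<Rightarrow> 'm \<Rightarrow> real \<times> 'm" and K :: "'m set"
  assumes variation: "variation A p \<epsilon> G"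
    and support: "variation_supported_in \<epsilon> G K"
begin

abbreviation "h \<equiv> variation_metric A p G"

abbreviation "\<psi> t x \<equiv> snd (G t x)"

lemma eps: "\<epsilon> > 0"
  and G_0: "G 0 x = (0, x)"
  and smooth_G: "smooth_map_on LA LA ({-\<epsilon><..<\<epsilon>} \<times> UNIV) (\<lambda>z. G (fst z) (snd z))"
  and riem_h: "\<bar>t\<bar> < \<epsilon> \<Longrightarrow> riemannian_metric A (h t)"
  using variation by (auto simp: variation_def case_prod_unfold abs_less_iff)

lemma compact_K: "compact K"
  and G_outside: "\<bar>t\<bar> < \<epsilon> \<Longrightarrow> x \<notin> K \<Longrightarrow> G t x = (0, x)"
  using support by (auto simp: variation_supported_in_def abs_less_iff)

text \<open>The variation seen in Minkowski space. The induced metric is the Gram form of its space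
  derivatives, and joint smoothness in time and space can be stated for it.\<close>

definition R :: "('m, real ^ 'n) chart \<Rightarrow> real \<times> (real ^ 'n) \<Rightarrow> 'n minkowski" where
  "R c w = \<Phi> (G (fst w) (cinv c (snd w)))"

definition dom :: "('m, real ^ 'n) chart \<Rightarrow> (real \<times> (real ^ 'n)) set" where
  "dom c = {-\<epsilon><..<\<epsilon>} \<times> cran c"

lemma dom_iff: "(t, y) \<in> dom c \<longleftrightarrow> \<bar>t\<bar> < \<epsilon> \<and> y \<in> cran c"
  by (auto simp: dom_def)

lemma open_dom: "c \<in> A \<Longrightarrow> open (dom c)"
  unfolding dom_def by (intro open_Times open_greaterThanLessThan open_cran chart)

lemma smooth_R:
  assumes c: "c \<in> A"
  shows "smooth_on (dom c) (R c)"
proof (rule smooth_on_if_smooth_at)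
  fix w assume w: "w \<in> dom c"
  obtain t y where ty: "w = (t, y)" by (cases w)
  have t: "\<bar>t\<bar> < \<epsilon>" and y: "y \<in> cran c" using w by (auto simp: ty dom_iff)
  let ?x = "cinv c y"
  note ch = chart[OF c]
  have l: "(t, ?x) \<in> cdom (line_chart c)" using cinv_in_cdom[OF ch y] by (simp add: cdom_line)
  have "smooth_near LA (t, ?x) (\<lambda>z. \<Phi> (G (fst z) (snd z)))"
    by (rule smooth_near_comp[OF LA LA smooth_G _ near_\<Phi>]) (use t in auto)
  then have "smooth_at (\<lambda>w. \<Phi> (G (fst (cinv (line_chart c) w)) (snd (cinv (line_chart c) w)))) w"
    unfolding smooth_near_iff[OF LA line_chart_LA[OF c] l] by (simp add: cmap_line cmap_cinv[OF ch y] ty)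
  then show "smooth_at (R c) w"
    by (rule smooth_at_cong[OF _ open_dom[OF c] w]) (auto simp: dom_iff R_def cinv_line[OF ch])
qed

lemma near_\<Phi>_G:
  assumes "\<bar>t\<bar> < \<epsilon>"
  shows "smooth_near A x (\<lambda>x. \<Phi> (G t x))"
proof -
  let ?c = "chart_at A x"
  note c = chart_at_props[OF A, of x]
  have "smooth_at (R ?c) (t, cmap ?c x)"
    by (rule smooth_atI[OF open_dom[OF c(1)] _ smooth_R[OF c(1)]])
       (use assms cmap_in_cran[OF c(2)] in \<open>auto simp: dom_iff\<close>)
  moreover have "smooth_at (\<lambda>y. (t, y)) (cmap ?c x)"
    by (rule smooth_atI[of UNIV]) (auto intro!: smooth_on_Pair smooth_on_const smooth_on_id)
  ultimately have "smooth_at (\<lambda>y. R ?c (t, y)) (cmap ?c x)"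
    using smooth_at_compose[of "\<lambda>y. (t, y)" "cmap ?c x" "R ?c"] by simp
  then show ?thesis unfolding smooth_near_iff[OF A c] by (simp add: R_def)
qed

lemma metric_matrix_h:
  assumes t: "\<bar>t\<bar> < \<epsilon>" and c: "c \<in> A" and y: "y \<in> cran c"
  shows "metric_matrix A (h t) c (cinv c y)
    = (\<chi> i j. lorentz (dir_deriv (0, axis i 1) (R c) (t, y)) (dir_deriv (0, axis j 1) (R c) (t, y)))"
proof -
  have "vdiff (\<lambda>x. \<Phi> (G t x)) (coord_vector A c (cinv c y) u) = dir_deriv (0, u) (R c) (t, y)" for u
  proof -
    have "vdiff (\<lambda>x. \<Phi> (G t x)) (coord_vector A c (cinv c y) u) = dir_deriv u (\<lambda>y. \<Phi> (G t (cinv c y))) y"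
      by (rule vdiff_chart[OF c near_\<Phi>_G[OF t] y])
    also have "\<dots> = dir_deriv u (\<lambda>y. R c (t, y)) y" by (simp add: R_def)
    also have "\<dots> = dir_deriv (0, u) (R c) (t, y)"
      using smooth_on_differentiable[OF smooth_R[OF c]] t y by (intro dir_deriv_snd) (simp add: dom_iff)
    finally show ?thesis .
  qed
  then show ?thesis by (simp add: metric_matrix_def variation_metric_eq coord_frame_def)
qed

definition \<Gamma> :: "('m, real ^ 'n) chart \<Rightarrow> real \<times> (real ^ 'n) \<Rightarrow> real ^ 'n ^ 'n" where
  "\<Gamma> c w = (\<chi> i j. lorentz (dir_deriv (0, axis i 1) (R c) w) (dir_deriv (0, axis j 1) (R c) w))"

definition dens :: "('m, real ^ 'n) chart \<Rightarrow> real \<times> (real ^ 'n) \<Rightarrow> real" where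
  "dens c w = sqrt (det (\<Gamma> c w))"

lemma vol_density_h:
  "\<bar>t\<bar> < \<epsilon> \<Longrightarrow> c \<in> A \<Longrightarrow> y \<in> cran c \<Longrightarrow> vol_density A (h t) c y = dens c (t, y)"
  by (simp add: vol_density_def dens_def \<Gamma>_def metric_matrix_h)

lemma smooth_dens:
  assumes c: "c \<in> A"
  shows "smooth_on (dom c) (dens c)"
  unfolding dens_def[abs_def]
proof (intro smooth_on_sqrt smooth_on_det open_dom c)
  show "smooth_on (dom c) (\<lambda>w. \<Gamma> c w $ i $ j)" for i j
    unfolding \<Gamma>_def
    by (simp add: smooth_on_bilinear[OF open_dom[OF c] bounded_bilinear_lorentz
          smooth_on_dir_deriv[OF smooth_R[OF c]] smooth_on_dir_deriv[OF smooth_R[OF c]]])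
  fix w assume "w \<in> dom c"
  moreover obtain t y where w: "w = (t, y)" by (cases w)
  ultimately have ty: "\<bar>t\<bar> < \<epsilon>" "y \<in> cran c" by (auto simp: dom_iff)
  show "det (\<Gamma> c w) > 0"
    using metric_matrix_pos(2)[OF A riem_h[OF ty(1)] c cinv_in_cdom[OF chart[OF c] ty(2)]]
    by (simp add: metric_matrix_h[OF ty(1) c ty(2)] \<Gamma>_def w)
qed

lemma dens_0:
  assumes c: "c \<in> A" and y: "y \<in> cran c"
  shows "dens c (0, y) = vol_density A g c y"
proof -
  have "dir_deriv (0, u) (R c) (0, y) = dir_deriv u (P c) y" for u
  proof -
    have "dir_deriv u (\<lambda>y. R c (0, y)) y = dir_deriv (0, u) (R c) (0, y)"
      using smooth_on_differentiable[OF smooth_R[OF c]] eps y by (intro dir_deriv_snd) (simp add: dom_iff)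
    then show ?thesis by (simp add: R_def G_0 \<Phi>_def P_def[abs_def])
  qed
  then have "\<Gamma> c (0, y) = H c y"
    by (simp add: \<Gamma>_def H_def light_cone_patch.H_def[OF light_cone_patch_P[OF c]]
        light_cone_patch.E_def[OF light_cone_patch_P[OF c]])
  then show ?thesis by (simp add: dens_def vol_density_g[OF c y])
qed

subsection \<open>The tangential part of a variation in coordinates\<close>

definition f :: "('m, real ^ 'n) chart \<Rightarrow> real \<times> (real ^ 'n) \<Rightarrow> real ^ 'n" where
  "f c w = cmap c (\<psi> (fst w) (cinv c (snd w)))"

definition \<sigma> :: "('m, real ^ 'n) chart \<Rightarrow> real \<times> (real ^ 'n) \<Rightarrow> real" where
  "\<sigma> c w = fst (G (fst w) (cinv c (snd w)))"

text \<open>The points that \<psi> keeps in the chart domain; elsewhere \<open>f c\<close> is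
  arbitrary, since \<open>cmap c\<close> is.\<close>

definition fdom :: "('m, real ^ 'n) chart \<Rightarrow> (real \<times> (real ^ 'n)) set" where
  "fdom c = {w \<in> dom c. \<psi> (fst w) (cinv c (snd w)) \<in> cdom c}"

lemma fdom_local:
  assumes c: "c \<in> A" and w: "w \<in> fdom c"
  shows "\<exists>T. open T \<and> w \<in> T \<and> T \<subseteq> fdom c" "smooth_at (f c) w" "smooth_at (\<sigma> c) w"
proof -
  let ?l = "line_chart c" and ?F = "\<lambda>z. G (fst z) (snd z)"
  note ch = chart[OF c] and lch = is_chart_line[OF chart[OF c]]
  obtain t y where ty: "w = (t, y)" by (cases w)
  let ?x = "cinv c y"
  have t: "\<bar>t\<bar> < \<epsilon>" and y: "y \<in> cran c" and in': "\<psi> t ?x \<in> cdom c"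
    using w by (auto simp: ty fdom_def dom_iff)
  have 1: "(t, ?x) \<in> {-\<epsilon><..<\<epsilon>} \<times> UNIV" using t by auto
  have 2: "(t, ?x) \<in> cdom ?l" using cinv_in_cdom[OF ch y] by (simp add: cdom_line)
  have 3: "?F (t, ?x) \<in> cdom ?l" using in' by (cases "G t ?x") (simp add: cdom_line)
  have cm: "cmap ?l (t, ?x) = w" by (simp add: cmap_line cmap_cinv[OF ch y] ty)
  obtain V where V: "open V" "(t, ?x) \<in> V" "V \<subseteq> {-\<epsilon><..<\<epsilon>} \<times> UNIV" "V \<subseteq> cdom ?l" "?F ` V \<subseteq> cdom ?l"
    and sm: "smooth_at (\<lambda>w. cmap ?l (?F (cinv ?l w))) (cmap ?l (t, ?x))" and "continuous_on V ?F"
    by (rule smooth_map_onD[OF LA LA smooth_G line_chart_LA[OF c] line_chart_LA[OF c] 1 2 3])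
  have "open (cmap ?l ` V)" by (rule open_cmap_image[OF lch V(1,4)])
  moreover have "w \<in> cmap ?l ` V" using V(2) cm by (metis image_eqI)
  moreover have "cmap ?l ` V \<subseteq> fdom c"
  proof
    fix u assume "u \<in> cmap ?l ` V"
    then obtain t' x' where v: "(t', x') \<in> V" "u = (t', cmap c x')" by (auto simp: cmap_line)
    then have x': "x' \<in> cdom c" "\<bar>t'\<bar> < \<epsilon>" using V(3,4) by (auto simp: cdom_line abs_less_iff)
    have "?F (t', x') \<in> cdom ?l" using V(5) v(1) by blast
    then have "\<psi> t' x' \<in> cdom c" by (cases "G t' x'") (simp add: cdom_line)
    then show "u \<in> fdom c" using x' by (simp add: v fdom_def dom_iff cinv_cmap[OF ch] cmap_in_cran)
  qed
  ultimately show "\<exists>T. open T \<and> w \<in> T \<and> T \<subseteq> fdom c" by blast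
  have lin: "bounded_linear (snd :: real \<times> (real ^ 'n) \<Rightarrow> _)" "bounded_linear (fst :: real \<times> (real ^ 'n) \<Rightarrow> _)"
    by (rule bounded_linear_snd, rule bounded_linear_fst)
  have wd: "w \<in> dom c" using w by (simp add: fdom_def)
  have cl: "cmap ?l z = (fst z, cmap c (snd z))" for z by (cases z) (simp add: cmap_line)
  have "smooth_at (\<lambda>w. snd (cmap ?l (?F (cinv ?l w)))) w"
    using smooth_at_linear_compose[OF lin(1) sm] by (simp only: cm)
  then show "smooth_at (f c) w"
    by (rule smooth_at_cong[OF _ open_dom[OF c] wd]) (auto simp: dom_iff f_def cinv_line[OF ch] cl)
  have "smooth_at (\<lambda>w. fst (cmap ?l (?F (cinv ?l w)))) w"
    using smooth_at_linear_compose[OF lin(2) sm] by (simp only: cm)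
  then show "smooth_at (\<sigma> c) w"
    by (rule smooth_at_cong[OF _ open_dom[OF c] wd]) (auto simp: dom_iff \<sigma>_def cinv_line[OF ch] cl)
qed

lemma open_fdom: "c \<in> A \<Longrightarrow> open (fdom c)"
  using fdom_local(1) by (subst open_subopen) blast

lemma smooth_f: "c \<in> A \<Longrightarrow> smooth_on (fdom c) (f c)"
  by (rule smooth_on_if_smooth_at) (rule fdom_local(2))

lemma smooth_\<sigma>: "c \<in> A \<Longrightarrow> smooth_on (fdom c) (\<sigma> c)"
  by (rule smooth_on_if_smooth_at) (rule fdom_local(3))

lemma f_in_cran: "w \<in> fdom c \<Longrightarrow> f c w \<in> cran c"
  by (simp add: fdom_def f_def cmap_in_cran)

lemma fdom_0: "c \<in> A \<Longrightarrow> y \<in> cran c \<Longrightarrow> (0, y) \<in> fdom c"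
  using eps cinv_in_cdom[OF chart] by (simp add: fdom_def dom_iff G_0)

lemma f_0: "c \<in> A \<Longrightarrow> (0, y) \<in> fdom c \<Longrightarrow> f c (0, y) = y"
  using cmap_cinv[OF chart] by (simp add: fdom_def dom_iff f_def G_0)

lemma \<sigma>_0: "\<sigma> c (0, y) = 0"
  by (simp add: \<sigma>_def G_0)

definition Df :: "('m, real ^ 'n) chart \<Rightarrow> real \<times> (real ^ 'n) \<Rightarrow> real ^ 'n ^ 'n" where
  "Df c w = matrix (\<lambda>u. dir_deriv (0, u) (f c) w)"

text \<open>\<open>R c\<close> is P + \<sigma> Q at the moved point. The derivative of \<sigma> adds
  only a multiple of Q, which is null and orthogonal to dP and dQ, hence invisible in the Gram
  matrix. What remains is the Gram matrix of the leaf at height \<sigma>, pulled back by f.\<close>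

lemma dens_formula:
  assumes c: "c \<in> A" and w: "w \<in> fdom c"
  shows "dens c w = \<bar>det (Df c w)\<bar> * (\<bar>det (mat 1 + \<sigma> c w *\<^sub>R W c (f c w))\<bar> * vol_density A g c (f c w))"
proof -
  interpret pt: dual_patch "cran c" "P c" "Q c" by (rule dual_patch_P_Q[OF c])
  let ?z = "f c w" and ?s = "\<sigma> c w"
  note z = f_in_cran[OF w]
  note df = smooth_on_differentiable[OF smooth_f[OF c] w] and d\<sigma> = smooth_on_differentiable[OF smooth_\<sigma>[OF c] w]
    and dP = pt.diff_P[OF z] and dQ = pt.diff_Q[OF z]
  have comp: "(\<lambda>w. P c (f c w)) differentiable (at w)" "(\<lambda>w. Q c (f c w)) differentiable (at w)"
    using differentiable_chain_at[OF df dP] differentiable_chain_at[OF df dQ] by (simp_all add: o_def)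
  have Rf: "R c u = P c (f c u) + \<sigma> c u *\<^sub>R Q c (f c u)" if "u \<in> fdom c" for u
    using that cinv_cmap[OF chart[OF c]] by (simp add: fdom_def R_def \<Phi>_def P_def Q_def f_def \<sigma>_def)
  have L: "Df c w *v u = dir_deriv (0, u) (f c) w" for u
  proof -
    have "linear (\<lambda>u. (0 :: real, u :: real ^ 'n))" by (rule linearI) auto
    then have "linear (\<lambda>u. dir_deriv (0, u) (f c) w)"
      using linear_compose[OF _ linear_dir_deriv[OF df]] by (simp add: o_def)
    then show ?thesis unfolding Df_def by (simp add: matrix_works linear_matrix_vector_mul_eq)
  qed
  let ?X = "\<lambda>u. dir_deriv (Df c w *v u) (P c) ?z + ?s *\<^sub>R dir_deriv (Df c w *v u) (Q c) ?z"
  have "\<exists>b. dir_deriv (0, u) (R c) w = ?X u + b *\<^sub>R Q c ?z" for u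
  proof -
    have "dir_deriv (0, u) (R c) w = dir_deriv (0, u) (\<lambda>w. P c (f c w) + \<sigma> c w *\<^sub>R Q c (f c w)) w"
      by (rule dir_deriv_cong_open[OF open_fdom[OF c] Rf w])
    also have "\<dots> = dir_deriv (0, u) (\<lambda>w. P c (f c w)) w + dir_deriv (0, u) (\<lambda>w. \<sigma> c w *\<^sub>R Q c (f c w)) w"
      by (rule dir_deriv_add[OF comp(1)]) (intro differentiable_scaleR d\<sigma> comp(2))
    also have "\<dots> = ?X u + dir_deriv (0, u) (\<sigma> c) w *\<^sub>R Q c ?z"
      unfolding dir_deriv_bilinear[OF bounded_bilinear_scaleR d\<sigma> comp(2)] dir_deriv_compose[OF df dP]
        dir_deriv_compose[OF df dQ] L by simp
    finally show ?thesis by blast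
  qed
  then obtain b where b: "dir_deriv (0, u) (R c) w = ?X u + b u *\<^sub>R Q c ?z" for u by metis
  have XQ: "lorentz (?X u) (Q c ?z) = 0" for u
    using pt.lorentz_dP_Q[OF z] pt.lorentz_F_Q[OF z]
    by (simp add: lorentz.add_left lorentz.scaleR_left pt.dir_deriv_Q[OF z] lorentz.sum_left)
  have QX: "lorentz (Q c ?z) (?X u) = 0" for u using XQ lorentz_commute by metis
  have QQ: "lorentz (Q c ?z) (Q c ?z) = 0" by (rule pt.null_Q[OF z])
  have "lorentz (?X u + b u *\<^sub>R Q c ?z) (?X v + b v *\<^sub>R Q c ?z) = lorentz (?X u) (?X v)" for u v
    unfolding lorentz.add_left[of "?X u"] lorentz.add_right[of _ "?X v"] lorentz.scaleR_left[of "b u"]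
      lorentz.scaleR_right[of _ "b v"] XQ QX QQ by simp
  then have "\<Gamma> c w = (\<chi> i j. (Df c w *v axis i 1) \<bullet> (gram c ?s ?z *v (Df c w *v axis j 1)))"
    unfolding \<Gamma>_def b gram_form[OF c z] by (simp only:)
  then have "det (\<Gamma> c w) = (det (Df c w))\<^sup>2 * ((det (mat 1 + ?s *\<^sub>R W c ?z))\<^sup>2 * det (H c ?z))"
    by (simp add: gram_matrix_compose det_mul det_transpose det_gram power2_eq_square)
  then show ?thesis by (simp add: dens_def real_sqrt_mult vol_density_g[OF c z])
qed

end

section \<open>The volume along a variation\<close>

context varied
begin

text \<open>The bound on \<open>\<sigma>\<^sup>2 tr W\<^sup>2\<close> makes \<open>1 + \<sigma> W\<close> positive.\<close>

definition good :: "('m, real ^ 'n) chart \<Rightarrow> real ^ 'n \<Rightarrow> real \<Rightarrow> real \<Rightarrow> bool" where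
  "good c a r \<delta> \<longleftrightarrow> c \<in> A \<and> 0 < r \<and> 0 < \<delta> \<and> \<delta> \<le> \<epsilon> \<and> cball a r \<subseteq> cran c \<and>
     (\<forall>t y. \<bar>t\<bar> < \<delta> \<longrightarrow> y \<in> cball a r \<longrightarrow> (t, y) \<in> fdom c \<and>
        (\<sigma> c (t, y))\<^sup>2 * trace (W c (f c (t, y)) ** W c (f c (t, y))) < 1) \<and>
     (\<forall>t. \<bar>t\<bar> < \<delta> \<longrightarrow> inj_on (\<lambda>y. f c (t, y)) (cball a r))"

lemma good_mono: "good c a r \<delta> \<Longrightarrow> 0 < \<delta>' \<Longrightarrow> \<delta>' \<le> \<delta> \<Longrightarrow> good c a r \<delta>'"
  unfolding good_def by (meson order_trans less_le_trans)

text \<open>At t = 0 the height vanishes and f is the identity, so all conditions hold there; they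
  persist on a small ball for small t.\<close>

lemma good_exists:
  assumes c: "c \<in> A" and x: "x \<in> cdom c"
  shows "\<exists>r \<delta>. good c (cmap c x) r \<delta>"
proof -
  let ?a = "cmap c x"
  define N where "N w = (\<sigma> c w)\<^sup>2 * trace (W c (f c w) ** W c (f c w))" for w
  have cW: "continuous_on (fdom c) (\<lambda>w. W c (f c w) $ i $ j)" for i j
    by (rule continuous_on_compose2[OF smooth_on_imp_continuous_on[OF smooth_on_W[OF c]]
          smooth_on_imp_continuous_on[OF smooth_f[OF c]] image_subsetI[OF f_in_cran]])
  have "continuous_on (fdom c) N"
    unfolding N_def trace_def matrix_matrix_mult_def vec_lambda_beta
    by (intro continuous_on_mult continuous_on_sum continuous_on_power cW
        smooth_on_imp_continuous_on[OF smooth_\<sigma>[OF c]])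
  then have o: "open (fdom c \<inter> N -` {..<1})"
    using continuous_on_open_vimage[OF open_fdom[OF c]] by (metis Int_commute open_lessThan)
  note a = cmap_in_cran[OF x] and a0 = fdom_0[OF c cmap_in_cran[OF x]]
  have m: "(0, ?a) \<in> fdom c \<inter> N -` {..<1}" using a0 by (simp add: N_def \<sigma>_0)
  obtain V \<delta>1 where V: "open V" "?a \<in> V" "\<delta>1 > 0"
    "\<And>t z. \<bar>t\<bar> < \<delta>1 \<Longrightarrow> z \<in> V \<Longrightarrow> (t, z) \<in> fdom c \<inter> N -` {..<1}"
    using eventually_time_nhds[OF o m] by blast
  obtain r1 where r1: "r1 > 0" "\<And>t. \<bar>t\<bar> < r1 \<Longrightarrow> inj_on (\<lambda>y. f c (t, y)) (ball ?a r1)"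
    using locally_injective_deformation[OF open_fdom[OF c] smooth_f[OF c] a0 f_0[OF c]] by blast
  have "open (V \<inter> ball ?a r1 \<inter> cran c)" using V open_cran[OF chart[OF c]] by auto
  moreover have "?a \<in> V \<inter> ball ?a r1 \<inter> cran c" using V r1 a by simp
  ultimately obtain r where r: "r > 0" "cball ?a r \<subseteq> V \<inter> ball ?a r1 \<inter> cran c"
    using open_contains_cball by blast
  have "good c ?a r (min (min \<delta>1 r1) \<epsilon>)"
    unfolding good_def
  proof (intro conjI allI impI)
    fix t y assume t: "\<bar>t\<bar> < min (min \<delta>1 r1) \<epsilon>" and y: "y \<in> cball ?a r"
    then have "(t, y) \<in> fdom c \<inter> N -` {..<1}" using V(4)[of t y] r(2) by auto
    then show "(t, y) \<in> fdom c" "(\<sigma> c (t, y))\<^sup>2 * trace (W c (f c (t, y)) ** W c (f c (t, y))) < 1"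
      by (auto simp: N_def)
  next
    fix t assume "\<bar>t\<bar> < min (min \<delta>1 r1) \<epsilon>"
    then show "inj_on (\<lambda>y. f c (t, y)) (cball ?a r)"
      using inj_on_subset[OF r1(2)[of t]] r(2) by auto
  qed (use c r r1 V eps in auto)
  then show ?thesis by blast
qed

lemma \<psi>_near:
  assumes "open U" "x \<in> U"
  shows "\<exists>V \<delta>. open V \<and> x \<in> V \<and> \<delta> > 0 \<and> (\<forall>t. \<bar>t\<bar> < \<delta> \<longrightarrow> (\<forall>z\<in>V. \<psi> t z \<in> U))"
proof -
  let ?c = "chart_at A x" and ?F = "\<lambda>z. G (fst z) (snd z)"
  note c = chart_at_props[OF A, of x]
  have 1: "(0, x) \<in> {-\<epsilon><..<\<epsilon>} \<times> UNIV" using eps by auto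
  have 2: "(0, x) \<in> cdom (line_chart ?c)" using c by (simp add: cdom_line)
  have 3: "?F (0, x) \<in> cdom (line_chart ?c)" using c by (simp add: cdom_line G_0)
  obtain V where V: "open V" "(0, x) \<in> V" "V \<subseteq> {-\<epsilon><..<\<epsilon>} \<times> UNIV" "V \<subseteq> cdom (line_chart ?c)"
    "?F ` V \<subseteq> cdom (line_chart ?c)"
    "smooth_at (\<lambda>y. cmap (line_chart ?c) (?F (cinv (line_chart ?c) y))) (cmap (line_chart ?c) (0, x))"
    "continuous_on V ?F"
    by (rule smooth_map_onD[OF LA LA smooth_G line_chart_LA[OF c(1)] line_chart_LA[OF c(1)] 1 2 3])
  have "open ((UNIV :: real set) \<times> U)" using assms by (simp add: open_Times)
  then have o: "open (V \<inter> ?F -` (UNIV \<times> U))"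
    using continuous_on_open_vimage[OF V(1)] V(7) by (metis Int_commute)
  have "(0, x) \<in> V \<inter> ?F -` (UNIV \<times> U)" using V(2) assms by (simp add: G_0)
  then obtain W' \<delta> where W': "open W'" "x \<in> W'" "\<delta> > 0"
    "\<And>t z. \<bar>t\<bar> < \<delta> \<Longrightarrow> z \<in> W' \<Longrightarrow> (t, z) \<in> V \<inter> ?F -` (UNIV \<times> U)"
    using eventually_time_nhds[OF o] by blast
  have "\<psi> t z \<in> U" if "\<bar>t\<bar> < \<delta>" "z \<in> W'" for t z
  proof -
    have "?F (t, z) \<in> UNIV \<times> U" using W'(4)[OF that] by blast
    then show ?thesis by (cases "G t z") simp
  qed
  then show ?thesis using W' by blast
qed

lemma \<psi>_outside: "\<bar>t\<bar> < \<epsilon> \<Longrightarrow> x \<notin> K \<Longrightarrow> \<psi> t x = x"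
  by (simp add: G_outside)

lemma \<psi>_locally_injective:
  "\<exists>U \<delta>. open U \<and> x \<in> U \<and> \<delta> > 0 \<and> \<delta> \<le> \<epsilon> \<and> (\<forall>t. \<bar>t\<bar> < \<delta> \<longrightarrow> inj_on (\<psi> t) U)"
proof -
  let ?c = "chart_at A x"
  note c = chart_at_props[OF A, of x] and ch = chart[OF chart_at_props(1)[OF A, of x]]
  obtain r \<delta> where gd: "good ?c (cmap ?c x) r \<delta>" using good_exists[OF c] by blast
  let ?U = "cdom ?c \<inter> cmap ?c -` ball (cmap ?c x) r"
  have "inj_on (\<psi> t) ?U" if t: "\<bar>t\<bar> < \<delta>" for t
  proof (rule inj_onI)
    fix u v assume u: "u \<in> ?U" and v: "v \<in> ?U" and "\<psi> t u = \<psi> t v"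
    then have "f ?c (t, cmap ?c u) = f ?c (t, cmap ?c v)" by (simp add: f_def cinv_cmap[OF ch])
    moreover have "inj_on (\<lambda>y. f ?c (t, y)) (cball (cmap ?c x) r)" using gd t by (simp add: good_def)
    ultimately have "cmap ?c u = cmap ?c v" using u v by (auto dest!: inj_onD)
    then show "u = v" using u v inj_on_cmap[OF ch] by (auto dest: inj_onD)
  qed
  moreover have "open ?U" by (rule open_cmap_vimage[OF ch open_ball])
  moreover have "x \<in> ?U" using c gd by (simp add: good_def)
  ultimately show ?thesis using gd unfolding good_def by blast
qed

lemma \<psi>_locally_surjective:
  "\<exists>V \<delta>. open V \<and> x \<in> V \<and> \<delta> > 0 \<and> (\<forall>t. \<bar>t\<bar> < \<delta> \<longrightarrow> (\<forall>z\<in>V. z \<in> range (\<psi> t)))"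
proof -
  let ?c = "chart_at A x"
  let ?a = "cmap ?c x"
  note c = chart_at_props[OF A, of x] and ch = chart[OF chart_at_props(1)[OF A, of x]]
  obtain e \<delta> where gd: "good ?c ?a e \<delta>" using good_exists[OF c] by blast
  then have e: "e > 0" "\<delta> > 0" and fd: "\<And>t y. \<bar>t\<bar> < \<delta> \<Longrightarrow> y \<in> cball ?a e \<Longrightarrow> (t, y) \<in> fdom ?c"
    by (auto simp: good_def)
  obtain r where r: "r > 0" "\<And>t y. \<bar>t\<bar> < r \<Longrightarrow> y \<in> ball ?a r \<Longrightarrow> \<exists>z\<in>ball ?a e. f ?c (t, z) = y"
    using locally_surjective_deformation[OF open_fdom[OF c(1)]
        smooth_on_imp_continuous_on[OF smooth_f[OF c(1)]]
        fdom_0[OF c(1) cmap_in_cran[OF c(2)]] f_0[OF c(1)] e(1)] by blast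
  let ?V = "cdom ?c \<inter> cmap ?c -` ball ?a r"
  have "v \<in> range (\<psi> t)" if t: "\<bar>t\<bar> < min r \<delta>" and v: "v \<in> ?V" for t v
  proof -
    obtain z where z: "z \<in> ball ?a e" "f ?c (t, z) = cmap ?c v" using r(2)[of t "cmap ?c v"] t v by auto
    have "(t, z) \<in> fdom ?c" using fd[of t z] t z by auto
    then have "\<psi> t (cinv ?c z) \<in> cdom ?c" by (simp add: fdom_def)
    then have "\<psi> t (cinv ?c z) = v"
      using z(2) v inj_on_cmap[OF ch] by (auto simp: f_def dest: inj_onD)
    then show ?thesis by (rule range_eqI[OF sym])
  qed
  moreover have "open ?V" by (rule open_cmap_vimage[OF ch open_ball])
  moreover have "x \<in> ?V" using c r by simp
  moreover have "min r \<delta> > 0" using r e by simp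
  ultimately show ?thesis by blast
qed

text \<open>Compactness makes local injectivity and surjectivity uniform on K. Outside K the map is
  the identity, so it remains to exclude that points of K leave K or collide with points
  outside.\<close>

lemma \<psi>_bijective: "\<exists>\<delta>>0. \<delta> \<le> \<epsilon> \<and> (\<forall>t. \<bar>t\<bar> < \<delta> \<longrightarrow> inj (\<psi> t) \<and> \<psi> t ` K = K)"
proof -
  have "\<exists>\<delta>>0. \<forall>t. \<bar>t\<bar> < \<delta> \<longrightarrow> (\<forall>z\<in>K. \<psi> t z \<notin> K \<longrightarrow> \<psi> t z = z)"
  proof (rule compact_uniform_time[OF compact_K])
    fix x
    obtain U \<delta> where U: "open U" "x \<in> U" "\<delta> > 0" "\<delta> \<le> \<epsilon>" "\<And>t. \<bar>t\<bar> < \<delta> \<Longrightarrow> inj_on (\<psi> t) U"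
      using \<psi>_locally_injective[of x] by blast
    obtain V \<delta>' where V: "open V" "x \<in> V" "\<delta>' > 0" "\<And>t z. \<bar>t\<bar> < \<delta>' \<Longrightarrow> z \<in> V \<Longrightarrow> \<psi> t z \<in> U"
      using \<psi>_near[OF U(1,2)] by blast
    have "\<psi> t z = z" if t: "\<bar>t\<bar> < min \<delta> \<delta>'" and z: "z \<in> V \<inter> U" and out: "\<psi> t z \<notin> K" for t z
    proof -
      \<comment> \<open>An image outside K is a fixed point, so z and its image have the same image
        and local injectivity identifies them. A point of K therefore cannot leave K.\<close>
      have "\<psi> t (\<psi> t z) = \<psi> t z" using \<psi>_outside[OF _ out] t U(4) by simp
      moreover have "\<psi> t z \<in> U" using V(4)[of t z] t z by simp
      ultimately show ?thesis using U(5)[of t] t z by (auto dest: inj_onD)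
    qed
    then show "\<exists>V \<delta>. open V \<and> x \<in> V \<and> \<delta> > 0 \<and>
        (\<forall>t. \<bar>t\<bar> < \<delta> \<longrightarrow> (\<forall>z\<in>V. \<psi> t z \<notin> K \<longrightarrow> \<psi> t z = z))"
      using U V by (intro exI[of _ "V \<inter> U"] exI[of _ "min \<delta> \<delta>'"]) auto
  qed
  then obtain \<delta>1 where \<delta>1: "\<delta>1 > 0" "\<And>t z. \<bar>t\<bar> < \<delta>1 \<Longrightarrow> z \<in> K \<Longrightarrow> \<psi> t z \<notin> K \<Longrightarrow> \<psi> t z = z"
    by blast
  \<comment> \<open>Injectivity concerns pairs: near the diagonal of K \<times> K it is local
    injectivity, away from it the images stay in disjoint neighbourhoods.\<close>
  have "\<exists>\<delta>>0. \<forall>t. \<bar>t\<bar> < \<delta> \<longrightarrow> (\<forall>z\<in>K \<times> K. \<psi> t (fst z) = \<psi> t (snd z) \<longrightarrow> fst z = snd z)"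
  proof (rule compact_uniform_time[OF compact_Times[OF compact_K compact_K]])
    fix z :: "'m \<times> 'm"
    obtain x w where z: "z = (x, w)" by (cases z)
    show "\<exists>V \<delta>. open V \<and> z \<in> V \<and> \<delta> > 0 \<and>
        (\<forall>t. \<bar>t\<bar> < \<delta> \<longrightarrow> (\<forall>z\<in>V. \<psi> t (fst z) = \<psi> t (snd z) \<longrightarrow> fst z = snd z))"
    proof (cases "x = w")
      case True
      obtain U \<delta> where U: "open U" "x \<in> U" "\<delta> > 0" "\<And>t. \<bar>t\<bar> < \<delta> \<Longrightarrow> inj_on (\<psi> t) U"
        using \<psi>_locally_injective[of x] by blast
      then show ?thesis
        using True by (intro exI[of _ "U \<times> U"] exI[of _ \<delta>]) (auto simp: z open_Times dest: inj_onD)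
    next
      case False
      then obtain U1 U2 where U: "open U1" "open U2" "x \<in> U1" "w \<in> U2" "U1 \<inter> U2 = {}"
        using hausdorff by metis
      obtain V1 \<delta>1 where V1: "open V1" "x \<in> V1" "\<delta>1 > 0" "\<And>t z. \<bar>t\<bar> < \<delta>1 \<Longrightarrow> z \<in> V1 \<Longrightarrow> \<psi> t z \<in> U1"
        using \<psi>_near[OF U(1,3)] by blast
      obtain V2 \<delta>2 where V2: "open V2" "w \<in> V2" "\<delta>2 > 0" "\<And>t z. \<bar>t\<bar> < \<delta>2 \<Longrightarrow> z \<in> V2 \<Longrightarrow> \<psi> t z \<in> U2"
        using \<psi>_near[OF U(2,4)] by blast
      have "\<psi> t a \<noteq> \<psi> t b" if "\<bar>t\<bar> < min \<delta>1 \<delta>2" "a \<in> V1" "b \<in> V2" for t a b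
        using V1(4)[of t a] V2(4)[of t b] that U(5) by auto
      then show ?thesis
        using V1 V2 by (intro exI[of _ "V1 \<times> V2"] exI[of _ "min \<delta>1 \<delta>2"]) (auto simp: z open_Times)
    qed
  qed
  then obtain \<delta>2 where \<delta>2: "\<delta>2 > 0"
    and inj: "\<forall>t. \<bar>t\<bar> < \<delta>2 \<longrightarrow> (\<forall>z\<in>K \<times> K. \<psi> t (fst z) = \<psi> t (snd z) \<longrightarrow> fst z = snd z)"
    by blast
  have "\<exists>\<delta>>0. \<forall>t. \<bar>t\<bar> < \<delta> \<longrightarrow> (\<forall>z\<in>K. z \<in> range (\<psi> t))"
    by (rule compact_uniform_time[OF compact_K]) (rule \<psi>_locally_surjective)
  then obtain \<delta>3 where \<delta>3: "\<delta>3 > 0" "\<And>t z. \<bar>t\<bar> < \<delta>3 \<Longrightarrow> z \<in> K \<Longrightarrow> z \<in> range (\<psi> t)"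
    by blast
  define \<delta> where "\<delta> = min (min \<delta>1 \<delta>2) (min \<delta>3 \<epsilon>)"
  have "inj (\<psi> t) \<and> \<psi> t ` K = K" if "\<bar>t\<bar> < \<delta>" for t
  proof -
    have t: "\<bar>t\<bar> < \<delta>1" "\<bar>t\<bar> < \<delta>2" "\<bar>t\<bar> < \<delta>3" "\<bar>t\<bar> < \<epsilon>" using that by (auto simp: \<delta>_def)
    have inner: "u = v" if "u \<in> K" "v \<in> K" "\<psi> t u = \<psi> t v" for u v
      using inj[rule_format, OF t(2), of "(u, v)"] that by simp
    have mixed: "u = v" if uv: "u \<in> K" "v \<notin> K" "\<psi> t u = \<psi> t v" for u v
    proof -
      have v: "\<psi> t u = v" unfolding uv(3) by (rule \<psi>_outside[OF t(4) uv(2)])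
      have "\<psi> t u = u" by (rule \<delta>1(2)[OF t(1) uv(1)]) (simp only: v uv(2) not_False_eq_True)
      then show ?thesis by (simp only: v)
    qed
    have "inj (\<psi> t)"
    proof (rule injI)
      fix u v assume e: "\<psi> t u = \<psi> t v"
      consider "u \<in> K" "v \<in> K" | "u \<in> K" "v \<notin> K" | "u \<notin> K" "v \<in> K" | "u \<notin> K" "v \<notin> K" by blast
      then show "u = v"
      proof cases
        case 1
        then show ?thesis by (rule inner[OF _ _ e])
      next
        case 2
        then show ?thesis by (rule mixed[OF _ _ e])
      next
        case 3
        then show ?thesis by (intro sym[OF mixed[OF _ _ e[symmetric]]])
      next
        case 4
        show ?thesis using e unfolding \<psi>_outside[OF t(4) 4(1)] \<psi>_outside[OF t(4) 4(2)] .
      qed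
    qed
    moreover have "\<psi> t ` K = K"
    proof
      show "\<psi> t ` K \<subseteq> K"
      proof
        fix y assume "y \<in> \<psi> t ` K"
        then obtain x where x: "x \<in> K" "y = \<psi> t x" by blast
        show "y \<in> K"
        proof (rule ccontr)
          assume y: "y \<notin> K"
          have "\<psi> t x = x" by (rule \<delta>1(2)[OF t(1) x(1)]) (use y x(2) in blast)
          then show False using x y by metis
        qed
      qed
      show "K \<subseteq> \<psi> t ` K"
      proof
        fix y assume y: "y \<in> K"
        then obtain w where w: "y = \<psi> t w" using \<delta>3(2)[OF t(3)] by blast
        \<comment> \<open>A preimage outside K would be fixed, hence equal to y, which lies in
          K.\<close>
        then have "w \<in> K" using \<psi>_outside[OF t(4), of w] y by metis
        then show "y \<in> \<psi> t ` K" using w by blast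
      qed
    qed
    ultimately show ?thesis ..
  qed
  moreover have "\<delta> > 0" "\<delta> \<le> \<epsilon>" using \<delta>1 \<delta>2 \<delta>3 eps by (auto simp: \<delta>_def)
  ultimately show ?thesis by blast
qed

text \<open>One \<delta> serves all pieces and the pieces do not depend on t, so all dependence of
  the volume on t sits in the integrands.\<close>

definition pieces ::
    "real \<Rightarrow> nat \<Rightarrow> (nat \<Rightarrow> ('m, real ^ 'n) chart) \<Rightarrow> (nat \<Rightarrow> real ^ 'n) \<Rightarrow> (nat \<Rightarrow> real) \<Rightarrow>
     (nat \<Rightarrow> 'm set) \<Rightarrow> bool" where
  "pieces \<delta> N c a r B \<longleftrightarrow> \<delta> > 0 \<and> \<delta> \<le> \<epsilon> \<and>
     (\<forall>i<N. good (c i) (a i) (r i) \<delta> \<and> B i \<in> sets borel \<and> B i \<subseteq> cdom (c i) \<and>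
        cmap (c i) ` B i \<subseteq> ball (a i) (r i)) \<and>
     disjoint_family_on B {..<N} \<and> (\<Union>i<N. B i) = K"

lemma pieces_exist: "\<exists>\<delta> N c a r B. pieces \<delta> N c a r B"
proof -
  define c where "c x = chart_at A x" for x
  define a where "a x = cmap (c x) x" for x
  have c: "c x \<in> A" "x \<in> cdom (c x)" for x using chart_at_props[OF A] by (auto simp: c_def)
  obtain r \<delta> where gd: "\<And>x. good (c x) (a x) (r x) (\<delta> x)"
    using good_exists[OF c] unfolding a_def by metis
  define U where "U x = cdom (c x) \<inter> cmap (c x) -` ball (a x) (r x)" for x
  have U: "open (U x)" "x \<in> U x" for x
    unfolding U_def using open_cmap_vimage[OF chart[OF c(1)] open_ball] c(2) gd
    by (auto simp: a_def good_def)
  have "K \<subseteq> (\<Union>x\<in>K. U x)" using U(2) by blast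
  then obtain J where J: "J \<subseteq> K" "finite J" "K \<subseteq> (\<Union>x\<in>J. U x)"
    using compactE_image[OF compact_K, of K U] U(1) by blast
  obtain e where e: "bij_betw e {0..<card J} J" using ex_bij_betw_nat_finite[OF J(2)] by blast
  \<comment> \<open>\<open>disjointed\<close> makes the finite cover disjoint without leaving the
    coordinate balls.\<close>
  define B where "B i = K \<inter> disjointed (\<lambda>i. U (e i)) i" for i
  define d where "d = Min (insert \<epsilon> (\<delta> ` J))"
  have dpos: "\<delta> x > 0" for x using gd by (simp add: good_def)
  have d: "d > 0" "d \<le> \<epsilon>" "\<And>x. x \<in> J \<Longrightarrow> d \<le> \<delta> x" using J(2) eps dpos by (auto simp: d_def)
  have BU: "B i \<subseteq> U (e i)" for i using disjointed_subset[of "\<lambda>i. U (e i)" i] by (auto simp: B_def)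
  have "pieces d (card J) (c \<circ> e) (a \<circ> e) (r \<circ> e) B"
    unfolding pieces_def
  proof (intro conjI allI impI d(1,2))
    fix i assume "i < card J"
    then have eJ: "e i \<in> J" using e by (auto simp: bij_betw_def)
    show "good ((c \<circ> e) i) ((a \<circ> e) i) ((r \<circ> e) i) d"
      using good_mono[OF gd d(1) d(3)[OF eJ]] by simp
    have "K \<in> sets borel" by (rule borel_closed[OF compact_imp_closed[OF compact_K]])
    moreover have "disjointed (\<lambda>i. U (e i)) i \<in> sets borel"
      unfolding disjointed_def using U(1) by (auto intro!: sets.Diff sets.finite_UN borel_open)
    ultimately show "B i \<in> sets borel" by (simp add: B_def)
    show "B i \<subseteq> cdom ((c \<circ> e) i)" "cmap ((c \<circ> e) i) ` B i \<subseteq> ball ((a \<circ> e) i) ((r \<circ> e) i)"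
      using BU[of i] by (auto simp: U_def)
  next
    show "disjoint_family_on B {..<card J}"
      using disjoint_family_disjointed[of "\<lambda>i. U (e i)"] unfolding disjoint_family_on_def B_def by blast
    have "(\<Union>i<card J. disjointed (\<lambda>i. U (e i)) i) = (\<Union>i\<in>{0..<card J}. U (e i))"
      using finite_UN_disjointed_eq[of "\<lambda>i. U (e i)" "card J"] by (simp add: lessThan_atLeast0)
    also have "\<dots> = (\<Union>x\<in>e ` {0..<card J}. U x)" by simp
    also have "\<dots> = (\<Union>x\<in>J. U x)" by (simp only: bij_betw_imp_surj_on[OF e])
    finally show "(\<Union>i<card J. B i) = K" using J(3) by (auto simp: B_def)
  qed
  then show ?thesis by blast
qed

lemma pieces_mono:
  assumes "pieces \<delta> N c a r B" "0 < \<delta>'" "\<delta>' \<le> \<delta>"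
  shows "pieces \<delta>' N c a r B"
proof -
  have "good (c i) (a i) (r i) \<delta>'" if "i < N" for i
    by (rule good_mono[OF _ assms(2,3)]) (use assms(1) that in \<open>simp add: pieces_def\<close>)
  then show ?thesis using assms by (simp add: pieces_def)
qed

lemma piece_facts:
  assumes pc: "pieces \<delta> N c a r B" and i: "i < N" and t: "\<bar>t\<bar> < \<delta>"
  shows "c i \<in> A" "\<bar>t\<bar> < \<epsilon>" "cmap (c i) ` B i \<in> sets borel" "cmap (c i) ` B i \<subseteq> cball (a i) (r i)"
    "cball (a i) (r i) \<subseteq> cran (c i)" "continuous_on (cball (a i) (r i)) (\<lambda>y. dens (c i) (t, y))"
    "set_integrable lborel (cmap (c i) ` B i) (\<lambda>y. dens (c i) (t, y))"
proof -
  have gd: "good (c i) (a i) (r i) \<delta>" and B: "B i \<in> sets borel" "B i \<subseteq> cdom (c i)"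
    "cmap (c i) ` B i \<subseteq> ball (a i) (r i)"
    using pc i by (auto simp: pieces_def)
  show c: "c i \<in> A" and t\<epsilon>: "\<bar>t\<bar> < \<epsilon>" and sub: "cball (a i) (r i) \<subseteq> cran (c i)"
    using gd t by (auto simp: good_def)
  show b: "cmap (c i) ` B i \<in> sets borel" by (rule borel_cmap_image[OF chart[OF c] B(1,2)])
  show s: "cmap (c i) ` B i \<subseteq> cball (a i) (r i)" using B(3) ball_subset_cball by blast
  show k: "continuous_on (cball (a i) (r i)) (\<lambda>y. dens (c i) (t, y))"
    by (rule continuous_on_compose2[OF smooth_on_imp_continuous_on[OF smooth_dens[OF c]]])
       (use t\<epsilon> sub in \<open>auto intro!: continuous_intros simp: dom_iff\<close>)
  show "set_integrable lborel (cmap (c i) ` B i) (\<lambda>y. dens (c i) (t, y))"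
    by (rule set_integrable_continuous_compact[OF compact_cball b s k])
qed

lemma variation_volume_eq:
  assumes pc: "pieces \<delta> N c a r B" and t: "\<bar>t\<bar> < \<delta>"
  shows "variation_volume A p G K t = (\<Sum>i<N. LINT y:cmap (c i) ` B i|lborel. dens (c i) (t, y))"
proof -
  have v: "vol_density A (h t) (c i) y = dens (c i) (t, y)" if "i < N" "y \<in> cmap (c i) ` B i" for i y
    using piece_facts(1,2,4,5)[OF pc that(1) t] that(2) by (intro vol_density_h) auto
  have "vol_piece_integrable A (h t) (c i) (B i)" if "i < N" for i
    unfolding vol_piece_integrable_def
    using piece_facts(7)[OF pc that t] v[OF that] by (simp cong: set_integrable_cong)
  moreover have p: "vol_piece A (h t) (c i) (B i) = (LINT y:cmap (c i) ` B i|lborel. dens (c i) (t, y))"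
    if "i < N" for i
    unfolding vol_piece_def
    by (rule set_lebesgue_integral_cong) (use piece_facts(3)[OF pc that t] v[OF that] in auto)
  ultimately have "vol_decomp A (h t) K N c B"
    using pc piece_facts(1)[OF pc _ t] by (auto simp: vol_decomp_def pieces_def)
  moreover have "\<bar>t\<bar> < \<epsilon>" using pc t by (simp add: pieces_def)
  ultimately show ?thesis
    unfolding variation_volume_def using volume_eq[OF oriented riem_h] p by simp
qed


lemma variation_volume_derivatives:
  "\<exists>f' f'' \<delta>. \<delta> > 0 \<and> (\<forall>t. \<bar>t\<bar> < \<delta> \<longrightarrow>
     (variation_volume A p G K has_real_derivative f' t) (at t) \<and> (f' has_real_derivative f'' t) (at t))"
proof -
  obtain \<delta> N c a r B where pc: "pieces \<delta> N c a r B" using pieces_exist by blast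
  let ?S = "\<lambda>i. cmap (c i) ` B i"
  define f0 where "f0 t = (\<Sum>i<N. LINT y:?S i|lborel. dens (c i) (t, y))" for t
  define f1 where "f1 t = (\<Sum>i<N. LINT y:?S i|lborel. dir_deriv (1, 0) (dens (c i)) (t, y))" for t
  define f2 where "f2 t = (\<Sum>i<N. LINT y:?S i|lborel. dir_deriv (1, 0) (dir_deriv (1, 0) (dens (c i))) (t, y))" for t
  have \<delta>: "\<delta> > 0" "\<delta> \<le> \<epsilon>" using pc by (auto simp: pieces_def)
  have d0: "(f0 has_real_derivative f1 t) (at t)" and d1: "(f1 has_real_derivative f2 t) (at t)"
    if t: "\<bar>t\<bar> < \<delta>" for t
  proof -
    have sub: "{-\<delta><..<\<delta>} \<times> cball (a i) (r i) \<subseteq> dom (c i)" if "i < N" for i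
      using piece_facts(5)[OF pc that t] \<delta> by (auto simp: dom_def)
    show "(f0 has_real_derivative f1 t) (at t)"
      unfolding f0_def[abs_def] f1_def
    proof (rule DERIV_sum)
      fix i assume "i \<in> {..<N}"
      then have i: "i < N" by simp
      show "((\<lambda>t. LINT y:?S i|lborel. dens (c i) (t, y)) has_real_derivative
          (LINT y:?S i|lborel. dir_deriv (1, 0) (dens (c i)) (t, y))) (at t)"
        by (rule DERIV_integral_smooth[OF smooth_dens[OF piece_facts(1)[OF pc i t]] sub[OF i] compact_cball
              piece_facts(3)[OF pc i t] piece_facts(4)[OF pc i t] t])
    qed
    show "(f1 has_real_derivative f2 t) (at t)"
      unfolding f1_def[abs_def] f2_def
    proof (rule DERIV_sum)
      fix i assume "i \<in> {..<N}"
      then have i: "i < N" by simp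
      show "((\<lambda>t. LINT y:?S i|lborel. dir_deriv (1, 0) (dens (c i)) (t, y)) has_real_derivative
          (LINT y:?S i|lborel. dir_deriv (1, 0) (dir_deriv (1, 0) (dens (c i))) (t, y))) (at t)"
        by (rule DERIV_integral_smooth[OF smooth_on_dir_deriv[OF smooth_dens[OF piece_facts(1)[OF pc i t]]]
              sub[OF i] compact_cball piece_facts(3)[OF pc i t] piece_facts(4)[OF pc i t] t])
    qed
  qed
  have "(variation_volume A p G K has_real_derivative f1 t) (at t)" if t: "\<bar>t\<bar> < \<delta>" for t
  proof (rule has_field_derivative_transform_within_open[OF d0[OF t]])
    show "open {-\<delta><..<\<delta>}" "t \<in> {-\<delta><..<\<delta>}" using t by auto
    show "f0 s = variation_volume A p G K s" if "s \<in> {-\<delta><..<\<delta>}" for s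
      using variation_volume_eq[OF pc, of s] that by (simp add: f0_def abs_less_iff)
  qed
  then show ?thesis using d1 \<delta>(1) by blast
qed

text \<open>
  Since \<open>det (1 + \<sigma> W) \<le> 1\<close>, the volume is at most that of the tangential part \<open>\<psi> t\<close>, which
  is the volume of \<open>K\<close> by the change of variables \<open>\<psi> t\<close>.
\<close>

lemma variation_volume_le:
  assumes traceless: "\<And>c y. c \<in> A \<Longrightarrow> y \<in> cran c \<Longrightarrow> trace (W c y) = 0"
  shows "\<exists>\<delta>>0. \<forall>t. \<bar>t\<bar> < \<delta> \<longrightarrow> variation_volume A p G K t \<le> variation_volume A p G K 0"
proof -
  obtain \<delta>1 where \<delta>1: "\<delta>1 > 0" "\<delta>1 \<le> \<epsilon>" "\<And>t. \<bar>t\<bar> < \<delta>1 \<Longrightarrow> inj (\<psi> t) \<and> \<psi> t ` K = K"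
    using \<psi>_bijective by blast
  obtain \<delta>2 N c a r B where pc2: "pieces \<delta>2 N c a r B" using pieces_exist by blast
  define \<delta> where "\<delta> = min \<delta>1 \<delta>2"
  have "\<delta>2 > 0" using pc2 by (simp add: pieces_def)
  then have \<delta>: "\<delta> > 0" "\<delta> \<le> \<delta>1" "\<delta> \<le> \<delta>2" using \<delta>1(1) by (auto simp: \<delta>_def)
  have pc: "pieces \<delta> N c a r B" by (rule pieces_mono[OF pc2 \<delta>(1,3)])
  have 0: "\<bar>0\<bar> < \<delta>" using \<delta> by simp
  have vol0: "variation_volume A p G K 0 = volume A g K"
  proof -
    have d: "dens (c i) (0, y) = vol_density A g (c i) y" if "i < N" "y \<in> cmap (c i) ` B i" for i y
      using piece_facts(1,4,5)[OF pc that(1) 0] that(2) by (intro dens_0) auto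
    have e: "(LINT y:cmap (c i) ` B i|lborel. dens (c i) (0, y)) = vol_piece A g (c i) (B i)" if "i < N" for i
      unfolding vol_piece_def
      by (rule set_lebesgue_integral_cong) (use piece_facts(3)[OF pc that 0] d[OF that] in auto)
    have "vol_piece_integrable A g (c i) (B i)" if "i < N" for i
    proof -
      have "set_integrable lborel (cmap (c i) ` B i) (\<lambda>y. dens (c i) (0, y))
          \<longleftrightarrow> set_integrable lborel (cmap (c i) ` B i) (vol_density A g (c i))"
        by (rule set_integrable_cong[OF refl refl d[OF that]])
      then show ?thesis using piece_facts(7)[OF pc that 0] by (simp add: vol_piece_integrable_def)
    qed
    then have "vol_decomp A g K N c B"
      using pc piece_facts(1)[OF pc _ 0] unfolding vol_decomp_def pieces_def by blast
    then show ?thesis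
      using volume_eq[OF oriented riem] variation_volume_eq[OF pc 0] e by simp
  qed
  have "variation_volume A p G K t \<le> volume A g K" if t: "\<bar>t\<bar> < \<delta>" for t
  proof -
    have inj: "inj (\<psi> t)" and \<psi>K: "\<psi> t ` K = K" using \<delta>1(3)[of t] t \<delta> by auto
    have piece: "\<psi> t ` B i \<in> sets borel" "\<psi> t ` B i \<subseteq> cdom (c i)"
      "vol_piece_integrable A g (c i) (\<psi> t ` B i)"
      "(LINT y:cmap (c i) ` B i|lborel. dens (c i) (t, y)) \<le> vol_piece A g (c i) (\<psi> t ` B i)"
      if i: "i < N" for i
    proof -
      let ?c = "c i" and ?S = "cmap (c i) ` B i" and ?C = "cball (a i) (r i)" and ?b = "ball (a i) (r i)"
      let ?f = "\<lambda>y. f (c i) (t, y)"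
      note pf = piece_facts[OF pc i t]
      note ch = chart[OF pf(1)]
      have gd: "good ?c (a i) (r i) \<delta>" and B: "B i \<subseteq> cdom ?c" "?S \<subseteq> ?b"
        using pc i by (auto simp: pieces_def)
      have fd: "(t, y) \<in> fdom ?c" and small: "(\<sigma> ?c (t, y))\<^sup>2 * trace (W ?c (?f y) ** W ?c (?f y)) < 1"
        if "y \<in> ?C" for y
        using gd t that by (auto simp: good_def)
      have injf: "inj_on ?f ?C" using gd t by (simp add: good_def)
      have cf: "continuous_on ?C ?f"
        by (rule continuous_on_compose2[OF smooth_on_imp_continuous_on[OF smooth_f[OF pf(1)]]])
           (use fd in \<open>auto intro!: continuous_intros\<close>)
      have cg: "continuous_on (cran ?c) (vol_density A g ?c)"
      proof -
        have "smooth_on (cran ?c) (\<lambda>y. sqrt (det (H ?c y)))"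
          by (intro smooth_on_sqrt smooth_on_det open_cran ch smooth_on_H det_H_pos pf(1))
        then show ?thesis
          by (rule continuous_on_eq[OF smooth_on_imp_continuous_on]) (simp add: vol_density_g[OF pf(1)])
      qed
      have fC: "?f ` ?C \<subseteq> cran ?c" using f_in_cran fd by blast
      have fS: "cmap ?c ` \<psi> t ` B i = ?f ` ?S"
        using B(1) cinv_cmap[OF ch] by (force simp: f_def image_image subset_iff)
      show \<psi>B: "\<psi> t ` B i \<subseteq> cdom ?c"
      proof
        fix z assume "z \<in> \<psi> t ` B i"
        then obtain x where x: "x \<in> B i" "z = \<psi> t x" by blast
        then have "(t, cmap ?c x) \<in> fdom ?c" using fd pf(4) by blast
        then show "z \<in> cdom ?c" using x B(1) cinv_cmap[OF ch] by (auto simp: fdom_def)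
      qed
      have bS: "?f ` ?S \<in> sets borel"
        by (rule borel_injective_image[OF open_ball continuous_on_subset[OF cf ball_subset_cball]
              inj_on_subset[OF injf ball_subset_cball] pf(3) B(2)])
      \<comment> \<open>Measurability is obtained in coordinates, where
        \<open>borel_injective_image\<close> applies, and pulled back by the chart.\<close>
      have "\<psi> t ` B i = cdom ?c \<inter> cmap ?c -` (?f ` ?S)"
        using \<psi>B inj_on_cmap[OF ch] unfolding fS[symmetric] inj_on_def by blast
      then show "\<psi> t ` B i \<in> sets borel"
        using borel_vimage_continuous_on[OF continuous_on_cmap[OF ch] _ bS] open_cdom[OF ch] by simp
      have iS: "set_integrable lborel (?f ` ?S) (vol_density A g ?c)"
        by (rule set_integrable_continuous_compact[OF compact_continuous_image[OF cf compact_cball] bS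
              image_mono[OF pf(4)] continuous_on_subset[OF cg fC]])
      then show "vol_piece_integrable A g ?c (\<psi> t ` B i)" by (simp add: vol_piece_integrable_def fS)
      let ?D = "\<lambda>y. \<bar>det (Df ?c (t, y))\<bar> * vol_density A g ?c (?f y)"
      have der: "(?f has_derivative (\<lambda>u. dir_deriv (0, u) (f ?c) (t, y))) (at y)" if "y \<in> ?C" for y
      proof -
        have df: "f ?c differentiable (at (t, y))"
          by (rule smooth_on_differentiable[OF smooth_f[OF pf(1)] fd[OF that]])
        have "((\<lambda>y. (t, y)) has_derivative (\<lambda>u. (0, u))) (at y)" by (auto intro!: derivative_eq_intros)
        from diff_chain_at[OF this has_derivative_frechet[OF df]] show ?thesis by (simp add: o_def)
      qed
      have "continuous_on ?C (\<lambda>y. \<bar>det (Df ?c (t, y))\<bar>)"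
      proof -
        have "continuous_on ?C (\<lambda>y. dir_deriv (0, u) (f ?c) (t, y) $ k)" for u k
          by (intro continuous_on_component continuous_on_compose2[OF
                smooth_on_imp_continuous_on[OF smooth_on_dir_deriv[OF smooth_f[OF pf(1)]]]])
             (use fd in \<open>auto intro!: continuous_intros\<close>)
        then show ?thesis
          unfolding Df_def matrix_def det_def vec_lambda_beta
          by (intro continuous_on_rabs continuous_on_sum continuous_on_mult continuous_on_prod continuous_on_const)
      qed
      moreover have "continuous_on ?C (\<lambda>y. vol_density A g ?c (?f y))"
        by (rule continuous_on_compose2[OF cg cf fC])
      ultimately have "continuous_on ?C ?D" by (rule continuous_on_mult)
      then have iD: "set_integrable lborel ?S ?D"
        by (rule set_integrable_continuous_compact[OF compact_cball pf(3,4)])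
      have cov: "set_lebesgue_integral lborel (?f ` ?S) (vol_density A g ?c) = set_lebesgue_integral lborel ?S ?D"
        unfolding Df_def
      proof (rule change_of_variables_lborel[OF pf(3) der _ iS])
        show "inj_on ?f ?S" by (rule inj_on_subset[OF injf pf(4)])
        show "set_integrable lborel ?S (\<lambda>y. \<bar>det (matrix (\<lambda>u. dir_deriv (0, u) (f ?c) (t, y)))\<bar> *
            vol_density A g ?c (?f y))"
          using iD by (simp only: Df_def)
      qed (use pf(4) in blast)
      \<comment> \<open>Smallness of the height makes the determinant positive, which removes the
        absolute value; tracelessness bounds it by 1.\<close>
      have le: "dens ?c (t, y) \<le> ?D y" if "y \<in> ?S" for y
      proof -
        have yC: "y \<in> ?C" using that pf(4) by blast
        note z = f_in_cran[OF fd[OF yC]]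
        have "\<bar>det (mat 1 + \<sigma> ?c (t, y) *\<^sub>R W ?c (?f y))\<bar> \<le> 1"
          using det_1_W_pos[OF pf(1) z small[OF yC]] det_1_W_le_1[OF pf(1) z small[OF yC] traceless[OF pf(1) z]]
          by simp
        moreover have "vol_density A g ?c (?f y) \<ge> 0"
          using det_H_pos[OF pf(1) z] by (simp add: vol_density_g[OF pf(1) z])
        ultimately show ?thesis
          unfolding dens_formula[OF pf(1) fd[OF yC]]
          by (intro mult_left_mono mult_left_le_one_le) auto
      qed
      have "(LINT y:?S|lborel. dens ?c (t, y)) \<le> set_lebesgue_integral lborel ?S ?D"
        by (rule set_integral_mono[OF pf(7) iD le])
      also have "\<dots> = vol_piece A g ?c (\<psi> t ` B i)" by (simp add: vol_piece_def fS cov)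
      finally show "(LINT y:?S|lborel. dens ?c (t, y)) \<le> vol_piece A g ?c (\<psi> t ` B i)" .
    qed
    have "disjoint_family_on (\<lambda>i. \<psi> t ` B i) {..<N}"
      using pc inj unfolding pieces_def disjoint_family_on_def inj_on_def by blast
    moreover have "(\<Union>i<N. \<psi> t ` B i) = K"
    proof -
      have "(\<Union>i<N. \<psi> t ` B i) = \<psi> t ` (\<Union>i<N. B i)" by blast
      then show ?thesis using pc \<psi>K by (simp add: pieces_def)
    qed
    \<comment> \<open>\<psi> permutes K, so the images of the pieces decompose K again, in the same
      charts.\<close>
    ultimately have "vol_decomp A g K N c (\<lambda>i. \<psi> t ` B i)"
      using piece piece_facts(1)[OF pc _ t] unfolding vol_decomp_def by blast
    then have "volume A g K = (\<Sum>i<N. vol_piece A g (c i) (\<psi> t ` B i))"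
      by (rule volume_eq[OF oriented riem])
    then show ?thesis
      unfolding variation_volume_eq[OF pc t] by (auto intro!: sum_mono piece(4))
  qed
  then show ?thesis using \<delta>(1) vol0 by auto
qed

lemma variation_volume_stationary:
  assumes "\<And>c y. c \<in> A \<Longrightarrow> y \<in> cran c \<Longrightarrow> trace (W c y) = 0"
  shows "(variation_volume A p G K has_real_derivative 0) (at 0)"
    and "\<exists>D. has_second_real_derivative (variation_volume A p G K) D 0 \<and> D \<le> 0"
proof -
  obtain f' f'' \<delta> where d: "\<delta> > 0"
    "\<And>t. \<bar>t\<bar> < \<delta> \<Longrightarrow> (variation_volume A p G K has_real_derivative f' t) (at t)"
    "\<And>t. \<bar>t\<bar> < \<delta> \<Longrightarrow> (f' has_real_derivative f'' t) (at t)"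
    using variation_volume_derivatives by blast
  obtain \<delta>' where m: "\<delta>' > 0"
    "\<And>t. \<bar>t\<bar> < \<delta>' \<Longrightarrow> variation_volume A p G K t \<le> variation_volume A p G K 0"
    using variation_volume_le[OF assms] by blast
  have e: "\<forall>\<^sub>F t in nhds 0. (variation_volume A p G K has_real_derivative f' t) (at t)"
    using d unfolding eventually_nhds_metric by (auto simp: dist_real_def)
  have "\<forall>\<^sub>F t in nhds 0. variation_volume A p G K t \<le> variation_volume A p G K 0"
    using m unfolding eventually_nhds_metric by (auto simp: dist_real_def)
  note max = second_derivative_at_max[OF e d(3)[of 0] this]
  show "(variation_volume A p G K has_real_derivative 0) (at 0)"
    using d(2)[of 0] max(1) d(1) by simp
  show "\<exists>D. has_second_real_derivative (variation_volume A p G K) D 0 \<and> D \<le> 0"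
    using e d(3)[of 0] max(2) d(1) unfolding has_second_real_derivative_def
    by (intro exI[of _ "f'' 0"]) auto
qed

end

section \<open>Normal variations\<close>

context immersed
begin

lemma gram_pos:
  assumes c: "c \<in> A" and y: "y \<in> cran c" and N: "det (mat 1 + s *\<^sub>R W c y) \<noteq> 0" and u: "u \<noteq> 0"
  shows "u \<bullet> (gram c s y *v u) > 0"
proof -
  let ?N = "mat 1 + s *\<^sub>R W c y"
  interpret pt: light_cone_patch "cran c" "P c" by (rule light_cone_patch_P[OF c])
  have "transpose ?N *v u \<noteq> 0"
  proof
    assume "transpose ?N *v u = 0"
    moreover have "invertible (transpose ?N)" using N by (simp add: invertible_det_nz det_transpose)
    ultimately show False
      using u matrix_left_invertible_ker[of "transpose ?N"] invertible_left_inverse[of "transpose ?N"] by blast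
  qed
  then have "(transpose ?N *v u) \<bullet> (H c y *v (transpose ?N *v u)) > 0"
    using pt.H_form[OF y] pt.spacelike[OF y] by (simp add: H_def)
  moreover have "(transpose ?N *v u) \<bullet> (H c y *v (transpose ?N *v u)) = u \<bullet> (gram c s y *v u)"
    by (simp only: gram_def transpose_matrix_vector dot_lmul_matrix matrix_vector_mul_assoc[symmetric])
  ultimately show ?thesis by simp
qed

text \<open>The derivative of s contributes only a multiple of the null direction Q, so the graph of
  s has at y the Gram matrix of the leaf of constant height \<open>s y\<close>.\<close>

lemma lorentz_normal_graph:
  assumes c: "c \<in> A" and y: "y \<in> cran c" and s: "s differentiable (at y)"
  shows "lorentz (dir_deriv u (\<lambda>z. P c z + s z *\<^sub>R Q c z) y) (dir_deriv v (\<lambda>z. P c z + s z *\<^sub>R Q c z) y)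
    = u \<bullet> (gram c (s y) y *v v)"
proof -
  interpret pt: dual_patch "cran c" "P c" "Q c" by (rule dual_patch_P_Q[OF c])
  let ?X = "\<lambda>u. dir_deriv u (P c) y + s y *\<^sub>R dir_deriv u (Q c) y"
  note dP = pt.diff_P[OF y] and dQ = pt.diff_Q[OF y]
  have d: "dir_deriv u (\<lambda>z. P c z + s z *\<^sub>R Q c z) y = ?X u + dir_deriv u s y *\<^sub>R Q c y" for u
    using dir_deriv_add[OF dP differentiable_scaleR[OF s dQ]]
      dir_deriv_bilinear[OF bounded_bilinear_scaleR s dQ] by simp
  have XQ: "lorentz (?X u) (Q c y) = 0" for u
    using pt.lorentz_dP_Q[OF y] pt.lorentz_F_Q[OF y]
    by (simp add: lorentz.add_left lorentz.scaleR_left pt.dir_deriv_Q[OF y] lorentz.sum_left)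
  have QX: "lorentz (Q c y) (?X u) = 0" for u using XQ lorentz_commute by metis
  have QQ: "lorentz (Q c y) (Q c y) = 0" by (rule pt.null_Q[OF y])
  show ?thesis
    unfolding d gram_form[OF c y] lorentz.add_left[of "?X u"] lorentz.add_right[of _ "?X v"]
      lorentz.scaleR_left[of "dir_deriv u s y"] lorentz.scaleR_right[of _ "dir_deriv v s y"] XQ QX QQ by simp
qed

text \<open>The induced tensor is positive definite as long as 1 + t \<eta> W is invertible. Off the
  domain of c the function \<eta> vanishes and this matrix is the identity.\<close>

lemma normal_variation:
  fixes \<eta> :: "'m \<Rightarrow> real"
  assumes c: "c \<in> A" and eps: "\<epsilon> > 0"
    and near: "\<And>x. smooth_near A x \<eta>"
    and zero: "\<And>x. x \<notin> cdom c \<Longrightarrow> \<eta> x = 0"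
    and nz: "\<And>t x. \<bar>t\<bar> < \<epsilon> \<Longrightarrow> x \<in> cdom c \<Longrightarrow> det (mat 1 + (t * \<eta> x) *\<^sub>R W c (cmap c x)) \<noteq> 0"
  shows "variation A p \<epsilon> (\<lambda>t x. (t * \<eta> x, x))"
proof -
  let ?G = "\<lambda>t x. (t * \<eta> x, x)"
  have sm: "smooth_on (cran d) (\<lambda>y. t * \<eta> (cinv d y))" if d: "d \<in> A" for d t
    by (intro smooth_on_mult smooth_on_const open_cran chart d smooth_on_chart near)
  have nearF: "smooth_near A x (\<lambda>x. \<Phi> (?G t x))" for t x
  proof -
    let ?d = "chart_at A x"
    note d = chart_at_props[OF A, of x]
    interpret pt: dual_patch "cran ?d" "P ?d" "Q ?d" by (rule dual_patch_P_Q[OF d(1)])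
    have "smooth_on (cran ?d) (\<lambda>y. P ?d y + (t * \<eta> (cinv ?d y)) *\<^sub>R Q ?d y)"
      by (intro smooth_on_add smooth_on_scaleR pt.open_U pt.smooth_P pt.smooth_Q sm d(1))
    then have "smooth_at (\<lambda>y. \<Phi> (?G t (cinv ?d y))) (cmap ?d x)"
      using cmap_in_cran[OF d(2)] pt.open_U
      by (intro smooth_atI[of "cran ?d"]) (auto simp: \<Phi>_def P_def Q_def)
    then show ?thesis by (simp only: smooth_near_iff[OF A d])
  qed
  have "riemannian_metric A (variation_metric A p ?G t)" if t: "\<bar>t\<bar> < \<epsilon>" for t
    unfolding riemannian_metric_def variation_metric_eq
  proof (intro conjI allI ballI impI)
    let ?F = "\<lambda>x. \<Phi> (?G t x)"
    show "lorentz (vdiff ?F X) (vdiff ?F Y) = lorentz (vdiff ?F Y) (vdiff ?F X)" for X Y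
      by (rule lorentz_commute)
    show "lorentz (vdiff ?F (\<lambda>f. a * X f + b * Y f)) (vdiff ?F Z)
        = a * lorentz (vdiff ?F X) (vdiff ?F Z) + b * lorentz (vdiff ?F Y) (vdiff ?F Z)" for X Y Z a b
      by (simp add: vdiff_linear_comb lorentz.add_left lorentz.scaleR_left)
    fix x X assume X: "X \<in> tangent_space A x" "X \<noteq> (\<lambda>_. 0)"
    \<comment> \<open>Prefers c, for which \<open>nz\<close> is stated; elsewhere \<eta> vanishes at
      x and any chart serves.\<close>
    define d where "d = (if x \<in> cdom c then c else chart_at A x)"
    have d: "d \<in> A" "x \<in> cdom d" using c chart_at_props[OF A] by (auto simp: d_def)
    obtain u where u: "X = coord_vector A d x u" using X(1) unfolding tangent_space_chart[OF A d] by blast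
    then have "u \<noteq> 0" using X(2) coord_vector_eq_0_iff[OF A d] by simp
    let ?y = "cmap d x"
    note y = cmap_in_cran[OF d(2)] and ci = cinv_cmap[OF chart[OF d(1)] d(2)]
    have n: "det (mat 1 + (t * \<eta> x) *\<^sub>R W d ?y) \<noteq> 0"
    proof (cases "x \<in> cdom c")
      case True
      then show ?thesis using nz[OF t True] by (simp add: d_def)
    qed (simp add: zero)
    have "vdiff ?F X = dir_deriv u (\<lambda>z. P d z + (t * \<eta> (cinv d z)) *\<^sub>R Q d z) ?y"
      unfolding u vdiff_coord_vector[OF A d nearF] by (simp add: \<Phi>_def P_def Q_def)
    then have "lorentz (vdiff ?F X) (vdiff ?F X) = u \<bullet> (gram d (t * \<eta> (cinv d ?y)) ?y *v u)"
      using lorentz_normal_graph[OF d(1) y smooth_on_differentiable[OF sm[OF d(1)] y]] by simp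
    then show "lorentz (vdiff ?F X) (vdiff ?F X) > 0"
      using gram_pos[OF d(1) y _ \<open>u \<noteq> 0\<close>] n by (simp add: ci)
  next
    fix d u v assume d: "d \<in> A"
    let ?F = "\<lambda>x. \<Phi> (?G t x)"
    have s: "smooth_on (cran d) (\<lambda>y. ?F (cinv d y))" by (rule smooth_on_chart[OF d nearF])
    show "smooth_on (cran d) (\<lambda>y. lorentz (vdiff ?F (coord_vector A d (cinv d y) u))
        (vdiff ?F (coord_vector A d (cinv d y) v)))"
      by (rule smooth_on_cong[OF open_cran[OF chart[OF d]] smooth_on_bilinear[OF open_cran[OF chart[OF d]]
              bounded_bilinear_lorentz smooth_on_dir_deriv[OF s] smooth_on_dir_deriv[OF s]]])
         (simp add: vdiff_chart[OF d nearF])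
  qed
  moreover have "smooth_map_on LA LA ({-\<epsilon><..<\<epsilon>} \<times> UNIV) (\<lambda>(t, x). ?G t x)"
    unfolding smooth_map_on_def
  proof
    fix z assume z: "z \<in> {-\<epsilon><..<\<epsilon>} \<times> (UNIV :: 'm set)"
    obtain t x where tx: "z = (t, x)" by (cases z)
    let ?d = "chart_at A x"
    note d = chart_at_props[OF A, of x] and ch = chart[OF chart_at_props(1)[OF A, of x]]
    let ?l = "line_chart ?d" and ?V = "{-\<epsilon><..<\<epsilon>} \<times> cdom ?d"
    have o: "open ({-\<epsilon><..<\<epsilon>} \<times> cran ?d)" by (intro open_Times open_greaterThanLessThan open_cran ch)
    have im: "cmap ?l ` ?V = {-\<epsilon><..<\<epsilon>} \<times> cran ?d" by (force simp: cmap_line cran_def)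
    have s: "smooth_on ({-\<epsilon><..<\<epsilon>} \<times> cran ?d) (\<lambda>w. \<eta> (cinv ?d (snd w)))"
      by (rule smooth_on_compose[OF o open_cran[OF ch] _ smooth_on_chart[OF d(1) near]
            smooth_on_bounded_linear[OF bounded_linear_snd]]) auto
    have "smooth_on ({-\<epsilon><..<\<epsilon>} \<times> cran ?d) (\<lambda>w. (fst w * \<eta> (cinv ?d (snd w)), snd w))"
      by (intro smooth_on_Pair o smooth_on_mult s smooth_on_bounded_linear[OF bounded_linear_fst]
          smooth_on_bounded_linear[OF bounded_linear_snd])
    then have "smooth_on (cmap ?l ` ?V) (cmap ?l \<circ> (\<lambda>(t, x). ?G t x) \<circ> cinv ?l)"
      unfolding im by (rule smooth_on_cong[OF o]) (auto simp: cinv_line[OF ch] cmap_line cmap_cinv[OF ch])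
    moreover have "open ?V" by (intro open_Times open_greaterThanLessThan open_cdom ch)
    ultimately show "\<exists>c\<in>LA. \<exists>d\<in>LA. \<exists>V. open V \<and> z \<in> V \<and> V \<subseteq> {-\<epsilon><..<\<epsilon>} \<times> UNIV \<inter> cdom c \<and>
        (\<lambda>(t, x). ?G t x) ` V \<subseteq> cdom d \<and> smooth_on (cmap c ` V) (cmap d \<circ> (\<lambda>(t, x). ?G t x) \<circ> cinv c)"
      using z d(2) line_chart_LA[OF d(1)]
      by (intro bexI[of _ ?l] exI[of _ ?V] conjI) (auto simp: cdom_line tx)
  qed
  ultimately show ?thesis
    unfolding variation_def using eps by (auto simp: abs_less_iff)
qed

text \<open>The image of C in the manifold is compact, hence closed in the Hausdorff space; a point
  outside the chart domain therefore has a neighbourhood on which the extension by 0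
  vanishes.\<close>

lemma smooth_near_cutoff:
  assumes c: "c \<in> A" and \<eta>: "smooth_on UNIV \<eta>" and C: "compact C" "C \<subseteq> cran c"
    and zero: "\<And>y. y \<notin> C \<Longrightarrow> \<eta> y = 0"
  shows "smooth_near A x (\<lambda>x. if x \<in> cdom c then \<eta> (cmap c x) else (0 :: real))"
proof -
  note ch = chart[OF c]
  show ?thesis
  proof (cases "x \<in> cdom c")
    case True
    have "smooth_at \<eta> (cmap c x)" by (rule smooth_atI[OF _ _ \<eta>]) auto
    then have "smooth_at (\<lambda>y. if cinv c y \<in> cdom c then \<eta> (cmap c (cinv c y)) else 0) (cmap c x)"
      by (rule smooth_at_cong[OF _ open_cran[OF ch] cmap_in_cran[OF True]])
         (simp add: cinv_in_cdom[OF ch] cmap_cinv[OF ch])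
    then show ?thesis by (simp only: smooth_near_iff[OF A c True])
  next
    case False
    let ?d = "chart_at A x"
    note d = chart_at_props[OF A, of x] and dh = chart[OF chart_at_props(1)[OF A, of x]]
    let ?K = "cinv c ` C"
    have "compact ?K"
      by (rule compact_continuous_image[OF continuous_on_subset[OF continuous_on_cinv[OF ch] C(2)] C(1)])
    then have o: "open (cmap ?d ` (cdom ?d - ?K))"
      by (intro open_cmap_image dh open_Diff open_cdom compact_imp_closed) auto
    have "x \<notin> ?K" using False C(2) cinv_in_cdom[OF ch] by auto
    then have m: "cmap ?d x \<in> cmap ?d ` (cdom ?d - ?K)" using d(2) by blast
    have k0: "(if z \<in> cdom c then \<eta> (cmap c z) else 0) = 0" if "z \<notin> ?K" for z
      using that zero[of "cmap c z"] cinv_cmap[OF ch, of z] by (metis image_eqI)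
    have e: "(if cinv ?d y \<in> cdom c then \<eta> (cmap c (cinv ?d y)) else 0) = 0"
      if "y \<in> cmap ?d ` (cdom ?d - ?K)" for y
    proof -
      obtain z where z: "z \<in> cdom ?d" "z \<notin> ?K" "y = cmap ?d z" using \<open>y \<in> _\<close> by blast
      show ?thesis unfolding z(3) cinv_cmap[OF dh z(1)] by (rule k0[OF z(2)])
    qed
    have "smooth_at (\<lambda>y. 0 :: real) (cmap ?d x)" by (rule smooth_atI[of UNIV]) (auto simp: smooth_on_const)
    then have "smooth_at (\<lambda>y. if cinv ?d y \<in> cdom c then \<eta> (cmap c (cinv ?d y)) else 0) (cmap ?d x)"
      by (rule smooth_at_cong[OF _ o m]) (rule e)
    then show ?thesis by (simp only: smooth_near_iff[OF A d])
  qed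
qed

text \<open>The determinant is 1 at s = 0; continuity and compactness of C make the admissible range
  of s uniform.\<close>

lemma det_1_W_nonzero_uniform:
  assumes c: "c \<in> A" and C: "compact C" "C \<subseteq> cran c"
  shows "\<exists>\<epsilon>>0. \<forall>s. \<bar>s\<bar> < \<epsilon> \<longrightarrow> (\<forall>y\<in>C. det (mat 1 + s *\<^sub>R W c y) \<noteq> 0)"
proof (rule compact_uniform_time[OF C(1)])
  fix y assume "y \<in> C"
  then have y: "y \<in> cran c" using C by auto
  let ?D = "UNIV \<times> cran c :: (real \<times> (real ^ 'n)) set"
  let ?N = "\<lambda>w. det (mat 1 + fst w *\<^sub>R W c (snd w))"
  have o: "open ?D" by (simp add: open_Times open_cran[OF chart[OF c]])
  have "continuous_on ?D (\<lambda>w. (mat 1 + fst w *\<^sub>R W c (snd w)) $ i $ j)" for i j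
  proof -
    have "continuous_on ?D (\<lambda>w. W c (snd w) $ i $ j)"
      by (rule continuous_on_compose2[OF smooth_on_imp_continuous_on[OF smooth_on_W[OF c]]])
         (auto intro!: continuous_intros)
    then show ?thesis by (simp, intro continuous_on_add continuous_on_mult continuous_on_const continuous_on_fst continuous_on_id)
  qed
  then have "continuous_on ?D ?N"
    unfolding det_def by (intro continuous_on_sum continuous_on_mult continuous_on_prod continuous_on_const)
  then have "\<forall>B. open B \<longrightarrow> open (?N -` B \<inter> ?D)" by (simp only: continuous_on_open_vimage[OF o])
  from this[rule_format, OF open_Compl[OF closed_singleton[of 0]]]
  have op: "open (?D \<inter> ?N -` (- {0}))" by (simp only: Int_commute)
  have "(0, y) \<in> ?D \<inter> ?N -` (- {0})" using y by simp
  then obtain V \<delta> where V: "open V" "y \<in> V" "\<delta> > 0"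
    "\<And>t z. \<bar>t\<bar> < \<delta> \<Longrightarrow> z \<in> V \<Longrightarrow> (t, z) \<in> ?D \<inter> ?N -` (- {0})"
    using eventually_time_nhds[OF op] by blast
  have "det (mat 1 + t *\<^sub>R W c z) \<noteq> 0" if "\<bar>t\<bar> < \<delta>" "z \<in> V" for t z
    using V(4)[OF that] by simp
  then show "\<exists>V \<delta>. open V \<and> y \<in> V \<and> \<delta> > 0 \<and> (\<forall>t. \<bar>t\<bar> < \<delta> \<longrightarrow> (\<forall>z\<in>V. det (mat 1 + t *\<^sub>R W c z) \<noteq> 0))"
    using V(1-3) by blast
qed

end

text \<open>A zero integral would make u vanish almost everywhere on the ball, and the open ball
  would be a null set.\<close>

lemma set_integral_pos:
  fixes u :: "'a::euclidean_space \<Rightarrow> real"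
  assumes "set_integrable lborel (cball a r) u" "r > 0"
    "\<And>y. y \<in> cball a r \<Longrightarrow> u y \<ge> 0" "\<And>y. y \<in> ball a r \<Longrightarrow> u y > 0"
  shows "set_lebesgue_integral lborel (cball a r) u \<noteq> 0"
proof
  assume "set_lebesgue_integral lborel (cball a r) u = 0"
  then have "AE y in lborel. indicat_real (cball a r) y *\<^sub>R u y = 0"
    using assms(1,3) unfolding set_lebesgue_integral_def set_integrable_def
    by (subst (asm) integral_nonneg_eq_0_iff_AE) (auto simp: indicator_def)
  then have "AE y in lborel. y \<notin> ball a r"
  proof eventually_elim
    case (elim y)
    show ?case
    proof
      assume y: "y \<in> ball a r"
      then have "y \<in> cball a r" by simp
      then show False using elim assms(4)[OF y] by (simp add: indicator_def)
    qed
  qed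
  then have "ball a r \<in> null_sets lborel" by (subst AE_iff_null_sets) auto
  then have "measure lborel (ball a r) = 0" by (simp add: measure_eq_0_null_sets)
  then show False using content_ball_pos[OF assms(2), of a] by simp
qed

section \<open>The first variation in the null direction\<close>

locale normal_variation = varied A g p \<epsilon> "\<lambda>t x. (t * \<eta> x, x)" K
  for A :: "('m::{t2_space, second_countable_topology}, real ^ 'n::finite) chart set"
    and g :: "'m tensor2" and p :: "'m \<Rightarrow> 'n minkowski" and \<epsilon> :: real and \<eta> :: "'m \<Rightarrow> real" and K :: "'m set"
begin

text \<open>The tangential part is the identity, so the Jacobian factor in
  \<open>dens_formula\<close> is 1.\<close>

lemma dens_normal:
  assumes c: "c \<in> A" and t: "\<bar>t\<bar> < \<epsilon>" and y: "y \<in> cran c"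
  shows "dens c (t, y) = \<bar>det (mat 1 + t *\<^sub>R (\<eta> (cinv c y) *\<^sub>R W c y))\<bar> * vol_density A g c y"
proof -
  have w: "(t, y) \<in> fdom c" using t y cinv_in_cdom[OF chart[OF c]] by (simp add: fdom_def dom_iff)
  have fy: "f c (t, z) = z" if "z \<in> cran c" for z using cmap_cinv[OF chart[OF c] that] by (simp add: f_def)
  have "dir_deriv (0, u) (f c) (t, y) = u" for u
  proof -
    have "dir_deriv (0, u) (f c) (t, y) = dir_deriv u (\<lambda>z. f c (t, z)) y"
      by (rule dir_deriv_snd[symmetric, OF smooth_on_differentiable[OF smooth_f[OF c] w]])
    also have "\<dots> = dir_deriv u (\<lambda>z. z) y"
      by (rule dir_deriv_cong_open[OF open_cran[OF chart[OF c]] fy y])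
    finally show ?thesis by simp
  qed
  then have "Df c (t, y) = mat 1" by (simp add: Df_def matrix_def mat_def axis_def vec_eq_iff)
  then show ?thesis using dens_formula[OF c w] by (simp add: fy[OF y] \<sigma>_def)
qed

lemma time_derivative_dens:
  assumes c: "c \<in> A" and y: "y \<in> cran c"
  shows "dir_deriv (1, 0) (dens c) (0, y) = \<eta> (cinv c y) * trace (W c y) * vol_density A g c y"
proof (rule DERIV_unique)
  show "((\<lambda>t. dens c (t, y)) has_real_derivative dir_deriv (1, 0) (dens c) (0, y)) (at 0)"
    by (rule smooth_on_time_derivative[OF smooth_dens[OF c]]) (use eps y in \<open>simp add: dom_iff\<close>)
  let ?D = "\<eta> (cinv c y) *\<^sub>R W c y"
  let ?d = "\<lambda>t. det (mat 1 + t *\<^sub>R ?D)"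
  have dd: "(?d has_real_derivative trace ?D) (at 0)" by (rule DERIV_det_identity)
  have "?d \<midarrow>0\<rightarrow> ?d 0" using DERIV_isCont[OF dd] by (simp only: isCont_def)
  then have "\<forall>\<^sub>F t in at 0. ?d t > 0" by (rule order_tendstoD(1)) simp
  then have "\<forall>\<^sub>F t in nhds 0. ?d t > 0" by (simp add: eventually_nhds_conv_at)
  moreover have "\<forall>\<^sub>F t in nhds 0. \<bar>t\<bar> < \<epsilon>"
    unfolding eventually_nhds_metric using eps by (auto simp: dist_real_def)
  ultimately have e: "\<forall>\<^sub>F t in nhds 0. dens c (t, y) = ?d t * vol_density A g c y"
    by eventually_elim (simp add: dens_normal[OF c _ y])
  have "((\<lambda>t. ?d t * vol_density A g c y) has_real_derivative trace ?D * vol_density A g c y) (at 0)"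
    by (rule DERIV_cmult_right[OF dd])
  moreover have "trace ?D = \<eta> (cinv c y) * trace (W c y)" by (simp add: trace_def sum_distrib_left)
  ultimately show "((\<lambda>t. dens c (t, y)) has_real_derivative
      \<eta> (cinv c y) * trace (W c y) * vol_density A g c y) (at 0)"
    using DERIV_cong_ev[OF refl e refl] by simp
qed

text \<open>K lies in the domain of one chart, so a one-piece decomposition computes the volume for
  all small t.\<close>

lemma DERIV_volume_normal:
  assumes c: "c \<in> A" and C: "compact C" "C \<subseteq> cran c" and K: "K = cinv c ` C"
  shows "(variation_volume A p (\<lambda>t x. (t * \<eta> x, x)) K has_real_derivative
    (LINT y:C|lborel. \<eta> (cinv c y) * trace (W c y) * vol_density A g c y)) (at 0)"
proof -
  note ch = chart[OF c]
  have im: "cmap c ` K = C" using C(2) cmap_cinv[OF ch] by (force simp: K image_image subset_iff)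
  have Kc: "K \<subseteq> cdom c" using C(2) cinv_in_cdom[OF ch] by (auto simp: K)
  have bC: "C \<in> sets borel" by (rule borel_compact[OF C(1)])
  have sub: "{-\<epsilon><..<\<epsilon>} \<times> C \<subseteq> dom c" using C(2) by (auto simp: dom_def)
  have vol: "variation_volume A p (\<lambda>t x. (t * \<eta> x, x)) K t = (LINT y:C|lborel. dens c (t, y))"
    if t: "\<bar>t\<bar> < \<epsilon>" for t
  proof -
    have d: "vol_density A (h t) c y = dens c (t, y)" if "y \<in> C" for y
      using vol_density_h[OF t c] C(2) that by blast
    have k: "continuous_on C (\<lambda>y. dens c (t, y))"
      by (rule continuous_on_compose2[OF smooth_on_imp_continuous_on[OF smooth_dens[OF c]]])
         (use t C(2) in \<open>auto intro!: continuous_intros simp: dom_iff\<close>)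
    have "set_integrable lborel C (\<lambda>y. dens c (t, y))"
      by (rule set_integrable_continuous_compact[OF C(1) bC order_refl k])
    moreover have "set_integrable lborel C (vol_density A (h t) c)
        \<longleftrightarrow> set_integrable lborel C (\<lambda>y. dens c (t, y))"
      by (rule set_integrable_cong[OF refl refl d])
    ultimately have "vol_piece_integrable A (h t) c K" by (simp add: vol_piece_integrable_def im)
    moreover have "K \<in> sets borel" by (rule borel_closed[OF compact_imp_closed[OF compact_K]])
    ultimately have "vol_decomp A (h t) K 1 (\<lambda>_. c) (\<lambda>_. K)"
      using c Kc by (auto simp: vol_decomp_def disjoint_family_on_def)
    then have "variation_volume A p (\<lambda>t x. (t * \<eta> x, x)) K t = vol_piece A (h t) c K"
      using volume_eq[OF oriented riem_h[OF t]] by (simp add: variation_volume_def)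
    also have "\<dots> = (LINT y:C|lborel. dens c (t, y))"
      unfolding vol_piece_def im by (rule set_lebesgue_integral_cong) (use bC d in auto)
    finally show ?thesis .
  qed
  have "((\<lambda>t. LINT y:C|lborel. dens c (t, y)) has_real_derivative
      (LINT y:C|lborel. dir_deriv (1, 0) (dens c) (0, y))) (at 0)"
    by (rule DERIV_integral_smooth[OF smooth_dens[OF c] sub C(1) bC order_refl]) (use eps in simp)
  moreover have "(LINT y:C|lborel. dir_deriv (1, 0) (dens c) (0, y))
      = (LINT y:C|lborel. \<eta> (cinv c y) * trace (W c y) * vol_density A g c y)"
    by (rule set_lebesgue_integral_cong) (use bC C(2) time_derivative_dens[OF c] in auto)
  ultimately show ?thesis
    using vol eps
    by (auto intro!: has_field_derivative_transform_within_open[where S = "{-\<epsilon><..<\<epsilon>}" and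
          f = "\<lambda>t. LINT y:C|lborel. dens c (t, y)"])
qed

end

context immersed
begin

lemma traceless_if_stationary:
  assumes st: "volume_stationary A p" and c: "c \<in> A" and a: "a \<in> cran c"
  shows "trace (W c a) = 0"
proof (rule ccontr)
  assume ne: "trace (W c a) \<noteq> 0"
  note ch = chart[OF c]
  \<comment> \<open>Normalizes the sign, so that both signs of a nonzero trace are treated as
    positive.\<close>
  let ?s = "sgn (trace (W c a))"
  have "continuous_on (cran c) (\<lambda>y. ?s * trace (W c y))"
    unfolding trace_def
    by (intro continuous_on_mult continuous_on_const continuous_on_sum smooth_on_imp_continuous_on smooth_on_W c)
  then have "open (cran c \<inter> (\<lambda>y. ?s * trace (W c y)) -` {0<..})"
    using continuous_on_open_vimage[OF open_cran[OF ch]] by (metis Int_commute open_greaterThan)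
  moreover have "a \<in> cran c \<inter> (\<lambda>y. ?s * trace (W c y)) -` {0<..}"
    using a ne by (auto simp: sgn_mult_self_eq sgn_if)
  ultimately obtain r where r: "r > 0" "cball a r \<subseteq> cran c \<inter> (\<lambda>y. ?s * trace (W c y)) -` {0<..}"
    using open_contains_cball by blast
  let ?C = "cball a r"
  have C: "compact ?C" "?C \<subseteq> cran c" using r(2) by auto
  obtain \<eta> :: "real ^ 'n \<Rightarrow> real" where \<eta>: "smooth_on UNIV \<eta>" "\<And>y. 0 \<le> \<eta> y" "\<And>y. \<eta> y \<le> 1"
    "\<And>y. \<eta> y > 0 \<longleftrightarrow> y \<in> ball a r"
    using bump_function_exists[OF r(1)] by blast
  have zero: "\<eta> y = 0" if "y \<notin> ?C" for y using \<eta>(2,4)[of y] that by fastforce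
  define \<theta> where "\<theta> x = (if x \<in> cdom c then \<eta> (cmap c x) else 0)" for x
  obtain \<epsilon> where \<epsilon>: "\<epsilon> > 0" "\<And>s y. \<bar>s\<bar> < \<epsilon> \<Longrightarrow> y \<in> ?C \<Longrightarrow> det (mat 1 + s *\<^sub>R W c y) \<noteq> 0"
    using det_1_W_nonzero_uniform[OF c C] by blast
  let ?K = "cinv c ` ?C"
  have var: "variation A p \<epsilon> (\<lambda>t x. (t * \<theta> x, x))"
  proof (rule normal_variation[OF c \<epsilon>(1)])
    show "smooth_near A x \<theta>" for x
      unfolding \<theta>_def[abs_def] by (rule smooth_near_cutoff[OF c \<eta>(1) C zero])
    show "\<theta> x = 0" if "x \<notin> cdom c" for x using that by (simp add: \<theta>_def)
    fix t x assume t: "\<bar>t\<bar> < \<epsilon>" and x: "x \<in> cdom c"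
    show "det (mat 1 + (t * \<theta> x) *\<^sub>R W c (cmap c x)) \<noteq> 0"
    proof (cases "cmap c x \<in> ?C")
      case True
      \<comment> \<open>The bound \<eta> \<le> 1 keeps the height in the range where the determinant
        is nonzero.\<close>
      have "\<bar>t * \<eta> (cmap c x)\<bar> \<le> \<bar>t\<bar> * 1"
        unfolding abs_mult using \<eta>(2,3)[of "cmap c x"] by (intro mult_left_mono) auto
      then show ?thesis using \<epsilon>(2)[OF _ True, of "t * \<eta> (cmap c x)"] t x by (simp add: \<theta>_def)
    qed (simp add: \<theta>_def x zero)
  qed
  have "compact ?K"
    by (rule compact_continuous_image[OF continuous_on_subset[OF continuous_on_cinv[OF ch] C(2)] C(1)])
  moreover have "\<theta> x = 0" if "x \<notin> ?K" for x
    using that zero[of "cmap c x"] cinv_cmap[OF ch, of x] unfolding \<theta>_def by (metis image_eqI)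
  ultimately have sup: "variation_supported_in \<epsilon> (\<lambda>t x. (t * \<theta> x, x)) ?K"
    by (simp add: variation_supported_in_def)
  interpret nv: normal_variation A g p \<epsilon> \<theta> ?K
    by unfold_locales (rule var, rule sup)
  let ?I = "\<lambda>y. \<theta> (cinv c y) * trace (W c y) * vol_density A g c y"
  have "(variation_volume A p (\<lambda>t x. (t * \<theta> x, x)) ?K has_real_derivative 0) (at 0)"
    using st var sup unfolding volume_stationary_def by blast
  from DERIV_unique[OF this nv.DERIV_volume_normal[OF c C refl]]
  have I0: "set_lebesgue_integral lborel ?C ?I = 0" by simp
  have \<theta>: "\<theta> (cinv c y) = \<eta> y" if "y \<in> ?C" for y
    using that C(2) cinv_in_cdom[OF ch] cmap_cinv[OF ch] by (auto simp: \<theta>_def)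
  have v: "vol_density A g c y > 0" if "y \<in> ?C" for y
    using that C(2) det_H_pos[OF c] by (auto simp: vol_density_g[OF c])
  have cv: "continuous_on ?C (vol_density A g c)"
  proof -
    have "smooth_on (cran c) (\<lambda>y. sqrt (det (H c y)))"
      by (intro smooth_on_sqrt smooth_on_det open_cran ch smooth_on_H det_H_pos c)
    from continuous_on_subset[OF smooth_on_imp_continuous_on[OF this] C(2)] show ?thesis
      by (rule continuous_on_eq) (use C(2) vol_density_g[OF c] in auto)
  qed
  have "continuous_on ?C (\<lambda>y. ?s * (\<eta> y * trace (W c y) * vol_density A g c y))"
    unfolding trace_def
    by (intro continuous_on_mult continuous_on_const continuous_on_sum cv
        continuous_on_subset[OF smooth_on_imp_continuous_on[OF \<eta>(1)]]
        continuous_on_subset[OF smooth_on_imp_continuous_on[OF smooth_on_W[OF c]] C(2)]) auto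
  then have int: "set_integrable lborel ?C (\<lambda>y. ?s * (\<eta> y * trace (W c y) * vol_density A g c y))"
    by (rule set_integrable_continuous_compact[OF C(1) borel_compact[OF C(1)] order_refl])
  have e: "?s * (\<eta> y * trace (W c y) * vol_density A g c y)
      = \<eta> y * ((?s * trace (W c y)) * vol_density A g c y)" for y by simp
  have pos: "(?s * trace (W c y)) * vol_density A g c y > 0" if "y \<in> ?C" for y
  proof (rule mult_pos_pos[OF _ v[OF that]])
    have "y \<in> (\<lambda>y. ?s * trace (W c y)) -` {0<..}" using r(2) that by blast
    then show "?s * trace (W c y) > 0" by (simp only: vimage_eq greaterThan_iff)
  qed
  have "set_lebesgue_integral lborel ?C (\<lambda>y. ?s * (\<eta> y * trace (W c y) * vol_density A g c y)) \<noteq> 0"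
  proof (rule set_integral_pos[OF int r(1)])
    show "?s * (\<eta> y * trace (W c y) * vol_density A g c y) \<ge> 0" if "y \<in> ?C" for y
      unfolding e by (rule mult_nonneg_nonneg[OF \<eta>(2) less_imp_le[OF pos[OF that]]])
    show "?s * (\<eta> y * trace (W c y) * vol_density A g c y) > 0" if "y \<in> ball a r" for y
      unfolding e
      by (rule mult_pos_pos[OF \<eta>(4)[THEN iffD2, OF that] pos[OF subsetD[OF ball_subset_cball that]]])
  qed
  moreover have "set_lebesgue_integral lborel ?C (\<lambda>y. \<eta> y * trace (W c y) * vol_density A g c y) = 0"
  proof -
    have "set_lebesgue_integral lborel ?C (\<lambda>y. \<eta> y * trace (W c y) * vol_density A g c y)
        = set_lebesgue_integral lborel ?C ?I"
      by (rule set_lebesgue_integral_cong) (use \<theta> borel_compact[OF C(1)] in auto)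
    then show ?thesis using I0 by simp
  qed
  ultimately show False by simp
qed

lemma scalar_flat_if_stationary:
  assumes "volume_stationary A p"
  shows "scalar_curvature A g x = 0"
  using traceless_if_stationary[OF assms chart_at_props(1)[OF A] cmap_in_cran[OF chart_at_props(2)[OF A]]]
  by (simp add: scalar_curvature_eq)

end

theorem mainTheorem1:
  fixes A :: "('m::{t2_space, second_countable_topology}, real ^ 'n::finite) chart set"
    and g :: "'m tensor2"
    and p :: "'m \<Rightarrow> 'n minkowski"
  assumes "CARD('n) \<ge> 2"
    and "oriented_atlas A"
    and "riemannian_metric A g"
    and "conformally_flat A g"
    and "isometric_immersion_in_light_cone A g p"
  shows "((\<forall>x. scalar_curvature A g x = 0) \<longleftrightarrow> volume_stationary A p) \<and>
    ((\<forall>x. scalar_curvature A g x = 0) \<or> volume_stationary A p \<longrightarrow>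
      (\<forall>\<epsilon> G K. variation A p \<epsilon> G \<and> variation_supported_in \<epsilon> G K \<longrightarrow>
        (\<exists>D. has_second_real_derivative (variation_volume A p G K) D 0 \<and> D \<le> 0)))"
proof -
  interpret immersed A g p by unfold_locales (use assms in auto)
  \<comment> \<open>Scalar flatness yields both variational conclusions at once; stationarity, the
    other possible hypothesis of the second part, leads back to it.\<close>
  have flat_stationary: "(variation_volume A p G K has_real_derivative 0) (at 0) \<and>
      (\<exists>D. has_second_real_derivative (variation_volume A p G K) D 0 \<and> D \<le> 0)"
    if S: "\<forall>x. scalar_curvature A g x = 0" and v: "variation A p \<epsilon> G" "variation_supported_in \<epsilon> G K"
    for \<epsilon> G K
  proof -
    interpret varied A g p \<epsilon> G K by unfold_locales (rule v)+
    show ?thesis using variation_volume_stationary[OF traceless_if_scalar_flat[OF S]] by blast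
  qed
  have "volume_stationary A p" if "\<forall>x. scalar_curvature A g x = 0"
    unfolding volume_stationary_def using flat_stationary[OF that] by blast
  moreover have "\<forall>x. scalar_curvature A g x = 0" if "volume_stationary A p"
    using scalar_flat_if_stationary[OF that] by blast
  ultimately show ?thesis using flat_stationary by blast
qed

end
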